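(* Let $(X,g)$ be a $2$-dimensional smooth connected Riemannian manifold without boundary, with intrinsic metric $\rho_X$. Let $Y_1\subset X$ be a $2$-dimensional compact connected $C^0$-submanifold with nonempty boundary $\partial Y_1$ such that $\rho_{Y_1}(x,y)<\infty$ for all $x,y\in Y_1$ and such that $Y_1$ is strictly convex in the metric $\rho_{Y_1}$. Let $Y_2\subset X$ also be a $2$-dimensional compact connected $C^0$-submanifold with $\partial Y_2\neq\varnothing$ such that $\rho_{Y_2}(x,y)<\infty$ for all $x,y\in Y_2$. Suppose that $\partial Y_1$ and $\partial Y_2$ are isometric in the metrics $\rho_{Y_j}$, $j=1,2$, i.e. there is a bijection $f:\partial Y_1\to\partial Y_2$ with $\rho_{Y_2}(f(x),f(y))=\rho_{Y_1}(x,y)$ for all $x,y\in\partial Y_1$. Suppose moreover that $X$ has the following property: $\rho_X(x,y)=\rho_Y(x,y)$ for any two points $x$ and $y$ of every $2$-dimensional compact connected $C^0$-submanifold $Y\subset X$ with $\partial Y\neq\varnothing$ such that $\rho_Y$ is finite on $Y\times Y$ and $Y$ is strictly convex with respect to the metric $\rho_Y$. Then $\partial Y_1$ and $\partial Y_2$ are isometric in the metric $\rho_X$, i.e. there is a bijection $F:\partial Y_1\to\partial Y_2$ with $\rho_X(F(x),F(y))=\rho_X(x,y)$ for all $x,y\in\partial Y_1$.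
   Context: A $C^0$-submanifold with boundary of dimension $n=\dim X$ in $X$ is a subset of $X$ which, with the subspace topology, is a topological $n$-manifold with boundary. $\mathrm{Int}\,Y$ and $\partial Y$ denote its interior and boundary. $l$ denotes length with respect to $g$. $\rho_X(x,y)$ is the infimum of the lengths $l(\gamma)$ of smooth paths $\gamma:[0,1]\to X$ joining $x$ and $y$. For a $2$-dimensional compact connected $C^0$-submanifold $Y\subset X$ with nonempty boundary $\partial Y$ and $x,y\in Y$, $$\rho_Y(x,y)=\liminf_{x'\to x,\; y'\to y;\; x',y'\in \mathrm{Int}\,Y}\ \inf\{\, l(\gamma)\,\},$$ the infimum being over all smooth paths $\gamma:[0,1]\to\mathrm{Int}\,Y$ joining $x'$ to $y'$. (In dimension $2$, for compact connected $Y$ with nonempty boundary, if $\rho_Y$ is finite then it is a metric on $Y$.) All paths are assumed continuous and non-constant. A shortest path in the metric $\rho_Y$ between points $\alpha\ne\beta$ of $Y$ is a path $\gamma:[0,1]\to Y$ with $\gamma(0)=\alpha$, $\gamma(1)=\beta$ for which there is a strictly increasing continuous function $\varphi:[0,1]\to[0,\infty)$ with $\varphi(0)=0$ such that $\rho_Y(\gamma(s),\gamma(t))=\varphi(t)-\varphi(s)$ for all $0\le s\le t\le 1$. $Y$ is called strictly convex in the metric $\rho_Y$ if, for any $\alpha,\beta\in Y$, any shortest path $\gamma:[0,1]\to Y$ between $\alpha$ and $\beta$ (in the metric $\rho_Y$) satisfies $\gamma(]0,1[)\subset\mathrm{Int}\,Y$. *)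

theory Defs
  imports "HOL-Analysis.Analysis"
begin

section \<open>Smooth functions on open sets\<close>

text \<open>In finite dimensions, a function is of class \<open>C\<^sup>k\<^sup>+\<^sup>1\<close> iff it is differentiable and all its
  directional derivatives are of class \<open>C\<^sup>k\<close>.\<close>

primrec Ck_on :: "nat \<Rightarrow> 'a set \<Rightarrow> ('a::euclidean_space \<Rightarrow> 'b::euclidean_space) \<Rightarrow> bool" where
  "Ck_on 0 S f \<longleftrightarrow> continuous_on S f"
| "Ck_on (Suc k) S f \<longleftrightarrow>
     (\<forall>x\<in>S. f differentiable (at x)) \<and> (\<forall>v. Ck_on k S (\<lambda>x. frechet_derivative f (at x) v))"

definition smooth_on :: "'a set \<Rightarrow> ('a::euclidean_space \<Rightarrow> 'b::euclidean_space) \<Rightarrow> bool" where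
  "smooth_on S f \<longleftrightarrow> open S \<and> (\<forall>k. Ck_on k S f)"


section \<open>Smooth Riemannian surfaces\<close>

type_synonym 'a surface_chart = "'a set \<times> ('a \<Rightarrow> real^2)"

text \<open>The metric tensor is given by its coordinate expressions: \<open>metric M c p\<close> is the inner product
  at \<open>p\<close> on tangent vectors written in the coordinates of the chart \<open>c\<close>. The invariance of the
  tensor is the transformation law in \<open>riemannian_metric\<close> below. Values of \<open>metric\<close> for \<open>p\<close>
  outside the domain of \<open>c\<close> are irrelevant, and so are the values of a chart map outside its domain.\<close>

record 'a surface =
  space_of :: "'a topology"
  charts :: "'a surface_chart set"
  metric :: "'a surface_chart \<Rightarrow> 'a \<Rightarrow> real^2 \<Rightarrow> real^2 \<Rightarrow> real"

definition transition :: "'a surface_chart \<Rightarrow> 'a surface_chart \<Rightarrow> real^2 \<Rightarrow> real^2" where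
  "transition c d = snd d \<circ> inv_into (fst c) (snd c)"

definition smooth_atlas :: "'a topology \<Rightarrow> 'a surface_chart set \<Rightarrow> bool" where
  "smooth_atlas X A \<longleftrightarrow>
     (\<Union>c\<in>A. fst c) = topspace X \<and>
     (\<forall>(U, \<phi>)\<in>A. openin X U \<and> open (\<phi> ` U) \<and>
        homeomorphic_map (subtopology X U) (top_of_set (\<phi> ` U)) \<phi>) \<and>
     (\<forall>c\<in>A. \<forall>d\<in>A. smooth_on (snd c ` (fst c \<inter> fst d)) (transition c d))"

definition riemannian_metric ::
    "'a surface_chart set \<Rightarrow> ('a surface_chart \<Rightarrow> 'a \<Rightarrow> real^2 \<Rightarrow> real^2 \<Rightarrow> real) \<Rightarrow> bool" where
  "riemannian_metric A g \<longleftrightarrow>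
     (\<forall>c\<in>A. \<forall>p\<in>fst c. bilinear (g c p) \<and> (\<forall>v w. g c p v w = g c p w v) \<and>
        (\<forall>v. v \<noteq> 0 \<longrightarrow> 0 < g c p v v)) \<and>
     (\<forall>(U, \<phi>)\<in>A. \<forall>v w. smooth_on (\<phi> ` U) (\<lambda>u. g (U, \<phi>) (inv_into U \<phi> u) v w)) \<and>
     (\<forall>c\<in>A. \<forall>d\<in>A. \<forall>p\<in>fst c \<inter> fst d. \<forall>v w.
        let D = frechet_derivative (transition c d) (at (snd c p))
        in g c p v w = g d p (D v) (D w))"

definition connected_riemannian_surface :: "'a surface \<Rightarrow> bool" where
  "connected_riemannian_surface M \<longleftrightarrow>
     Hausdorff_space (space_of M) \<and> second_countable (space_of M) \<and>
     connected_space (space_of M) \<and>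
     smooth_atlas (space_of M) (charts M) \<and> riemannian_metric (charts M) (metric M)"


section \<open>Smooth paths, length and the intrinsic metric\<close>

text \<open>Smoothness on the closed interval means that, in every chart, the path is locally the
  restriction of a smooth function on an open interval. Paths are non-constant by convention.\<close>

definition smooth_path :: "'a surface \<Rightarrow> (real \<Rightarrow> 'a) \<Rightarrow> bool" where
  "smooth_path M \<gamma> \<longleftrightarrow>
     pathin (space_of M) \<gamma> \<and>
     (\<exists>s\<in>{0..1}. \<exists>t\<in>{0..1}. \<gamma> s \<noteq> \<gamma> t) \<and>
     (\<forall>(U, \<phi>)\<in>charts M. \<forall>t\<in>{0..1}. \<gamma> t \<in> U \<longrightarrow>
        (\<exists>\<delta>>0. \<exists>c. smooth_on {t - \<delta><..<t + \<delta>} c \<and>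
           (\<forall>s\<in>{0..1} \<inter> {t - \<delta><..<t + \<delta>}. \<gamma> s \<in> U \<and> c s = \<phi> (\<gamma> s))))"

text \<open>By the transformation law of the metric, the speed does not depend on the chosen chart.\<close>

definition speed :: "'a surface \<Rightarrow> (real \<Rightarrow> 'a) \<Rightarrow> real \<Rightarrow> real" where
  "speed M \<gamma> t =
     (let c = SOME c. c \<in> charts M \<and> \<gamma> t \<in> fst c;
          v = vector_derivative (snd c \<circ> \<gamma>) (at t within {0..1})
      in sqrt (metric M c (\<gamma> t) v v))"

definition path_len :: "'a surface \<Rightarrow> (real \<Rightarrow> 'a) \<Rightarrow> ennreal" where
  "path_len M \<gamma> = ennreal (integral {0..1} (speed M \<gamma>))"

text \<open>Infimum of the lengths of the smooth paths from \<open>x\<close> to \<open>y\<close> inside \<open>S\<close>; it is \<open>\<infinity>\<close> if there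
  is no such path.\<close>

definition inf_len :: "'a surface \<Rightarrow> 'a set \<Rightarrow> 'a \<Rightarrow> 'a \<Rightarrow> ennreal" where
  "inf_len M S x y =
     (INF \<gamma>\<in>{\<gamma>. smooth_path M \<gamma> \<and> \<gamma> ` {0..1} \<subseteq> S \<and> \<gamma> 0 = x \<and> \<gamma> 1 = y}. path_len M \<gamma>)"

definition rho_space :: "'a surface \<Rightarrow> 'a \<Rightarrow> 'a \<Rightarrow> ennreal" where
  "rho_space M x y = inf_len M (topspace (space_of M)) x y"


section \<open>Topological surfaces with boundary\<close>

definition half_plane :: "(real^2) set" where
  "half_plane = {x. 0 \<le> x $ 2}"

definition surface_with_boundary :: "'a topology \<Rightarrow> bool" where
  "surface_with_boundary T \<longleftrightarrow>
     Hausdorff_space T \<and> second_countable T \<and>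
     (\<forall>p\<in>topspace T. \<exists>U V. openin T U \<and> p \<in> U \<and> openin (top_of_set half_plane) V \<and>
        subtopology T U homeomorphic_space top_of_set V)"

text \<open>Interior and boundary here are those of the manifold with boundary itself, not of a subset of
  an ambient space.\<close>

definition manifold_interior :: "'a topology \<Rightarrow> 'a set" where
  "manifold_interior T =
     {p \<in> topspace T. \<exists>U V. openin T U \<and> p \<in> U \<and> open (V :: (real^2) set) \<and>
        subtopology T U homeomorphic_space top_of_set V}"

definition manifold_boundary :: "'a topology \<Rightarrow> 'a set" where
  "manifold_boundary T = topspace T - manifold_interior T"

abbreviation Int_of :: "'a surface \<Rightarrow> 'a set \<Rightarrow> 'a set" where
  "Int_of M Y \<equiv> manifold_interior (subtopology (space_of M) Y)"

abbreviation Bd_of :: "'a surface \<Rightarrow> 'a set \<Rightarrow> 'a set" where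
  "Bd_of M Y \<equiv> manifold_boundary (subtopology (space_of M) Y)"

definition compact_connected_C0_submanifold :: "'a surface \<Rightarrow> 'a set \<Rightarrow> bool" where
  "compact_connected_C0_submanifold M Y \<longleftrightarrow>
     Y \<subseteq> topspace (space_of M) \<and> surface_with_boundary (subtopology (space_of M) Y) \<and>
     compactin (space_of M) Y \<and> connectedin (space_of M) Y"


section \<open>The metric \<open>\<rho>\<^sub>Y\<close> and strict convexity\<close>

definition nhds_Int :: "'a surface \<Rightarrow> 'a set \<Rightarrow> 'a \<Rightarrow> 'a filter" where
  "nhds_Int M Y x = inf (nhdsin (space_of M) x) (principal (Int_of M Y))"

definition rho_sub :: "'a surface \<Rightarrow> 'a set \<Rightarrow> 'a \<Rightarrow> 'a \<Rightarrow> ennreal" where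
  "rho_sub M Y x y =
     Liminf (nhds_Int M Y x \<times>\<^sub>F nhds_Int M Y y) (\<lambda>(x', y'). inf_len M (Int_of M Y) x' y')"

definition shortest_path :: "'a surface \<Rightarrow> 'a set \<Rightarrow> 'a \<Rightarrow> 'a \<Rightarrow> (real \<Rightarrow> 'a) \<Rightarrow> bool" where
  "shortest_path M Y \<alpha> \<beta> \<gamma> \<longleftrightarrow>
     \<alpha> \<noteq> \<beta> \<and> pathin (subtopology (space_of M) Y) \<gamma> \<and> \<gamma> 0 = \<alpha> \<and> \<gamma> 1 = \<beta> \<and>
     (\<exists>\<phi> :: real \<Rightarrow> real. \<phi> \<in> {0..1} \<rightarrow> {0..} \<and> strict_mono_on {0..1} \<phi> \<and>
        continuous_on {0..1} \<phi> \<and> \<phi> 0 = 0 \<and>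
        (\<forall>s t. 0 \<le> s \<and> s \<le> t \<and> t \<le> 1 \<longrightarrow>
           rho_sub M Y (\<gamma> s) (\<gamma> t) = ennreal (\<phi> t - \<phi> s)))"

definition strictly_convex :: "'a surface \<Rightarrow> 'a set \<Rightarrow> bool" where
  "strictly_convex M Y \<longleftrightarrow>
     (\<forall>\<alpha>\<in>Y. \<forall>\<beta>\<in>Y. \<forall>\<gamma>. shortest_path M Y \<alpha> \<beta> \<gamma> \<longrightarrow> \<gamma> ` {0<..<1} \<subseteq> Int_of M Y)"

end

theory Submission
  imports Defs
begin

text \<open>It suffices that \<open>Y\<^sub>2\<close> is strictly convex, because the hypothesis on \<open>X\<close> then identifies both
  \<open>\<rho>\<^sub>Y\<^sub>j\<close> with \<open>\<rho>\<^sub>X\<close> and \<open>F = f\<close> works. On \<open>Y\<^sub>1\<close> the metric \<open>\<rho>\<^sub>X\<close> is compatible with the topology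
  and has midpoints, so three distinct boundary points with \<open>\<rho>(a, b) = \<rho>(a, c) + \<rho>(c, b)\<close> would yield
  a shortest path through \<open>c\<close>, against strict convexity; hence no such triple exists on \<open>\<partial>Y\<^sub>2\<close> either.
  If a shortest path \<open>\<gamma>\<close> of \<open>Y\<^sub>2\<close> meets \<open>\<partial>Y\<^sub>2\<close> at an inner time, then either it does so three times,
  which is such a triple, or the contact point \<open>p\<close> is isolated. In the latter case take boundary points
  \<open>q, q'\<close> near \<open>p\<close> on either side of it: by planar topology, every short path joining them crosses both
  halves of \<open>\<gamma>\<close>, so it cannot be shorter than a path through \<open>p\<close>, and \<open>q, p, q'\<close> is such a triple.\<close>

section \<open>Calculus of \<open>C\<^sup>k\<close> functions\<close>

text \<open>The obstacle is that little is known about \<open>rho_sub M Y2\<close> beforehand: it is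
  a liminf of lengths of interior paths, and neither its triangle inequality nor its continuity at
  the boundary comes for free. Apart from the given shortest path, metric information on
  \<open>Y2\<close> therefore comes from three sources only. Between boundary points, the isometry
  replaces \<open>rho_sub M Y2\<close> by \<open>rhoX\<close> on \<open>Y1\<close>. From below,
  \<open>rhoX\<close> bounds it, so that a short interior path cannot leave a chart. Finally, paths
  are cut and glued at interior points alone, around which short interior paths exist; the crossings
  with \<gamma> are such points because the competing path runs in the interior. Isolation of the
  contact p serves to keep the nearby boundary points q, q' off \<gamma>. On \<open>Y1\<close> the
  two metrics coincide, and each contributes one half of what a geodesic space needs:
  \<open>rhoX\<close> the triangle inequality and the topology, \<open>rho_sub\<close> near-shortest
  paths that remain in \<open>Y1\<close>.\<close>

lemma Ck_on_cong:
  assumes "open S" "\<And>x. x \<in> S \<Longrightarrow> f x = g x" "Ck_on k S f"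
  shows "Ck_on k S g"
  using assms
proof (induction k arbitrary: f g)
  case 0
  then have "continuous_on S f" "\<forall>x\<in>S. f x = g x" by auto
  then show ?case by (simp add: continuous_on_eq[of S f g])
next
  case (Suc k)
  \<comment> \<open>A derivative at a point depends only on the germ there; since S is open,
    agreement on S is agreement of germs.\<close>
  have D: "frechet_derivative g (at x) = frechet_derivative f (at x) \<and> g differentiable (at x)"
    if "x \<in> S" for x
  proof -
    have "(f has_derivative frechet_derivative f (at x)) (at x)"
      using Suc.prems that by (simp add: frechet_derivative_works)
    then have "(g has_derivative frechet_derivative f (at x)) (at x)"
      by (rule has_derivative_transform_within_open[OF _ Suc.prems(1) that])
        (use Suc.prems(2) in auto)
    then show ?thesis
      using differentiable_def frechet_derivative_at by metis
  qed
  show ?case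
    unfolding Ck_on.simps
  proof (intro conjI ballI allI)
    show "g differentiable (at x)" if "x \<in> S" for x using D that by blast
    show "Ck_on k S (\<lambda>x. frechet_derivative g (at x) v)" for v
      by (rule Suc.IH[of "\<lambda>x. frechet_derivative f (at x) v"]) (use Suc.prems D in auto)
  qed
qed

lemma Ck_on_subset: "Ck_on k S f \<Longrightarrow> T \<subseteq> S \<Longrightarrow> Ck_on k T f"
  by (induction k arbitrary: f) (auto intro: continuous_on_subset)

lemma differentiable_at_imp_continuous_on:
  "\<forall>x\<in>S. f differentiable (at x) \<Longrightarrow> continuous_on S f"
  by (meson continuous_at_imp_continuous_on differentiable_imp_continuous_within)

lemma Ck_on_imp_continuous_on: "Ck_on k S f \<Longrightarrow> continuous_on S f"
  using differentiable_at_imp_continuous_on by (cases k) auto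

lemma Ck_on_SucD: "Ck_on (Suc k) S f \<Longrightarrow> Ck_on k S f"
proof (induction k arbitrary: f)
  case 0
  then show ?case using Ck_on_imp_continuous_on by (metis Ck_on.simps(1))
next
  case (Suc k)
  from Ck_on.simps(2)[THEN iffD1, OF Suc.prems] have "\<forall>x\<in>S. f differentiable (at x)"
    and "\<And>v. Ck_on (Suc k) S (\<lambda>x. frechet_derivative f (at x) v)" by auto
  then show ?case by (subst Ck_on.simps(2)) (simp only: Suc.IH simp_thms)
qed

lemma Ck_on_const: "Ck_on k S (\<lambda>x. c)"
  by (induction k arbitrary: c) auto

lemma Ck_on_add:
  assumes "open S" "Ck_on k S f" "Ck_on k S g"
  shows "Ck_on k S (\<lambda>x. f x + g x)"
  using assms(2,3)
proof (induction k arbitrary: f g)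
  case 0
  then show ?case by (auto intro: continuous_on_add)
next
  case (Suc k)
  show ?case
    unfolding Ck_on.simps
  proof (intro conjI ballI allI)
    show "(\<lambda>x. f x + g x) differentiable (at x)" if "x \<in> S" for x
      using Suc.prems that by auto
    show "Ck_on k S (\<lambda>x. frechet_derivative (\<lambda>x. f x + g x) (at x) v)" for v
    proof (rule Ck_on_cong[OF assms(1)])
      show "frechet_derivative f (at x) v + frechet_derivative g (at x) v =
        frechet_derivative (\<lambda>x. f x + g x) (at x) v" if "x \<in> S" for x
        using Suc.prems that
        by (subst frechet_derivative_at[symmetric, OF has_derivative_add])
          (auto simp: frechet_derivative_works[symmetric])
      show "Ck_on k S (\<lambda>x. frechet_derivative f (at x) v + frechet_derivative g (at x) v)"
        by (rule Suc.IH) (use Suc.prems in auto)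
    qed
  qed
qed

lemma Ck_on_sum:
  assumes "open S" "finite I" "\<And>i. i \<in> I \<Longrightarrow> Ck_on k S (f i)"
  shows "Ck_on k S (\<lambda>x. \<Sum>i\<in>I. f i x)"
  using assms(2,3)
proof (induction I rule: finite_induct)
  case empty
  then show ?case by (simp add: Ck_on_const)
next
  case (insert i I)
  then show ?case by (simp add: Ck_on_add[OF assms(1)])
qed

lemma Ck_on_scaleR:
  fixes a :: "'a::euclidean_space \<Rightarrow> real"
  assumes "open S" "Ck_on k S a" "Ck_on k S f"
  shows "Ck_on k S (\<lambda>x. a x *\<^sub>R f x)"
  using assms(2,3)
proof (induction k arbitrary: a f)
  case 0
  then show ?case by (auto intro: continuous_on_scaleR)
next
  case (Suc k)
  have D: "((\<lambda>x. a x *\<^sub>R f x) has_derivative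
     (\<lambda>v. a x *\<^sub>R frechet_derivative f (at x) v + frechet_derivative a (at x) v *\<^sub>R f x)) (at x)"
    if "x \<in> S" for x
    by (rule has_derivative_scaleR)
      (use Suc.prems that in \<open>auto simp: frechet_derivative_works[symmetric]\<close>)
  show ?case
    unfolding Ck_on.simps
  proof (intro conjI ballI allI)
    show "(\<lambda>x. a x *\<^sub>R f x) differentiable (at x)" if "x \<in> S" for x
      using D[OF that] differentiable_def by blast
    show "Ck_on k S (\<lambda>x. frechet_derivative (\<lambda>x. a x *\<^sub>R f x) (at x) v)" for v
    proof (rule Ck_on_cong[OF assms(1)])
      show "a x *\<^sub>R frechet_derivative f (at x) v + frechet_derivative a (at x) v *\<^sub>R f x =
        frechet_derivative (\<lambda>x. a x *\<^sub>R f x) (at x) v" if "x \<in> S" for x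
        by (simp flip: frechet_derivative_at[OF D[OF that]])
      show "Ck_on k S (\<lambda>x. a x *\<^sub>R frechet_derivative f (at x) v +
          frechet_derivative a (at x) v *\<^sub>R f x)"
        using Suc.prems Ck_on_SucD[OF Suc.prems(1)] Ck_on_SucD[OF Suc.prems(2)]
        by (intro Ck_on_add assms(1) Suc.IH) auto
    qed
  qed
qed

lemma Ck_on_linear:
  assumes "bounded_linear L" shows "Ck_on k S L"
proof (cases k)
  case 0
  then show ?thesis using assms by (simp add: linear_continuous_on)
next
  case (Suc j)
  have "frechet_derivative L (at x) = L" for x
    by (rule frechet_derivative_at[OF bounded_linear_imp_has_derivative[OF assms], symmetric])
  then show ?thesis
    using assms Suc by (auto simp: Ck_on_const intro: bounded_linear_imp_differentiable)
qed

lemma Ck_on_linear_compose: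
  assumes "bounded_linear L" "open S" "Ck_on k S f"
  shows "Ck_on k S (\<lambda>x. L (f x))"
  using assms(3)
proof (induction k arbitrary: f)
  case 0
  then show ?case using assms bounded_linear.continuous_on by auto
next
  case (Suc k)
  have D: "((\<lambda>x. L (f x)) has_derivative (\<lambda>v. L (frechet_derivative f (at x) v))) (at x)"
    if "x \<in> S" for x
    by (rule bounded_linear.has_derivative[OF assms(1)])
      (use Suc.prems that in \<open>auto simp: frechet_derivative_works[symmetric]\<close>)
  show ?case
    unfolding Ck_on.simps
  proof (intro conjI ballI allI)
    show "(\<lambda>x. L (f x)) differentiable (at x)" if "x \<in> S" for x
      using D[OF that] differentiable_def by blast
    show "Ck_on k S (\<lambda>x. frechet_derivative (\<lambda>x. L (f x)) (at x) v)" for v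
    proof (rule Ck_on_cong[OF assms(2)])
      show "L (frechet_derivative f (at x) v) =
        frechet_derivative (\<lambda>x. L (f x)) (at x) v" if "x \<in> S" for x
        by (simp flip: frechet_derivative_at[OF D[OF that]])
      show "Ck_on k S (\<lambda>x. L (frechet_derivative f (at x) v))"
        using Suc by auto
    qed
  qed
qed

text \<open>Expanding f'(x) v in the basis turns the derivative of the composition into a sum of
  components of f' times directional derivatives of g taken along f. The latter are again
  compositions with the same f, so the induction varies g only.\<close>

lemma Ck_on_compose:
  fixes f :: "'a::euclidean_space \<Rightarrow> 'b::euclidean_space"
    and g :: "'b \<Rightarrow> 'c::euclidean_space"
  assumes "open S" "open T" "f ` S \<subseteq> T" "Ck_on k S f" "Ck_on k T g"
  shows "Ck_on k S (\<lambda>x. g (f x))"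
  using assms(4,5)
proof (induction k arbitrary: g)
  case 0
  then show ?case using assms(3) continuous_on_compose2 by auto
next
  case (Suc k)
  have D: "((\<lambda>x. g (f x)) has_derivative
      (\<lambda>v. frechet_derivative g (at (f x)) (frechet_derivative f (at x) v))) (at x)"
    if "x \<in> S" for x
  proof -
    have "f x \<in> T" using assms(3) that by auto
    then show ?thesis
      using has_derivative_compose[of f _ x UNIV g] Suc.prems that
      by (auto simp: frechet_derivative_works[symmetric])
  qed
  have S: "frechet_derivative g (at (f x)) (frechet_derivative f (at x) v) =
      (\<Sum>b\<in>Basis. (frechet_derivative f (at x) v \<bullet> b) *\<^sub>R frechet_derivative g (at (f x)) b)"
    if "x \<in> S" for x v
  proof -
    have "g differentiable (at (f x))" using assms(3) that Suc.prems by auto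
    then have L: "linear (frechet_derivative g (at (f x)))"
      by (rule linear_frechet_derivative)
    show ?thesis
      by (subst (1) euclidean_representation[of "frechet_derivative f (at x) v", symmetric])
        (simp only: linear_sum[OF L] linear_scale[OF L])
  qed
  show ?case
    unfolding Ck_on.simps
  proof (intro conjI ballI allI)
    show "(\<lambda>x. g (f x)) differentiable (at x)" if "x \<in> S" for x
      using D[OF that] differentiable_def by blast
    show "Ck_on k S (\<lambda>x. frechet_derivative (\<lambda>x. g (f x)) (at x) v)" for v
    proof (rule Ck_on_cong[OF assms(1)])
      show "(\<Sum>b\<in>Basis. (frechet_derivative f (at x) v \<bullet> b) *\<^sub>R frechet_derivative g (at (f x)) b)
        = frechet_derivative (\<lambda>x. g (f x)) (at x) v" if "x \<in> S" for x
        by (simp add: S[OF that] flip: frechet_derivative_at[OF D[OF that]])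
      show "Ck_on k S (\<lambda>x. \<Sum>b\<in>Basis.
          (frechet_derivative f (at x) v \<bullet> b) *\<^sub>R frechet_derivative g (at (f x)) b)"
        using Suc.prems Ck_on_SucD[OF Suc.prems(1)]
        by (intro Ck_on_sum Ck_on_scaleR Suc.IH assms(1) finite_Basis
            Ck_on_linear_compose[OF bounded_linear_inner_left]) auto
    qed
  qed
qed

lemma smooth_on_compose:
  assumes "smooth_on S f" "smooth_on T g" "f ` S \<subseteq> T"
  shows "smooth_on S (\<lambda>x. g (f x))"
  using assms Ck_on_compose[of S T f _ g] unfolding smooth_on_def by blast

lemma smooth_on_subset: "smooth_on S f \<Longrightarrow> open T \<Longrightarrow> T \<subseteq> S \<Longrightarrow> smooth_on T f"
  unfolding smooth_on_def using Ck_on_subset by blast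

lemma smooth_on_add: "smooth_on S f \<Longrightarrow> smooth_on S g \<Longrightarrow> smooth_on S (\<lambda>x. f x + g x)"
  unfolding smooth_on_def using Ck_on_add[of S _ f g] by blast

lemma smooth_on_const: "open S \<Longrightarrow> smooth_on S (\<lambda>x. c)"
  unfolding smooth_on_def by (simp add: Ck_on_const)

lemma smooth_on_linear: "open S \<Longrightarrow> bounded_linear L \<Longrightarrow> smooth_on S L"
  unfolding smooth_on_def by (simp add: Ck_on_linear)

lemma smooth_on_imp_differentiable: "smooth_on S f \<Longrightarrow> x \<in> S \<Longrightarrow> f differentiable (at x)"
  unfolding smooth_on_def by (drule conjunct2, drule spec[of _ "Suc 0"]) simp

lemma smooth_on_imp_continuous_on: "smooth_on S f \<Longrightarrow> continuous_on S f"
  unfolding smooth_on_def using Ck_on_imp_continuous_on by blast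

text \<open>In one variable the derivative in direction v is v times f', so one function has to be
  examined instead of one for each direction.\<close>

lemma Ck_on_Suc_realI:
  fixes f :: "real \<Rightarrow> 'b::euclidean_space"
  assumes "open S" "\<And>x. x \<in> S \<Longrightarrow> (f has_vector_derivative f' x) (at x)" "Ck_on k S f'"
  shows "Ck_on (Suc k) S f"
proof -
  have D: "frechet_derivative f (at x) = (\<lambda>v. v *\<^sub>R f' x)" if "x \<in> S" for x
    by (rule frechet_derivative_at[OF assms(2)[OF that, unfolded has_vector_derivative_def], symmetric])
  show ?thesis
    unfolding Ck_on.simps
  proof (intro conjI ballI allI)
    show "f differentiable (at x)" if "x \<in> S" for x
      using assms(2)[OF that] unfolding has_vector_derivative_def differentiable_def by blast
    show "Ck_on k S (\<lambda>x. frechet_derivative f (at x) v)" for v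
      by (rule Ck_on_cong[OF assms(1) _ Ck_on_scaleR[OF assms(1) Ck_on_const[of k S v] assms(3)]])
        (simp add: D)
  qed
qed

lemma smooth_on_vector_derivative:
  fixes f :: "real \<Rightarrow> 'b::euclidean_space"
  assumes "smooth_on S f"
  shows "continuous_on S (\<lambda>x. vector_derivative f (at x))"
    and "x \<in> S \<Longrightarrow> (f has_vector_derivative vector_derivative f (at x)) (at x)"
proof -
  have "Ck_on 1 S f" using assms by (auto simp: smooth_on_def)
  then have C: "continuous_on S (\<lambda>x. frechet_derivative f (at x) 1)"
    and d: "\<And>x. x \<in> S \<Longrightarrow> f differentiable (at x)" by auto
  have "frechet_derivative f (at x) 1 = vector_derivative f (at x)" if "x \<in> S" for x
    using fun_cong[OF frechet_derivative_eq_vector_derivative[OF d[OF that]], of 1] by simp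
  then show "continuous_on S (\<lambda>x. vector_derivative f (at x))"
    using C by (simp add: continuous_on_eq[of S "\<lambda>x. frechet_derivative f (at x) 1"])
  show "(f has_vector_derivative vector_derivative f (at x)) (at x)" if "x \<in> S"
    using d[OF that] vector_derivative_works by blast
qed

section \<open>A smooth step function\<close>

lemma poly_exp_tendsto_0: "((\<lambda>y::real. poly P y * exp (- y)) \<longlongrightarrow> 0) at_top"
proof -
  have "((\<lambda>y. \<Sum>i\<le>degree P. coeff P i * (y ^ i / exp y)) \<longlongrightarrow> (\<Sum>i\<le>degree P. coeff P i * 0)) at_top"
    by (intro tendsto_sum tendsto_mult tendsto_const tendsto_power_div_exp_0)
  moreover have "(\<Sum>i\<le>degree P. coeff P i * (y ^ i / exp y)) = poly P y * exp (- y)" for y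
    unfolding poly_altdef sum_distrib_right by (simp add: exp_minus divide_inverse mult_ac)
  ultimately show ?thesis by simp
qed

text \<open>The classical flat function exp(-1/x), extended by 0, with a polynomial factor in 1/x.
  The factor makes the family closed under differentiation, so that smoothness is an induction over
  all P at once.\<close>

definition flat :: "real poly \<Rightarrow> real \<Rightarrow> real" where
  "flat P x = (if x > 0 then poly P (inverse x) * exp (- inverse x) else 0)"

text \<open>With y = 1/x one has dy/dx = -y^2, so P(y) exp(-y) has derivative y^2 (P(y) - P'(y))
  exp(-y); the factor y^2 is \<open>[:0, 0, 1:]\<close>.\<close>

lemma flat_has_derivative:
  "(flat P has_real_derivative flat ([:0, 0, 1:] * (P - pderiv P)) x) (at x)"
proof -
  consider "x > 0" | "x < 0" | "x = 0" by linarith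
  then show ?thesis
  proof cases
    case 1
    have "((\<lambda>x. poly P (inverse x) * exp (- inverse x)) has_real_derivative
        flat ([:0, 0, 1:] * (P - pderiv P)) x) (at x)"
      using 1 by (auto intro!: derivative_eq_intros simp: flat_def field_simps power2_eq_square)
    then show ?thesis
      by (rule has_field_derivative_transform_within_open[where S="{0<..}"])
        (use 1 in \<open>auto simp: flat_def\<close>)
  next
    case 2
    have "((\<lambda>x. 0) has_real_derivative flat ([:0, 0, 1:] * (P - pderiv P)) x) (at x)"
      using 2 by (simp add: flat_def)
    then show ?thesis
      by (rule has_field_derivative_transform_within_open[where S="{..<0}"])
        (use 2 in \<open>auto simp: flat_def\<close>)
  next
    case 3
    have "((\<lambda>h. flat P h / h) \<longlongrightarrow> 0) (at_right 0)"
    proof -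
      \<comment> \<open>Dividing by h multiplies the polynomial by y = 1/h, which exp(-y) still
        beats.\<close>
      have "((\<lambda>h. poly ([:0, 1:] * P) (inverse h) * exp (- inverse h)) \<longlongrightarrow> 0) (at_right 0)"
        by (rule filterlim_compose[OF poly_exp_tendsto_0 filterlim_inverse_at_top_right])
      moreover have "\<forall>\<^sub>F h in at_right 0.
          poly ([:0, 1:] * P) (inverse h) * exp (- inverse h) = flat P h / h"
        by (auto simp: eventually_at_right_field flat_def field_simps intro!: exI[of _ 1])
      ultimately show ?thesis by (rule Lim_transform_eventually)
    qed
    moreover have "((\<lambda>h. flat P h / h) \<longlongrightarrow> 0) (at_left 0)"
      by (rule Lim_transform_eventually[OF tendsto_const])
        (auto simp: eventually_at_left_field flat_def intro!: exI[of _ "-1"])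
    ultimately have "((\<lambda>h. flat P h / h) \<longlongrightarrow> 0) (at 0)"
      by (simp add: filterlim_split_at)
    then show ?thesis using 3 by (simp add: DERIV_def flat_def)
  qed
qed

lemma Ck_on_flat: "Ck_on k UNIV (flat P)"
proof (induction k arbitrary: P)
  case 0
  then show ?case
    by (auto intro!: continuous_at_imp_continuous_on DERIV_isCont[OF flat_has_derivative])
next
  case (Suc k)
  show ?case
    by (rule Ck_on_Suc_realI[OF open_UNIV _ Suc.IH])
      (use flat_has_derivative has_real_derivative_iff_has_vector_derivative in blast)
qed

text \<open>The step is the normalised integral of a bump that is positive exactly on ]0,1[. The
  margins up to -1 and 2 make smoothness at 0 and 1 two-sided, so that all derivatives vanish
  there.\<close>

lemma smooth_step:
  obtains h h' :: "real \<Rightarrow> real"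
  where "smooth_on {-1<..<2} h"
    and "\<And>x. x \<in> {-1<..<2} \<Longrightarrow> (h has_real_derivative h' x) (at x)" "\<And>x. 0 \<le> h' x"
    and "\<And>x. -1 < x \<Longrightarrow> x \<le> 0 \<Longrightarrow> h x = 0" "\<And>x. 1 \<le> x \<Longrightarrow> x < 2 \<Longrightarrow> h x = 1"
    and "\<And>x. x \<in> {-1<..<2} \<Longrightarrow> h x \<in> {0..1}"
proof -
  define b where "b x = flat 1 x *\<^sub>R flat 1 (1 - x)" for x
  have flat0: "flat 1 x \<ge> 0" "x \<le> 0 \<Longrightarrow> flat 1 x = 0" "x > 0 \<Longrightarrow> flat 1 x > 0" for x
    by (auto simp: flat_def)
  have b0: "b x \<ge> 0" "x \<le> 0 \<Longrightarrow> b x = 0" "x \<ge> 1 \<Longrightarrow> b x = 0" for x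
    using flat0 by (auto simp: b_def)
  have aff: "Ck_on k UNIV (\<lambda>x::real. 1 - x)" for k
    using Ck_on_add[OF open_UNIV Ck_on_const Ck_on_linear[OF bounded_linear_minus[OF bounded_linear_ident]], of k 1]
    by simp
  have Cb: "Ck_on k UNIV b" for k
    unfolding b_def
    by (intro Ck_on_scaleR Ck_on_flat open_UNIV)
      (rule Ck_on_compose[OF open_UNIV open_UNIV _ aff Ck_on_flat], simp)
  have cont: "continuous_on S b" for S
    using Cb[of 0] continuous_on_subset by auto
  define J where "J = integral {-1..2} b"
  have int: "b integrable_on {x..y}" for x y
    using cont by (rule integrable_continuous_real)
  have J: "J > 0"
  proof -
    have "b (1/2) = 0" if "J = 0"
      using integral_eq_0_iff[OF cont[of "{-1..2}"]] b0(1) that unfolding J_def by auto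
    moreover have "b (1/2) > 0" using flat0(3)[of "1/2"] by (simp add: b_def)
    moreover have "J \<ge> 0" unfolding J_def by (rule integral_nonneg[OF int]) (use b0 in auto)
    ultimately show ?thesis by fastforce
  qed
  define h where "h x = integral {-1..x} b / J" for x
  have D: "(h has_real_derivative b x / J) (at x)" if "x \<in> {-1<..<2}" for x
  proof -
    have "((\<lambda>x. integral {-1..x} b) has_real_derivative b x) (at x within {-1..2})"
      by (rule integral_has_real_derivative[OF cont]) (use that in auto)
    moreover have "at x within {-1..2} = at x"
      by (rule at_within_interior) (use that in auto)
    ultimately show ?thesis unfolding h_def using J by (auto intro!: derivative_eq_intros)
  qed
  have split: "integral {-1..y} b = integral {-1..x} b + integral {x..y} b"
    if "-1 \<le> x" "x \<le> y" for x y
    using Henstock_Kurzweil_Integration.integral_combine[OF that int] by simp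
  have nn: "integral {x..y} b \<ge> 0" for x y
    by (rule integral_nonneg[OF int]) (use b0 in auto)
  have h0: "h x = 0" if "-1 < x" "x \<le> 0" for x
  proof -
    have "integral {-1..x} b = integral {-1..x} (\<lambda>x. 0)"
      by (rule integral_cong) (use b0 that in auto)
    then show ?thesis by (simp add: h_def)
  qed
  have h1: "h x = 1" if "1 \<le> x" "x < 2" for x
  proof -
    have "integral {x..2} b = integral {x..2} (\<lambda>x. 0)"
      by (rule integral_cong) (use b0 that in auto)
    then show ?thesis using split[of x 2] that J by (simp add: h_def J_def)
  qed
  have h01: "h x \<in> {0..1}" if "x \<in> {-1<..<2}" for x
    using split[of x 2] nn[of x 2] nn[of "-1" x] that J by (simp add: h_def J_def)
  have C: "Ck_on (Suc k) {-1<..<2} h" for k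
  proof (rule Ck_on_Suc_realI)
    show "(h has_vector_derivative b x / J) (at x)" if "x \<in> {-1<..<2}" for x
      using D[OF that] has_real_derivative_iff_has_vector_derivative by blast
    show "Ck_on k {-1<..<2} (\<lambda>x. b x / J)"
      by (rule Ck_on_subset[OF Ck_on_linear_compose[OF bounded_linear_divide open_UNIV Cb]]) simp
  qed simp
  have "Ck_on k {-1<..<2} h" for k
    by (rule Ck_on_SucD[OF C])
  then have "smooth_on {-1<..<2} h"
    by (simp add: smooth_on_def)
  then show ?thesis
    by (rule that[OF _ D _ h0 h1 h01]) (use b0 J in auto)
qed

section \<open>Charts and local smoothness\<close>

lemma continuous_interval_into_open:
  assumes "open (T :: 'b::euclidean_space set)" "continuous_on {t - \<delta><..<t + \<delta>} c" "\<delta> > 0" "c t \<in> T"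
  obtains \<delta>' where "0 < \<delta>'" "\<delta>' \<le> \<delta>" "\<And>s::real. s \<in> {t - \<delta>'<..<t + \<delta>'} \<Longrightarrow> c s \<in> T"
proof -
  have "isCont c t"
    using assms by (simp add: continuous_on_eq_continuous_at)
  then obtain \<delta>1 where "\<delta>1 > 0" "\<And>s. dist s t < \<delta>1 \<Longrightarrow> c s \<in> T"
    using assms(1,4) unfolding continuous_at_open
    by (metis (no_types, lifting) open_dist)
  then show ?thesis
    by (intro that[of "min \<delta> \<delta>1"]) (use assms in \<open>auto simp: dist_real_def\<close>)
qed

locale riemannian_surface =
  fixes M :: "'a surface"
  assumes crs: "connected_riemannian_surface M"
begin

abbreviation X :: "'a topology" where "X \<equiv> space_of M"

lemma Hausdorff_X: "Hausdorff_space X"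
  and smooth_atlas_X: "smooth_atlas X (charts M)"
  and riemannian_metric_M: "riemannian_metric (charts M) (metric M)"
  using crs by (auto simp: connected_riemannian_surface_def)

lemma chart:
  assumes "(U, \<phi>) \<in> charts M"
  shows chart_openin: "openin X U"
    and chart_open: "open (\<phi> ` U)"
    and chart_homeo: "homeomorphic_map (subtopology X U) (top_of_set (\<phi> ` U)) \<phi>"
    and chart_subset: "U \<subseteq> topspace X"
    and chart_inj: "inj_on \<phi> U"
proof -
  show *: "openin X U" "open (\<phi> ` U)"
    "homeomorphic_map (subtopology X U) (top_of_set (\<phi> ` U)) \<phi>"
    using smooth_atlas_X assms by (auto simp: smooth_atlas_def)
  show "U \<subseteq> topspace X" using * openin_subset by blast
  then show "inj_on \<phi> U" using homeomorphic_imp_injective_map[OF *(3)]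
    by (simp add: Int_absorb1)
qed

lemma chart_at:
  assumes "p \<in> topspace X"
  obtains U \<phi> where "(U, \<phi>) \<in> charts M" "p \<in> U"
proof -
  have "p \<in> (\<Union>c\<in>charts M. fst c)"
    using smooth_atlas_X assms by (simp add: smooth_atlas_def)
  then show ?thesis using that by auto
qed

lemma chart_image_open:
  assumes "(U, \<phi>) \<in> charts M" "openin X W"
  shows "open (\<phi> ` (U \<inter> W))"
proof -
  have "openin (subtopology X U) (U \<inter> W)"
    using assms(2) by (auto simp: openin_subtopology)
  then have "openin (top_of_set (\<phi> ` U)) (\<phi> ` (U \<inter> W))"
    using homeomorphic_map_openness_eq[OF chart_homeo[OF assms(1)]] by blast
  then show ?thesis using chart_open[OF assms(1)] openin_open_trans by blast
qed

lemma chart_inv_openin: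
  assumes "(U, \<phi>) \<in> charts M" "open V"
  shows "openin X (U \<inter> \<phi> -` V)"
proof -
  have "continuous_map (subtopology X U) euclidean \<phi>"
    using homeomorphic_imp_continuous_map[OF chart_homeo[OF assms(1)]]
      continuous_map_into_fulltopology by blast
  then have "openin (subtopology X U) {x \<in> topspace (subtopology X U). \<phi> x \<in> V}"
    using assms(2) openin_continuous_map_preimage open_openin by blast
  moreover have "{x \<in> topspace (subtopology X U). \<phi> x \<in> V} = U \<inter> \<phi> -` V"
    using chart_subset[OF assms(1)] by auto
  ultimately show ?thesis using chart_openin[OF assms(1)] openin_trans_full by fastforce
qed

lemma chart_inv_compactin:
  assumes "(U, \<phi>) \<in> charts M" "compact K" "K \<subseteq> \<phi> ` U"
  shows "compactin X (U \<inter> \<phi> -` K)"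
proof -
  have hm: "homeomorphic_map (subtopology X U) (top_of_set (\<phi> ` U)) \<phi>"
    using chart_homeo[OF assms(1)] .
  have "\<phi> ` (U \<inter> \<phi> -` K) = K" using assms(3) by auto
  then have "compactin (subtopology X U) (U \<inter> \<phi> -` K)"
    unfolding homeomorphic_map_compactness_eq[OF hm]
    using assms chart_subset[OF assms(1)] by (auto simp: compactin_subtopology)
  then show ?thesis by (simp add: compactin_subtopology)
qed

text \<open>A preimage under a chart is a priori closed in U only; compactness and the Hausdorff
  property make it closed in X. In \<open>inf_len_escape\<close> this prevents a path from leaving
  the chart while its coordinates stay in a small ball.\<close>

lemma chart_closed_preimage:
  assumes "(U, \<phi>) \<in> charts M" "compact K" "K \<subseteq> \<phi> ` U"
  shows "closedin X (U \<inter> \<phi> -` K)"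
  using chart_inv_compactin[OF assms] Hausdorff_X compactin_imp_closedin by blast

lemma transition_smooth:
  assumes "(U, \<phi>) \<in> charts M" "(V, \<psi>) \<in> charts M"
  shows "smooth_on (\<phi> ` (U \<inter> V)) (transition (U, \<phi>) (V, \<psi>))"
proof -
  have "\<forall>c\<in>charts M. \<forall>d\<in>charts M. smooth_on (snd c ` (fst c \<inter> fst d)) (transition c d)"
    using smooth_atlas_X by (simp add: smooth_atlas_def)
  from this[rule_format, OF assms] show ?thesis by simp
qed

lemma transition_apply:
  assumes "(U, \<phi>) \<in> charts M" "p \<in> U"
  shows "transition (U, \<phi>) (V, \<psi>) (\<phi> p) = \<psi> p"
  using chart_inj[OF assms(1)] assms(2) by (simp add: transition_def)

text \<open>One chart around \<gamma> t suffices here, whereas \<open>smooth_path\<close> quantifies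
  over all charts. \<open>smooth_atE\<close> moves to any other chart and
  \<open>smooth_path_iff\<close> recovers the original notion, so a new path has to be tested in one
  convenient chart per time.\<close>

definition smooth_at :: "(real \<Rightarrow> 'a) \<Rightarrow> real \<Rightarrow> bool" where
  "smooth_at \<gamma> t \<longleftrightarrow> (\<exists>U \<phi> \<delta> c. (U, \<phi>) \<in> charts M \<and> \<gamma> t \<in> U \<and> \<delta> > 0 \<and>
     smooth_on {t - \<delta><..<t + \<delta>} c \<and>
     (\<forall>s\<in>{0..1} \<inter> {t - \<delta><..<t + \<delta>}. \<gamma> s \<in> U \<and> c s = \<phi> (\<gamma> s)))"

lemma smooth_atI:
  assumes "(U, \<phi>) \<in> charts M" "\<gamma> t \<in> U" "\<delta> > 0" "smooth_on {t - \<delta><..<t + \<delta>} c"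
    and "\<And>s. s \<in> {0..1} \<Longrightarrow> s \<in> {t - \<delta><..<t + \<delta>} \<Longrightarrow> \<gamma> s \<in> U \<and> c s = \<phi> (\<gamma> s)"
  shows "smooth_at \<gamma> t"
  unfolding smooth_at_def using assms by blast

lemma smooth_at_in_topspace: "smooth_at \<gamma> t \<Longrightarrow> \<gamma> t \<in> topspace X"
  unfolding smooth_at_def using chart_subset by blast

text \<open>The interval is shrunk until the extension stays in the image of the overlap, where it
  can be composed with the transition map. The new extension is controlled also at times outside
  [0,1], at which \<gamma> gives no information; continuity of the speed uses this.\<close>

lemma smooth_atE:
  assumes "smooth_at \<gamma> t" "t \<in> {0..1}" "(V, \<psi>) \<in> charts M" "\<gamma> t \<in> V" "openin X W" "\<gamma> t \<in> W"
  obtains \<delta> c where "\<delta> > 0" "smooth_on {t - \<delta><..<t + \<delta>} c"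
    "\<And>s. s \<in> {0..1} \<Longrightarrow> s \<in> {t - \<delta><..<t + \<delta>} \<Longrightarrow> \<gamma> s \<in> V \<and> \<gamma> s \<in> W \<and> c s = \<psi> (\<gamma> s)"
    "\<And>s. s \<in> {t - \<delta><..<t + \<delta>} \<Longrightarrow> c s \<in> \<psi> ` (V \<inter> W)"
proof -
  obtain U \<phi> \<delta> c where c: "(U, \<phi>) \<in> charts M" "\<gamma> t \<in> U" "\<delta> > 0" "smooth_on {t - \<delta><..<t + \<delta>} c"
     "\<And>s. s\<in>{0..1} \<inter> {t - \<delta><..<t + \<delta>} \<Longrightarrow> \<gamma> s \<in> U \<and> c s = \<phi> (\<gamma> s)"
    using assms(1) unfolding smooth_at_def by blast
  let ?T = "\<phi> ` (U \<inter> (V \<inter> W))"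
  have o: "open ?T"
    by (rule chart_image_open[OF c(1)]) (use assms chart_openin in blast)
  have "c t = \<phi> (\<gamma> t)" using c assms by auto
  then have "c t \<in> ?T" using assms c by auto
  then obtain \<delta>' where d: "0 < \<delta>'" "\<delta>' \<le> \<delta>" and T: "\<And>s. s \<in> {t - \<delta>'<..<t + \<delta>'} \<Longrightarrow> c s \<in> ?T"
    using continuous_interval_into_open[OF o smooth_on_imp_continuous_on[OF c(4)] c(3)] by metis
  have sm: "smooth_on {t - \<delta>'<..<t + \<delta>'} (\<lambda>s. transition (U, \<phi>) (V, \<psi>) (c s))"
  proof (rule smooth_on_compose[OF smooth_on_subset[OF c(4)] transition_smooth[OF c(1) assms(3)]])
    show "c ` {t - \<delta>'<..<t + \<delta>'} \<subseteq> \<phi> ` (U \<inter> V)" using T by blast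
  qed (use d in auto)
  show ?thesis
  proof (rule that[OF d(1) sm])
    fix s assume s: "s \<in> {t - \<delta>'<..<t + \<delta>'}"
    obtain q where q: "q \<in> U" "q \<in> V" "q \<in> W" "c s = \<phi> q" using T[OF s] by auto
    then show "transition (U, \<phi>) (V, \<psi>) (c s) \<in> \<psi> ` (V \<inter> W)"
      by (simp add: transition_apply[OF c(1)])
    assume "s \<in> {0..1}"
    then have s1: "\<gamma> s \<in> U" "c s = \<phi> (\<gamma> s)" using c(5) s d by auto
    with q chart_inj[OF c(1)] have "\<gamma> s = q" by (metis inj_on_eq_iff)
    then show "\<gamma> s \<in> V \<and> \<gamma> s \<in> W \<and> transition (U, \<phi>) (V, \<psi>) (c s) = \<psi> (\<gamma> s)"
      using q s1 by (simp add: transition_apply[OF c(1)])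
  qed
qed

text \<open>Continuity need not be demanded on the right: \<open>smooth_atE\<close> accepts any open
  W around \<gamma> t and keeps \<gamma> in W for nearby times.\<close>

lemma smooth_path_iff:
  "smooth_path M \<gamma> \<longleftrightarrow>
     (\<exists>s\<in>{0..1}. \<exists>t\<in>{0..1}. \<gamma> s \<noteq> \<gamma> t) \<and> (\<forall>t\<in>{0..1}. smooth_at \<gamma> t)"
  (is "?L \<longleftrightarrow> ?N \<and> ?R")
proof
  assume L: ?L
  have "smooth_at \<gamma> t" if t: "t \<in> {0..1}" for t
  proof -
    have "continuous_map (top_of_set {0..1}) X \<gamma>"
      using L unfolding smooth_path_def pathin_def by blast
    then have "\<gamma> t \<in> topspace X"
      using t by (auto dest!: continuous_map_image_subset_topspace)
    then obtain U \<phi> where U: "(U, \<phi>) \<in> charts M" "\<gamma> t \<in> U" using chart_at by blast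
    then obtain \<delta> c where "\<delta>>0" "smooth_on {t - \<delta><..<t + \<delta>} c"
           "\<forall>s\<in>{0..1} \<inter> {t - \<delta><..<t + \<delta>}. \<gamma> s \<in> U \<and> c s = \<phi> (\<gamma> s)"
      using L t unfolding smooth_path_def by fast
    then show ?thesis using U by (intro smooth_atI[of U \<phi> \<gamma> t \<delta> c]) auto
  qed
  then show "?N \<and> ?R" using L unfolding smooth_path_def by blast
next
  assume R: "?N \<and> ?R"
  have "pathin X \<gamma>"
    unfolding pathin_def continuous_map_def
  proof (intro conjI allI impI)
    show "\<gamma> \<in> topspace (top_of_set {0..1}) \<rightarrow> topspace X"
      using R smooth_at_in_topspace by auto
    fix W assume W: "openin X W"
    have "\<exists>e>0. \<forall>s\<in>{0..1}. dist s t < e \<longrightarrow> \<gamma> s \<in> W" if t: "t \<in> {0..1}" "\<gamma> t \<in> W" for t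
    proof -
      have st: "smooth_at \<gamma> t" using R t by blast
      then obtain U \<phi> where U: "(U, \<phi>) \<in> charts M" "\<gamma> t \<in> U" unfolding smooth_at_def by blast
      obtain \<delta> c where "\<delta> > 0" "\<And>s. s \<in> {0..1} \<Longrightarrow> s \<in> {t - \<delta><..<t + \<delta>} \<Longrightarrow> \<gamma> s \<in> W"
        by (rule smooth_atE[OF st t(1) U W t(2)]) blast
      then show ?thesis by (intro exI[of _ \<delta>]) (auto simp: dist_real_def abs_less_iff)
    qed
    then show "openin (top_of_set {0..1}) {x \<in> topspace (top_of_set {0..1}). \<gamma> x \<in> W}"
      by (auto simp: openin_euclidean_subtopology_iff)
  qed
  moreover have "\<forall>(U, \<phi>)\<in>charts M. \<forall>t\<in>{0..1}. \<gamma> t \<in> U \<longrightarrow>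
        (\<exists>\<delta>>0. \<exists>c. smooth_on {t - \<delta><..<t + \<delta>} c \<and>
           (\<forall>s\<in>{0..1} \<inter> {t - \<delta><..<t + \<delta>}. \<gamma> s \<in> U \<and> c s = \<phi> (\<gamma> s)))"
  proof (intro ballI impI, clarify)
    fix U \<phi> t assume U: "(U, \<phi>) \<in> charts M" "\<gamma> t \<in> U" and t: "t \<in> {0..1::real}"
    have st: "smooth_at \<gamma> t" using R t by blast
    obtain \<delta> c where "\<delta> > 0" "smooth_on {t - \<delta><..<t + \<delta>} c"
      "\<And>s. s \<in> {0..1} \<Longrightarrow> s \<in> {t - \<delta><..<t + \<delta>} \<Longrightarrow> \<gamma> s \<in> U \<and> c s = \<phi> (\<gamma> s)"
      by (rule smooth_atE[OF st t U chart_openin[OF U(1)] U(2)]) blast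
    then show "\<exists>\<delta>>0. \<exists>c. smooth_on {t - \<delta><..<t + \<delta>} c \<and>
           (\<forall>s\<in>{0..1} \<inter> {t - \<delta><..<t + \<delta>}. \<gamma> s \<in> U \<and> c s = \<phi> (\<gamma> s))" by blast
  qed
  ultimately show ?L using R unfolding smooth_path_def by blast
qed

lemma smooth_path_smooth_at: "smooth_path M \<gamma> \<Longrightarrow> t \<in> {0..1} \<Longrightarrow> smooth_at \<gamma> t"
  using smooth_path_iff by blast

text \<open>Only times in [0,1] have to be mapped into [0,1]. Where h overshoots, the local
  extension of \<sigma> takes over, which covers the end points.\<close>

lemma smooth_at_compose:
  assumes "smooth_path M \<sigma>" "\<delta> > 0" "smooth_on {t - \<delta><..<t + \<delta>} h" "t \<in> {0..1}"
    and "\<And>s. s \<in> {0..1} \<Longrightarrow> s \<in> {t - \<delta><..<t + \<delta>} \<Longrightarrow> h s \<in> {0..1} \<and> \<gamma> s = \<sigma> (h s)"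
  shows "smooth_at \<gamma> t"
proof -
  have "t \<in> {t - \<delta><..<t + \<delta>}" using assms(2) by simp
  from assms(5)[OF assms(4) this] have ht: "h t \<in> {0..1}" "\<gamma> t = \<sigma> (h t)" by blast+
  obtain U \<phi> \<delta>1 c where c: "(U, \<phi>) \<in> charts M" "\<sigma> (h t) \<in> U" "\<delta>1 > 0"
     "smooth_on {h t - \<delta>1<..<h t + \<delta>1} c"
     "\<And>s. s\<in>{0..1} \<inter> {h t - \<delta>1<..<h t + \<delta>1} \<Longrightarrow> \<sigma> s \<in> U \<and> c s = \<phi> (\<sigma> s)"
    using smooth_path_smooth_at[OF assms(1) ht(1)] unfolding smooth_at_def by blast
  have "h t \<in> {h t - \<delta>1<..<h t + \<delta>1}" using c(3) by simp
  from continuous_interval_into_open[OF open_greaterThanLessThan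
      smooth_on_imp_continuous_on[OF assms(3)] assms(2) this]
  obtain \<delta>' where d: "0 < \<delta>'" "\<delta>' \<le> \<delta>"
    and T: "\<And>s. s \<in> {t - \<delta>'<..<t + \<delta>'} \<Longrightarrow> h s \<in> {h t - \<delta>1<..<h t + \<delta>1}"
    by blast
  show ?thesis
  proof (rule smooth_atI[OF c(1)])
    show "smooth_on {t - \<delta>'<..<t + \<delta>'} (\<lambda>s. c (h s))"
      by (rule smooth_on_compose[OF smooth_on_subset[OF assms(3)] c(4)]) (use d T in auto)
    show "\<gamma> s \<in> U \<and> c (h s) = \<phi> (\<gamma> s)" if "s \<in> {0..1}" "s \<in> {t - \<delta>'<..<t + \<delta>'}" for s
    proof -
      have "s \<in> {t - \<delta><..<t + \<delta>}" using that d by auto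
      from assms(5)[OF that(1) this] c(5)[of "h s"] T[OF that(2)] show ?thesis by simp
    qed
    show "\<gamma> t \<in> U" using c(2) ht(2) by simp
  qed (fact d)
qed

section \<open>Speed in a chart\<close>

lemma metric_pointwise:
  assumes "(U, \<phi>) \<in> charts M" "p \<in> U"
  shows metric_bilinear: "bilinear (metric M (U, \<phi>) p)"
    and metric_pos: "v \<noteq> 0 \<Longrightarrow> 0 < metric M (U, \<phi>) p v v"
proof -
  have "\<forall>c\<in>charts M. \<forall>p\<in>fst c. bilinear (metric M c p) \<and>
      (\<forall>v w. metric M c p v w = metric M c p w v) \<and> (\<forall>v. v \<noteq> 0 \<longrightarrow> 0 < metric M c p v v)"
    using riemannian_metric_M unfolding riemannian_metric_def by (elim conjE)
  from this[rule_format, OF assms(1), unfolded fst_conv, OF assms(2)]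
  show "bilinear (metric M (U, \<phi>) p)" "v \<noteq> 0 \<Longrightarrow> 0 < metric M (U, \<phi>) p v v" by auto
qed

lemma metric_scale:
  assumes "(U, \<phi>) \<in> charts M" "p \<in> U"
  shows "metric M (U, \<phi>) p (a *\<^sub>R v) (a *\<^sub>R v) = a\<^sup>2 * metric M (U, \<phi>) p v v"
  using metric_bilinear[OF assms] by (simp add: bilinear_lmul bilinear_rmul power2_eq_square)

lemma metric_nonneg:
  assumes "(U, \<phi>) \<in> charts M" "p \<in> U"
  shows "0 \<le> metric M (U, \<phi>) p v v"
  using metric_pos[OF assms, of v] metric_scale[OF assms, of 0 v] by (cases "v = 0") auto

lemma metric_smooth:
  assumes "(U, \<phi>) \<in> charts M"
  shows "smooth_on (\<phi> ` U) (\<lambda>u. metric M (U, \<phi>) (inv_into U \<phi> u) v w)"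
proof -
  have "\<forall>(U, \<phi>)\<in>charts M. \<forall>v w. smooth_on (\<phi> ` U) (\<lambda>u. metric M (U, \<phi>) (inv_into U \<phi> u) v w)"
    using riemannian_metric_M unfolding riemannian_metric_def by (elim conjE)
  then show ?thesis using assms by blast
qed

lemma metric_transform:
  assumes "(U, \<phi>) \<in> charts M" "(V, \<psi>) \<in> charts M" "p \<in> U" "p \<in> V"
  shows "metric M (U, \<phi>) p v w = metric M (V, \<psi>) p
    (frechet_derivative (transition (U, \<phi>) (V, \<psi>)) (at (\<phi> p)) v)
    (frechet_derivative (transition (U, \<phi>) (V, \<psi>)) (at (\<phi> p)) w)"
proof -
  have "\<forall>c\<in>charts M. \<forall>d\<in>charts M. \<forall>p\<in>fst c \<inter> fst d. \<forall>v w.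
        let D = frechet_derivative (transition c d) (at (snd c p))
        in metric M c p v w = metric M d p (D v) (D w)"
    using riemannian_metric_M unfolding riemannian_metric_def by (elim conjE)
  from this[rule_format, OF assms(1,2), of p v w] assms(3,4) show ?thesis
    by (simp add: Let_def)
qed

text \<open>\<open>riemannian_metric\<close> provides smoothness in the base point for each fixed
  pair of vectors; bilinearity and a finite basis upgrade this to continuity in base point and
  vector together.\<close>

lemma metric_continuous:
  assumes "(U, \<phi>) \<in> charts M"
  shows "continuous_on (\<phi> ` U \<times> UNIV) (\<lambda>z. metric M (U, \<phi>) (inv_into U \<phi> (fst z)) (snd z) (snd z))"
proof -
  let ?g = "metric M (U, \<phi>)"
  let ?h = "\<lambda>z. \<Sum>(i, j)\<in>Basis\<times>Basis. (snd z \<bullet> i) * ((snd z \<bullet> j) * ?g (inv_into U \<phi> (fst z)) i j)"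
  have "?g p v v = (\<Sum>(i, j)\<in>Basis\<times>Basis. (v \<bullet> i) * ((v \<bullet> j) * ?g p i j))" if "p \<in> U" for p v
  proof -
    have b: "bilinear (?g p)" by (rule metric_bilinear[OF assms that])
    have "?g p v v = ?g p (\<Sum>i\<in>Basis. (v \<bullet> i) *\<^sub>R i) (\<Sum>i\<in>Basis. (v \<bullet> i) *\<^sub>R i)"
      by (simp add: euclidean_representation)
    also have "\<dots> = (\<Sum>(i, j)\<in>Basis\<times>Basis. (v \<bullet> i) * ((v \<bullet> j) * ?g p i j))"
      by (subst bilinear_sum[OF b])
        (auto intro!: sum.cong simp: bilinear_lmul[OF b] bilinear_rmul[OF b])
    finally show ?thesis .
  qed
  moreover have "continuous_on (\<phi> ` U \<times> UNIV) ?h"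
    unfolding split_def
    by (intro continuous_intros continuous_on_compose2[OF smooth_on_imp_continuous_on[OF metric_smooth[OF assms]]])
      auto
  ultimately show ?thesis
    by (subst continuous_on_cong[OF refl, of _ _ ?h]) (auto simp: inv_into_into)
qed

text \<open>\<open>speed\<close> takes its chart from \<open>SOME\<close>. The chain rule for the
  transition map converts the velocity in the given chart into that of the chosen one, and the
  transformation law of the metric absorbs the conversion.\<close>

lemma speed_eq:
  assumes "(U, \<phi>) \<in> charts M" "\<gamma> t \<in> U" "t \<in> {0..1}" "smooth_at \<gamma> t"
    and v: "((\<lambda>s. \<phi> (\<gamma> s)) has_vector_derivative v) (at t within {0..1})"
  shows "speed M \<gamma> t = sqrt (metric M (U, \<phi>) (\<gamma> t) v v)"
proof -
  define d where "d = (SOME c. c \<in> charts M \<and> \<gamma> t \<in> fst c)"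
  obtain V \<psi> where d: "d = (V, \<psi>)" by force
  have "d \<in> charts M \<and> \<gamma> t \<in> fst d"
    unfolding d_def by (rule someI[of _ "(U, \<phi>)"]) (use assms in auto)
  then have V: "(V, \<psi>) \<in> charts M" "\<gamma> t \<in> V" using d by auto
  let ?T = "transition (U, \<phi>) (V, \<psi>)"
  let ?D = "frechet_derivative ?T (at (\<phi> (\<gamma> t)))"
  obtain \<delta> c where \<delta>: "\<delta> > 0" "\<And>s. s \<in> {0..1} \<Longrightarrow> s \<in> {t - \<delta><..<t + \<delta>} \<Longrightarrow> \<gamma> s \<in> U"
    by (rule smooth_atE[OF assms(4,3,1,2) chart_openin[OF V(1)] V(2)]) blast
  have "?T differentiable (at (\<phi> (\<gamma> t)))"
    by (rule smooth_on_imp_differentiable[OF transition_smooth[OF assms(1) V(1)]])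
      (use assms V in auto)
  then have "(?T has_derivative ?D) (at (\<phi> (\<gamma> t)))" by (simp add: frechet_derivative_works)
  then have "((\<lambda>s. ?T (\<phi> (\<gamma> s))) has_derivative (\<lambda>r. ?D (r *\<^sub>R v))) (at t within {0..1})"
    by (rule has_derivative_compose[OF v[unfolded has_vector_derivative_def]])
  moreover have "linear ?D"
    by (rule linear_frechet_derivative) fact
  ultimately have "((\<lambda>s. ?T (\<phi> (\<gamma> s))) has_vector_derivative ?D v) (at t within {0..1})"
    by (simp add: has_vector_derivative_def linear_scale)
  then have "((\<psi> \<circ> \<gamma>) has_vector_derivative ?D v) (at t within {0..1})"
    by (rule has_vector_derivative_transform_within[OF _ \<delta>(1) assms(3)])
      (use \<delta>(2) transition_apply[OF assms(1)] in \<open>auto simp: dist_real_def abs_less_iff\<close>)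
  then have "vector_derivative (\<psi> \<circ> \<gamma>) (at t within {0..1}) = ?D v"
    using assms(3) by (intro vector_derivative_within_closed_interval) auto
  then have "speed M \<gamma> t = sqrt (metric M (V, \<psi>) (\<gamma> t) (?D v) (?D v))"
    by (simp add: speed_def Let_def d flip: d_def)
  then show ?thesis
    using metric_transform[OF assms(1) V(1) assms(2) V(2), of v v] by simp
qed

text \<open>At 0 and 1 the derivative within [0,1] is one-sided; a differentiable local extension
  gives the same vector through an ordinary derivative.\<close>

lemma speed_eq_extension:
  assumes "(U, \<phi>) \<in> charts M" "t \<in> {0..1}" "smooth_at \<gamma> t" "\<delta> > 0"
    and "\<And>s. s \<in> {0..1} \<Longrightarrow> s \<in> {t - \<delta><..<t + \<delta>} \<Longrightarrow> \<gamma> s \<in> U \<and> c s = \<phi> (\<gamma> s)"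
    and "(c has_vector_derivative v) (at t)"
  shows "speed M \<gamma> t = sqrt (metric M (U, \<phi>) (\<gamma> t) v v)"
proof (rule speed_eq[OF assms(1) _ assms(2,3)])
  show "\<gamma> t \<in> U" using assms(5)[OF assms(2)] assms(4) by auto
  show "((\<lambda>s. \<phi> (\<gamma> s)) has_vector_derivative v) (at t within {0..1})"
    by (rule has_vector_derivative_transform_within[OF
          has_vector_derivative_at_within[OF assms(6)] assms(4,2)])
      (use assms(5) in \<open>auto simp: dist_real_def abs_less_iff\<close>)
qed

lemma speed_nonneg:
  assumes "smooth_path M \<gamma>" "t \<in> {0..1}"
  shows "0 \<le> speed M \<gamma> t"
proof -
  have s: "smooth_at \<gamma> t" by (rule smooth_path_smooth_at[OF assms])
  obtain U \<phi> where U: "(U, \<phi>) \<in> charts M" "\<gamma> t \<in> U"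
    using chart_at[OF smooth_at_in_topspace[OF s]] by blast
  obtain \<delta> c where c: "\<delta> > 0" "smooth_on {t - \<delta><..<t + \<delta>} c"
    "\<And>s. s \<in> {0..1} \<Longrightarrow> s \<in> {t - \<delta><..<t + \<delta>} \<Longrightarrow> \<gamma> s \<in> U \<and> c s = \<phi> (\<gamma> s)"
    by (rule smooth_atE[OF s assms(2) U chart_openin[OF U(1)] U(2)]) blast
  have t: "t \<in> {t - \<delta><..<t + \<delta>}" using c(1) by simp
  have "speed M \<gamma> t = sqrt (metric M (U, \<phi>) (\<gamma> t) (vector_derivative c (at t)) (vector_derivative c (at t)))"
    by (rule speed_eq_extension[OF U(1) assms(2) s c(1,3) smooth_on_vector_derivative(2)[OF c(2) t]])
  then show ?thesis using metric_nonneg[OF U] by simp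
qed

lemma speed_local:
  assumes "smooth_path M \<gamma>" "\<delta> > 0" "smooth_on {t - \<delta><..<t + \<delta>} c" "(U, \<phi>) \<in> charts M"
    "\<And>s. s \<in> {0..1} \<Longrightarrow> s \<in> {t - \<delta><..<t + \<delta>} \<Longrightarrow> \<gamma> s \<in> U \<and> c s = \<phi> (\<gamma> s)"
    and "s \<in> {0..1}" "s \<in> {t - \<delta><..<t + \<delta>}"
  shows "speed M \<gamma> s = sqrt (metric M (U, \<phi>) (\<gamma> s) (vector_derivative c (at s)) (vector_derivative c (at s)))"
proof -
  define e where "e = min (s - (t - \<delta>)) (t + \<delta> - s)"
  have e: "e > 0" "{s - e<..<s + e} \<subseteq> {t - \<delta><..<t + \<delta>}" using assms(7) by (auto simp: e_def)
  show ?thesis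
    by (rule speed_eq_extension[OF assms(4,6) smooth_path_smooth_at[OF assms(1,6)] e(1) _
          smooth_on_vector_derivative(2)[OF assms(3,7)]])
      (use assms(5) e(2) in blast)
qed

text \<open>Near each time the speed is the metric norm of the velocity of a smooth extension. This
  makes \<open>path_len\<close> meaningful: \<open>integral\<close> defaults to 0 on functions that
  are not integrable.\<close>

lemma speed_continuous:
  assumes "smooth_path M \<gamma>"
  shows "continuous_on {0..1} (speed M \<gamma>)"
  unfolding continuous_on_eq_continuous_within
proof
  fix t :: real assume t: "t \<in> {0..1}"
  have s: "smooth_at \<gamma> t" by (rule smooth_path_smooth_at[OF assms t])
  obtain U \<phi> where U: "(U, \<phi>) \<in> charts M" "\<gamma> t \<in> U"
    using chart_at[OF smooth_at_in_topspace[OF s]] by blast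
  obtain \<delta> c where c: "\<delta> > 0" "smooth_on {t - \<delta><..<t + \<delta>} c"
    "\<And>s. s \<in> {0..1} \<Longrightarrow> s \<in> {t - \<delta><..<t + \<delta>} \<Longrightarrow> \<gamma> s \<in> U \<and> c s = \<phi> (\<gamma> s)"
    "\<And>s. s \<in> {t - \<delta><..<t + \<delta>} \<Longrightarrow> c s \<in> \<phi> ` (U \<inter> U)"
    by (rule smooth_atE[OF s t U chart_openin[OF U(1)] U(2)]) blast
  let ?I = "{t - \<delta><..<t + \<delta>}"
  let ?v = "\<lambda>s. vector_derivative c (at s)"
  let ?f = "\<lambda>s. sqrt (metric M (U, \<phi>) (inv_into U \<phi> (c s)) (?v s) (?v s))"
  have "continuous_on ?I (\<lambda>s. (c s, ?v s))"
    by (intro continuous_intros smooth_on_imp_continuous_on[OF c(2)] smooth_on_vector_derivative(1)[OF c(2)])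
  then have "continuous_on ?I ?f"
    by (intro continuous_intros continuous_on_compose2[OF metric_continuous[OF U(1)], of ?I "\<lambda>s. (c s, ?v s)", simplified])
      (use c(4) smooth_on_imp_continuous_on[OF c(2)] smooth_on_vector_derivative(1)[OF c(2)] in auto)
  then have "continuous (at t within {0..1}) ?f"
    using c(1) by (simp add: continuous_on_eq_continuous_at continuous_at_imp_continuous_at_within)
  then show "continuous (at t within {0..1}) (speed M \<gamma>)"
  proof (rule continuous_transform_within[OF _ c(1) t])
    fix s assume s: "s \<in> {0..1}" "dist s t < \<delta>"
    then have s': "s \<in> ?I" by (auto simp: dist_real_def abs_less_iff)
    have "inv_into U \<phi> (c s) = \<gamma> s"
      using c(3)[OF s(1) s'] chart_inj[OF U(1)] by simp
    then show "?f s = speed M \<gamma> s"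
      using speed_local[OF assms c(1,2) U(1) c(3) s(1) s'] by simp
  qed
qed

lemma speed_integrable:
  "smooth_path M \<gamma> \<Longrightarrow> {a..b} \<subseteq> {0..1} \<Longrightarrow> speed M \<gamma> integrable_on {a..b}"
  by (intro integrable_continuous_real continuous_on_subset[OF speed_continuous])

lemma speed_compose:
  assumes "smooth_path M \<sigma>" "smooth_at \<gamma> t" "t \<in> {0<..<1}" "\<delta> > 0"
    and h: "(h has_real_derivative h') (at t)"
    and "\<And>s. s \<in> {t - \<delta><..<t + \<delta>} \<Longrightarrow> h s \<in> {0..1} \<and> \<gamma> s = \<sigma> (h s)"
  shows "speed M \<gamma> t = \<bar>h'\<bar> * speed M \<sigma> (h t)"
proof -
  have "t \<in> {t - \<delta><..<t + \<delta>}" using assms(4) by simp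
  from assms(6)[OF this] have ht: "h t \<in> {0..1}" "\<gamma> t = \<sigma> (h t)" by auto
  have s: "smooth_at \<sigma> (h t)" by (rule smooth_path_smooth_at[OF assms(1) ht(1)])
  obtain U \<phi> where U: "(U, \<phi>) \<in> charts M" "\<sigma> (h t) \<in> U"
    using chart_at[OF smooth_at_in_topspace[OF s]] by blast
  obtain \<epsilon> c where c: "\<epsilon> > 0" "smooth_on {h t - \<epsilon><..<h t + \<epsilon>} c"
    "\<And>s. s \<in> {0..1} \<Longrightarrow> s \<in> {h t - \<epsilon><..<h t + \<epsilon>} \<Longrightarrow> \<sigma> s \<in> U \<and> c s = \<phi> (\<sigma> s)"
    by (rule smooth_atE[OF s ht(1) U chart_openin[OF U(1)] U(2)]) blast
  let ?w = "vector_derivative c (at (h t))"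
  have w: "(c has_vector_derivative ?w) (at (h t))"
    by (rule smooth_on_vector_derivative(2)[OF c(2)]) (use c(1) in simp)
  have 1: "speed M \<sigma> (h t) = sqrt (metric M (U, \<phi>) (\<gamma> t) ?w ?w)"
    unfolding ht(2) by (rule speed_eq_extension[OF U(1) ht(1) s c(1,3) w])
  have chain: "((c \<circ> h) has_vector_derivative (h' *\<^sub>R ?w)) (at t)"
    by (rule vector_diff_chain_at[of h h' t c, OF _ w]) (use h has_real_derivative_iff_has_vector_derivative in blast)
  have "isCont h t" using h DERIV_isCont by blast
  then obtain \<eta> where \<eta>: "\<eta> > 0" "\<And>s. dist s t < \<eta> \<Longrightarrow> dist (h s) (h t) < \<epsilon>"
    using c(1) unfolding continuous_at_eps_delta by blast
  define e where "e = min \<delta> \<eta>"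
  have e: "e > 0" using \<eta> assms(4) by (simp add: e_def)
  have 2: "speed M \<gamma> t = sqrt (metric M (U, \<phi>) (\<gamma> t) (h' *\<^sub>R ?w) (h' *\<^sub>R ?w))"
  proof (rule speed_eq_extension[OF U(1) _ assms(2) e _ chain])
    show "t \<in> {0..1}" using assms(3) by auto
    fix s assume "s \<in> {t - e<..<t + e}"
    then have "s \<in> {t - \<delta><..<t + \<delta>}" "dist s t < \<eta>"
      by (auto simp: e_def dist_real_def abs_less_iff)
    with assms(6) \<eta>(2)[of s] have "h s \<in> {0..1} \<and> \<gamma> s = \<sigma> (h s)" "h s \<in> {h t - \<epsilon><..<h t + \<epsilon>}"
      by (simp, simp add: dist_real_def abs_less_iff)
    with c(3) show "\<gamma> s \<in> U \<and> (c \<circ> h) s = \<phi> (\<gamma> s)" by auto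
  qed
  have "\<gamma> t \<in> U" using U ht by simp
  then show ?thesis
    unfolding 1 2 metric_scale[OF U(1) \<open>\<gamma> t \<in> U\<close>]
    by (simp add: real_sqrt_mult)
qed

text \<open>Integration by substitution. \<open>speed_compose\<close> speaks about inner times only,
  and the two end points form a finite set that the integral ignores. The derivative of h may
  vanish, since smooth joins stop at the junction.\<close>

lemma speed_compose_has_integral:
  assumes "smooth_path M \<sigma>" "smooth_path M \<gamma>" "a \<le> b" "{a..b} \<subseteq> {0..1}"
    and "continuous_on {a..b} h" "\<And>s. s \<in> {a..b} \<Longrightarrow> h s \<in> {0..1} \<and> \<gamma> s = \<sigma> (h s)"
    and h: "\<And>s. s \<in> {a<..<b} \<Longrightarrow> (h has_real_derivative h' s) (at s) \<and> 0 \<le> h' s"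
    and "h a \<le> h b"
  shows "(speed M \<gamma> has_integral (integral {h a..h b} (speed M \<sigma>))) {a..b}"
proof -
  have "((\<lambda>s. h' s *\<^sub>R speed M \<sigma> (h s)) has_integral (integral {h a..h b} (speed M \<sigma>))) {a..b}"
  proof (rule has_integral_substitution_strong[where s="{a, b}" and c=0 and d=1])
    show "(h has_real_derivative h' s) (at s within {a..b})" if "s \<in> {a..b} - {a, b}" for s
      using h[of s] that has_field_derivative_at_within by auto
  qed (use assms speed_continuous in auto)
  then show ?thesis
  proof (rule has_integral_spike_finite[of "{a, b}", rotated 2])
    fix s assume "s \<in> {a..b} - {a, b}"
    then have s: "s \<in> {a<..<b}" by auto
    define e where "e = min (s - a) (b - s)"
    have e: "e > 0" using s by (auto simp: e_def)
    have "speed M \<gamma> s = \<bar>h' s\<bar> * speed M \<sigma> (h s)"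
    proof (rule speed_compose[OF assms(1) _ _ e])
      have "0 \<le> a" "b \<le> 1" using assms(3,4) by auto
      then show "s \<in> {0<..<1}" using s by auto
      then show "smooth_at \<gamma> s" using smooth_path_smooth_at[OF assms(2)] by auto
      show "(h has_real_derivative h' s) (at s)" using h[OF s] by blast
      show "h r \<in> {0..1} \<and> \<gamma> r = \<sigma> (h r)" if "r \<in> {s - e<..<s + e}" for r
        by (rule assms(6)) (use that in \<open>auto simp: e_def\<close>)
    qed
    then show "speed M \<gamma> s = h' s *\<^sub>R speed M \<sigma> (h s)" using h[OF s] by simp
  qed simp
qed

end

section \<open>Reparametrization and concatenation\<close>

lemma smooth_on_affine: "open S \<Longrightarrow> smooth_on S (\<lambda>x::real. a + b * x)"
  by (intro smooth_on_add smooth_on_const smooth_on_linear bounded_linear_mult_right)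

context riemannian_surface
begin

lemma smooth_path_affine:
  assumes "smooth_path M \<sigma>" "a \<in> {0..1}" "a + b \<in> {0..1}" "s \<in> {0..1}" "t \<in> {0..1}"
    and "\<sigma> (a + b * s) \<noteq> \<sigma> (a + b * t)"
  shows "smooth_path M (\<lambda>s. \<sigma> (a + b * s))"
  unfolding smooth_path_iff
proof (intro conjI ballI)
  show "\<exists>s\<in>{0..1}. \<exists>t\<in>{0..1}. \<sigma> (a + b * s) \<noteq> \<sigma> (a + b * t)" using assms by blast
  show "smooth_at (\<lambda>s. \<sigma> (a + b * s)) t" if "t \<in> {0..1}" for t
  proof (rule smooth_at_compose[OF assms(1) zero_less_one smooth_on_affine that])
    fix s :: real assume s: "s \<in> {0..1}"
    have "a + b * s = (1 - s) * a + s * (a + b)" by (simp add: algebra_simps)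
    then have "a + b * s \<in> {0..1}"
      using convexD_alt[OF convex_real_interval(5), of a 0 1 "a + b" s] assms s by simp
    then show "a + b * s \<in> {0..1} \<and> \<sigma> (a + b * s) = \<sigma> (a + b * s)" by blast
  qed simp
qed

lemma path_len_nonneg: "smooth_path M \<gamma> \<Longrightarrow> 0 \<le> integral {0..1} (speed M \<gamma>)"
  by (intro integral_nonneg speed_integrable speed_nonneg) auto

lemma smooth_path_reverse:
  assumes "smooth_path M \<sigma>"
  shows "smooth_path M (\<lambda>s. \<sigma> (1 - s))" "path_len M (\<lambda>s. \<sigma> (1 - s)) = path_len M \<sigma>"
proof -
  let ?r = "\<lambda>s. \<sigma> (1 - s)"
  obtain s t where st: "s \<in> {0..1}" "t \<in> {0..1}" "\<sigma> s \<noteq> \<sigma> t"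
    using assms unfolding smooth_path_iff by blast
  show r: "smooth_path M ?r"
    using smooth_path_affine[OF assms, of 1 "-1" "1 - s" "1 - t"] st by simp
  \<comment> \<open>The substitution rule yields an oriented integral. Here the interval from 1 - 0
    to 1 - 1 is empty, so its integral is 0 and only a sign remains to be turned.\<close>
  have "((\<lambda>x. - 1 *\<^sub>R speed M \<sigma> (1 - x)) has_integral
      (integral {1 - 0..1 - 1} (speed M \<sigma>) - integral {1 - 1..1 - 0} (speed M \<sigma>))) {0..1}"
    by (rule has_integral_substitution_general[where s="{}" and c=0 and d=1])
      (auto intro!: derivative_eq_intros continuous_intros speed_continuous[OF assms])
  then have "((\<lambda>x. - (- 1 *\<^sub>R speed M \<sigma> (1 - x))) has_integral
      - (integral {1 - 0..1 - 1} (speed M \<sigma>) - integral {1 - 1..1 - 0} (speed M \<sigma>))) {0..1}"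
    by (rule has_integral_neg)
  then have "((\<lambda>x. speed M \<sigma> (1 - x)) has_integral integral {0..1} (speed M \<sigma>)) {0..1}"
    by simp
  then have "(speed M ?r has_integral integral {0..1} (speed M \<sigma>)) {0..1}"
  proof (rule has_integral_spike_finite[of "{0, 1}", rotated 2])
    fix x :: real assume "x \<in> {0..1} - {0, 1}"
    then have x: "x \<in> {0<..<1}" by auto
    define e where "e = min x (1 - x)"
    have e: "e > 0" using x by (auto simp: e_def)
    have "speed M ?r x = \<bar>- 1\<bar> * speed M \<sigma> (1 - x)"
    proof (rule speed_compose[OF assms smooth_path_smooth_at[OF r] x e])
      show "((-) 1 has_real_derivative - 1) (at x)" by (auto intro!: derivative_eq_intros)
    qed (use x in \<open>auto simp: e_def\<close>)
    then show "speed M ?r x = speed M \<sigma> (1 - x)" by simp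
  qed simp
  then show "path_len M ?r = path_len M \<sigma>"
    unfolding path_len_def by (simp add: integral_unique)
qed

lemma smooth_path_restrict:
  assumes "smooth_path M \<sigma>" "0 \<le> u" "u < v" "v \<le> 1"
    and "s \<in> {u..v}" "t \<in> {u..v}" "\<sigma> s \<noteq> \<sigma> t"
  defines "\<gamma> \<equiv> \<lambda>s. \<sigma> (u + (v - u) * s)"
  shows "smooth_path M \<gamma>" "path_len M \<gamma> = ennreal (integral {u..v} (speed M \<sigma>))"
proof -
  have in01: "(r - u) / (v - u) \<in> {0..1}" "u + (v - u) * ((r - u) / (v - u)) = r" if "r \<in> {u..v}" for r
    using that assms(3) by (auto simp: field_simps)
  show g: "smooth_path M \<gamma>"
    unfolding \<gamma>_def
    by (rule smooth_path_affine[OF assms(1) _ _ in01(1)[OF assms(5)] in01(1)[OF assms(6)]])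
      (use in01(2)[OF assms(5)] in01(2)[OF assms(6)] assms in auto)
  have "(speed M \<gamma> has_integral (integral {u + (v - u) * 0..u + (v - u) * 1} (speed M \<sigma>))) {0..1}"
  proof (rule speed_compose_has_integral[OF assms(1) g, where h' = "\<lambda>_. v - u"])
    show "u + (v - u) * s \<in> {0..1} \<and> \<gamma> s = \<sigma> (u + (v - u) * s)" if "s \<in> {0..1}" for s
    proof -
      have "0 \<le> (v - u) * s" "(v - u) * s \<le> (v - u) * 1"
        using that assms(3) by (auto intro: mult_left_mono)
      then show ?thesis using assms(2,4) by (auto simp: \<gamma>_def)
    qed
  qed (use assms in \<open>auto intro!: continuous_intros derivative_eq_intros\<close>)
  then show "path_len M \<gamma> = ennreal (integral {u..v} (speed M \<sigma>))"
    unfolding path_len_def by (simp add: integral_unique)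
qed

text \<open>The paths are slowed down to infinite order at the junction, which makes the concatenation smooth.\<close>

lemma smooth_path_join:
  assumes "smooth_path M \<sigma>1" "smooth_path M \<sigma>2" "\<sigma>1 1 = \<sigma>2 0"
  obtains \<gamma> where "smooth_path M \<gamma>" "\<gamma> 0 = \<sigma>1 0" "\<gamma> 1 = \<sigma>2 1"
    "\<gamma> ` {0..1} \<subseteq> \<sigma>1 ` {0..1} \<union> \<sigma>2 ` {0..1}"
    "path_len M \<gamma> = path_len M \<sigma>1 + path_len M \<sigma>2"
proof -
  obtain h h' where h: "smooth_on {-1<..<2} h"
    and h': "\<And>x. x \<in> {-1<..<2} \<Longrightarrow> (h has_real_derivative h' x) (at x)" "\<And>x. 0 \<le> h' x"
    and h0: "\<And>x. -1 < x \<Longrightarrow> x \<le> 0 \<Longrightarrow> h x = 0" and h1: "\<And>x. 1 \<le> x \<Longrightarrow> x < 2 \<Longrightarrow> h x = 1"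
    and h01: "\<And>x. x \<in> {-1<..<2} \<Longrightarrow> h x \<in> {0..1}"
    using smooth_step by metis
  have conth: "continuous_on {-1<..<2} h" by (rule smooth_on_imp_continuous_on[OF h])
  define \<gamma> where "\<gamma> t = (if t \<le> 1/2 then \<sigma>1 (h (2 * t)) else \<sigma>2 (h (2 * t - 1)))" for t
  have g1: "\<gamma> t = \<sigma>1 (h (2 * t))" if "t \<le> 1/2" for t using that by (simp add: \<gamma>_def)
  have g2: "\<gamma> t = \<sigma>2 (h (2 * t - 1))" if "1/2 \<le> t" for t
  proof (cases "t = 1/2")
    case True
    show ?thesis
      unfolding True using assms(3) h0[of 0] h1[of 1] by (simp add: \<gamma>_def)
  next
    case False
    then show ?thesis using that by (simp add: \<gamma>_def)
  qed
  have sm1: "smooth_on {a<..<b} (\<lambda>s. h (2 * s))" if "-1/2 \<le> a" "b \<le> 1" for a b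
    by (rule smooth_on_compose[OF _ h]) (use that smooth_on_affine[of "{a<..<b}" 0 2] in auto)
  have sm2: "smooth_on {a<..<b} (\<lambda>s. h (2 * s - 1))" if "0 \<le> a" "b \<le> 3/2" for a b
    by (rule smooth_on_compose[OF _ h]) (use that smooth_on_affine[of "{a<..<b}" "-1" 2] in auto)
  have sm: "smooth_at \<gamma> t" if t: "t \<in> {0..1}" for t
  proof -
    consider "t < 1/2" | "t > 1/2" | "t = 1/2" by linarith
    then show ?thesis
    proof cases
      case 1
      show ?thesis
      proof (rule smooth_at_compose[OF assms(1) _ sm1 t, of "1/2 - t"])
        show "h (2 * s) \<in> {0..1} \<and> \<gamma> s = \<sigma>1 (h (2 * s))"
          if "s \<in> {0..1}" "s \<in> {t - (1/2 - t)<..<t + (1/2 - t)}" for s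
          using h01[of "2 * s"] g1[of s] that 1 by auto
      qed (use 1 t in auto)
    next
      case 2
      show ?thesis
      proof (rule smooth_at_compose[OF assms(2) _ sm2 t, of "t - 1/2"])
        show "h (2 * s - 1) \<in> {0..1} \<and> \<gamma> s = \<sigma>2 (h (2 * s - 1))"
          if "s \<in> {0..1}" "s \<in> {t - (t - 1/2)<..<t + (t - 1/2)}" for s
          using h01[of "2 * s - 1"] g2[of s] that 2 by auto
      qed (use 2 t in auto)
    next
      case 3
      define y where "y = \<sigma>1 1"
      have s1: "smooth_at \<sigma>1 1" and s2: "smooth_at \<sigma>2 0"
        using smooth_path_smooth_at assms by auto
      obtain U \<phi> where U: "(U, \<phi>) \<in> charts M" "\<sigma>1 1 \<in> U" "\<sigma>2 0 \<in> U"
        using chart_at[OF smooth_at_in_topspace[OF s1]] assms(3) by metis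
      obtain \<delta>1 c1 where c1: "\<delta>1 > 0" "smooth_on {1 - \<delta>1<..<1 + \<delta>1} c1"
        "\<And>s. s \<in> {0..1} \<Longrightarrow> s \<in> {1 - \<delta>1<..<1 + \<delta>1} \<Longrightarrow> \<sigma>1 s \<in> U \<and> c1 s = \<phi> (\<sigma>1 s)"
        by (rule smooth_atE[OF s1 _ U(1,2) chart_openin[OF U(1)] U(2)]) auto
      obtain \<delta>2 c2 where c2: "\<delta>2 > 0" "smooth_on {0 - \<delta>2<..<0 + \<delta>2} c2"
        "\<And>s. s \<in> {0..1} \<Longrightarrow> s \<in> {0 - \<delta>2<..<0 + \<delta>2} \<Longrightarrow> \<sigma>2 s \<in> U \<and> c2 s = \<phi> (\<sigma>2 s)"
        by (rule smooth_atE[OF s2 _ U(1,3) chart_openin[OF U(1)] U(3)]) auto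
      have ce: "c1 1 = \<phi> y" "c2 0 = \<phi> y" "y \<in> U"
        using c1(1) c1(3)[of 1] c2(1) c2(3)[of 0] assms(3) U by (auto simp: y_def)
      have A: "smooth_on {1/2 - 1/2<..<1/2 + 1/2} (\<lambda>s. h (2 * s))"
        "smooth_on {1/2 - 1/2<..<1/2 + 1/2} (\<lambda>s. h (2 * s - 1))" by (auto intro!: sm1 sm2)
      have "h (2 * (1/2)) \<in> {1 - \<delta>1<..<1 + \<delta>1}" using c1(1) h1[of 1] by simp
      from continuous_interval_into_open[OF open_greaterThanLessThan
          smooth_on_imp_continuous_on[OF A(1)] _ this]
      obtain d1 where d1: "0 < d1" "d1 \<le> 1/2"
        and T1: "\<And>s. s \<in> {1/2 - d1<..<1/2 + d1} \<Longrightarrow> h (2 * s) \<in> {1 - \<delta>1<..<1 + \<delta>1}"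
        by auto
      have "h (2 * (1/2) - 1) \<in> {0 - \<delta>2<..<0 + \<delta>2}" using c2(1) h0[of 0] by simp
      from continuous_interval_into_open[OF open_greaterThanLessThan
          smooth_on_imp_continuous_on[OF A(2)] _ this]
      obtain d2 where d2: "0 < d2" "d2 \<le> 1/2"
        and T2: "\<And>s. s \<in> {1/2 - d2<..<1/2 + d2} \<Longrightarrow> h (2 * s - 1) \<in> {0 - \<delta>2<..<0 + \<delta>2}"
        by auto
      define e where "e = min d1 d2"
      have e: "e > 0" "e \<le> d1" "e \<le> d2" "e \<le> 1/2" using d1 d2 by (auto simp: e_def)
      let ?I = "{1/2 - e<..<1/2 + e}"
      \<comment> \<open>One formula for both sides of the junction: up to time 1/2 the second
        summand is constantly \<open>\<phi> y\<close>, afterwards the first one is, and subtracting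
        \<open>\<phi> y\<close> leaves the coordinates of \<gamma>. As a sum of smooth functions it
        is smooth across 1/2.\<close>
      let ?c = "\<lambda>s. (c1 (h (2 * s)) + c2 (h (2 * s - 1))) + (- \<phi> y)"
      show ?thesis
        unfolding 3
      proof (rule smooth_atI[OF U(1) _ e(1)])
        have "smooth_on ?I (\<lambda>s. c1 (h (2 * s)))"
        proof (rule smooth_on_compose[OF sm1 c1(2)])
          show "(\<lambda>s. h (2 * s)) ` ?I \<subseteq> {1 - \<delta>1<..<1 + \<delta>1}"
            by (intro image_subsetI T1) (use e in auto)
        qed (use e in auto)
        moreover have "smooth_on ?I (\<lambda>s. c2 (h (2 * s - 1)))"
        proof (rule smooth_on_compose[OF sm2 c2(2)])
          show "(\<lambda>s. h (2 * s - 1)) ` ?I \<subseteq> {0 - \<delta>2<..<0 + \<delta>2}"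
            by (intro image_subsetI T2) (use e in auto)
        qed (use e in auto)
        ultimately show "smooth_on ?I ?c"
          by (intro smooth_on_add smooth_on_const) auto
        show "\<gamma> (1/2) \<in> U" using g1[of "1/2"] h1[of 1] U by simp
        fix s assume s: "s \<in> {0..1}" "s \<in> ?I"
        then have s1: "h (2 * s) \<in> {1 - \<delta>1<..<1 + \<delta>1}" and s2: "h (2 * s - 1) \<in> {0 - \<delta>2<..<0 + \<delta>2}"
          using T1[of s] T2[of s] e by auto
        show "\<gamma> s \<in> U \<and> ?c s = \<phi> (\<gamma> s)"
        proof (cases "s \<le> 1/2")
          case True
          then have "h (2 * s - 1) = 0" using s e by (intro h0) auto
          moreover have "h (2 * s) \<in> {0..1}" by (rule h01) (use s e in auto)
          ultimately show ?thesis using c1(3)[OF _ s1] g1[OF True] ce by simp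
        next
          case False
          then have "h (2 * s) = 1" using s e by (intro h1) auto
          moreover have "h (2 * s - 1) \<in> {0..1}" by (rule h01) (use s e False in auto)
          ultimately show ?thesis using c2(3)[OF _ s2] g2[of s] False ce by simp
        qed
      qed
    qed
  qed
  \<comment> \<open>By the intermediate value theorem h takes all values in [0,1], so \<gamma> runs
    through every value of \<sigma>1, which is not constant.\<close>
  have nonconst: "\<exists>s\<in>{0..1}. \<exists>t\<in>{0..1}. \<gamma> s \<noteq> \<gamma> t"
  proof -
    have surj: "\<exists>t\<in>{0..1}. \<gamma> t = \<sigma>1 s" if s: "s \<in> {0..1}" for s
    proof -
      have "\<exists>x\<ge>0. x \<le> 1 \<and> h x = s"
        by (rule IVT') (use s h0[of 0] h1[of 1] in \<open>auto intro: continuous_on_subset[OF conth]\<close>)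
      then obtain x where "0 \<le> x" "x \<le> 1" "h x = s" by blast
      then show ?thesis by (intro bexI[of _ "x / 2"]) (auto simp: g1)
    qed
    obtain s t where "s \<in> {0..1}" "t \<in> {0..1}" "\<sigma>1 s \<noteq> \<sigma>1 t"
      using assms(1) unfolding smooth_path_iff by blast
    with surj show ?thesis by metis
  qed
  have g: "smooth_path M \<gamma>" unfolding smooth_path_iff using sm nonconst by blast
  have 1: "(speed M \<gamma> has_integral (integral {h (2 * 0)..h (2 * (1/2))} (speed M \<sigma>1))) {0..1/2}"
  proof (rule speed_compose_has_integral[OF assms(1) g, where h' = "\<lambda>s. h' (2 * s) * 2"])
    show "continuous_on {0..1/2} (\<lambda>s. h (2 * s))"
      by (rule continuous_on_compose2[OF conth]) (auto intro!: continuous_intros)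
    show "((\<lambda>s. h (2 * s)) has_real_derivative h' (2 * s) * 2) (at s) \<and> 0 \<le> h' (2 * s) * 2"
      if "s \<in> {0<..<1/2}" for s
    proof -
      have "((\<lambda>s. h (2 * s)) has_real_derivative h' (2 * s) * 2) (at s)"
        by (rule DERIV_chain2[OF h'(1)]) (use that in \<open>auto intro!: derivative_eq_intros\<close>)
      then show ?thesis using h'(2) by simp
    qed
    show "h (2 * s) \<in> {0..1} \<and> \<gamma> s = \<sigma>1 (h (2 * s))" if "s \<in> {0..1/2}" for s
      using h01[of "2 * s"] g1[of s] that by auto
  qed (use h0[of 0] h1[of 1] in auto)
  have 2: "(speed M \<gamma> has_integral (integral {h (2 * (1/2) - 1)..h (2 * 1 - 1)} (speed M \<sigma>2))) {1/2..1}"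
  proof (rule speed_compose_has_integral[OF assms(2) g, where h' = "\<lambda>s. h' (2 * s - 1) * 2"])
    show "continuous_on {1/2..1} (\<lambda>s. h (2 * s - 1))"
      by (rule continuous_on_compose2[OF conth]) (auto intro!: continuous_intros)
    show "((\<lambda>s. h (2 * s - 1)) has_real_derivative h' (2 * s - 1) * 2) (at s) \<and> 0 \<le> h' (2 * s - 1) * 2"
      if "s \<in> {1/2<..<1}" for s
    proof -
      have "((\<lambda>s. h (2 * s - 1)) has_real_derivative h' (2 * s - 1) * 2) (at s)"
        by (rule DERIV_chain2[OF h'(1)]) (use that in \<open>auto intro!: derivative_eq_intros\<close>)
      then show ?thesis using h'(2) by simp
    qed
    show "h (2 * s - 1) \<in> {0..1} \<and> \<gamma> s = \<sigma>2 (h (2 * s - 1))" if "s \<in> {1/2..1}" for s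
      using h01[of "2 * s - 1"] g2[of s] that by auto
  qed (use h0[of 0] h1[of 1] in auto)
  have "(speed M \<gamma> has_integral (integral {0..1} (speed M \<sigma>1) + integral {0..1} (speed M \<sigma>2))) {0..1}"
    using has_integral_combine[OF _ _ 1 2] h0[of 0] h1[of 1] by simp
  then have len: "path_len M \<gamma> = path_len M \<sigma>1 + path_len M \<sigma>2"
    using path_len_nonneg assms unfolding path_len_def by (simp add: integral_unique ennreal_plus)
  have img: "\<gamma> t \<in> \<sigma>1 ` {0..1} \<union> \<sigma>2 ` {0..1}" if "t \<in> {0..1}" for t
  proof (cases "t \<le> 1/2")
    case True
    then have "h (2 * t) \<in> {0..1}" using that by (intro h01) auto
    then show ?thesis using g1[OF True] by blast
  next
    case False
    then have "h (2 * t - 1) \<in> {0..1}" using that by (intro h01) auto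
    then show ?thesis using g2[of t] False by auto
  qed
  show ?thesis
    by (rule that[OF g _ _ image_subsetI[OF img] len])
      (use g1[of 0] g2[of 1] h0[of 0] h1[of 1] in auto)
qed

end

section \<open>The infimal length\<close>

lemma ennreal_less_add: "x < top \<Longrightarrow> 0 < e \<Longrightarrow> x < x + ennreal e"
  by (cases x) (auto simp: ennreal_less_iff simp flip: ennreal_plus)

context riemannian_surface
begin

lemma inf_len_le:
  assumes "smooth_path M \<gamma>" "\<gamma> ` {0..1} \<subseteq> S"
  shows "inf_len M S (\<gamma> 0) (\<gamma> 1) \<le> path_len M \<gamma>"
  unfolding inf_len_def by (rule INF_lower) (use assms in auto)

lemma inf_len_lessE:
  assumes "inf_len M S x y < r"
  obtains \<gamma> where "smooth_path M \<gamma>" "\<gamma> ` {0..1} \<subseteq> S" "\<gamma> 0 = x" "\<gamma> 1 = y" "path_len M \<gamma> < r"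
  using assms unfolding inf_len_def INF_less_iff by blast

lemma inf_len_mono: "S \<subseteq> T \<Longrightarrow> inf_len M T x y \<le> inf_len M S x y"
  unfolding inf_len_def by (rule INF_superset_mono) auto

lemma inf_len_sym_le: "inf_len M S y x \<le> inf_len M S x y"
proof -
  have "inf_len M S y x \<le> path_len M \<gamma>"
    if g: "smooth_path M \<gamma>" "\<gamma> ` {0..1} \<subseteq> S" "\<gamma> 0 = x" "\<gamma> 1 = y" for \<gamma>
  proof -
    have "(\<lambda>s. \<gamma> (1 - s)) ` {0..1} \<subseteq> S" using g(2) by (auto simp: image_subset_iff)
    from inf_len_le[OF smooth_path_reverse(1)[OF g(1)] this] show ?thesis
      using g(3,4) smooth_path_reverse(2)[OF g(1)] by simp
  qed
  then show ?thesis unfolding inf_len_def[of M S x y] by (intro INF_greatest) auto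
qed

lemma inf_len_sym: "inf_len M S x y = inf_len M S y x"
  by (rule antisym; rule inf_len_sym_le)

lemma inf_len_triangle: "inf_len M S x z \<le> inf_len M S x y + inf_len M S y z"
proof (rule ennreal_le_epsilon)
  fix e :: real
  have AC: "(A + E) + (B + E) = A + B + (E + E)" for A B E :: ennreal
    by (simp only: ac_simps)
  assume fin: "inf_len M S x y + inf_len M S y z < top" and e: "0 < e"
  have less: "inf_len M S x y < inf_len M S x y + ennreal (e / 2)"
    "inf_len M S y z < inf_len M S y z + ennreal (e / 2)"
    by (rule ennreal_less_add; use le_less_trans[OF _ fin] e in simp)+
  obtain \<gamma>1 where 1: "smooth_path M \<gamma>1" "\<gamma>1 ` {0..1} \<subseteq> S" "\<gamma>1 0 = x" "\<gamma>1 1 = y"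
      "path_len M \<gamma>1 < inf_len M S x y + ennreal (e / 2)"
    by (rule inf_len_lessE[OF less(1)])
  obtain \<gamma>2 where 2: "smooth_path M \<gamma>2" "\<gamma>2 ` {0..1} \<subseteq> S" "\<gamma>2 0 = y" "\<gamma>2 1 = z"
      "path_len M \<gamma>2 < inf_len M S y z + ennreal (e / 2)"
    by (rule inf_len_lessE[OF less(2)])
  obtain \<gamma> where g: "smooth_path M \<gamma>" "\<gamma> 0 = \<gamma>1 0" "\<gamma> 1 = \<gamma>2 1"
    "\<gamma> ` {0..1} \<subseteq> \<gamma>1 ` {0..1} \<union> \<gamma>2 ` {0..1}" "path_len M \<gamma> = path_len M \<gamma>1 + path_len M \<gamma>2"
    using smooth_path_join[OF 1(1) 2(1)] 1(4) 2(3) by metis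
  have "inf_len M S x z \<le> path_len M \<gamma>"
    using inf_len_le[OF g(1), of S] g(2-4) 1(2,3) 2(2,4) by auto
  also have "\<dots> \<le> (inf_len M S x y + ennreal (e / 2)) + (inf_len M S y z + ennreal (e / 2))"
    unfolding g(5) by (intro add_mono less_imp_le 1 2)
  also have "\<dots> = inf_len M S x y + inf_len M S y z + (ennreal (e / 2) + ennreal (e / 2))"
    by (rule AC)
  also have "ennreal (e / 2) + ennreal (e / 2) = ennreal e"
    using e by (simp flip: ennreal_plus)
  finally show "inf_len M S x z \<le> inf_len M S x y + inf_len M S y z + ennreal e" .
qed

text \<open>The metric norm is continuous and positive on the compact product of a closed ball and
  the unit circle. Its minimum m and maximum K there extend to all vectors by homogeneity. K bounds
  short segments from above in \<open>inf_len_small\<close>, m bounds escaping paths from below in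
  \<open>inf_len_escape\<close>.\<close>

lemma chart_ball:
  assumes "(U, \<phi>) \<in> charts M" "p \<in> U" "openin X W" "p \<in> W"
  obtains r m K where "r > 0" "m > 0" "K > 0" "cball (\<phi> p) r \<subseteq> \<phi> ` (U \<inter> W)"
    "\<And>q v. q \<in> U \<Longrightarrow> \<phi> q \<in> cball (\<phi> p) r \<Longrightarrow> m * norm v \<le> sqrt (metric M (U, \<phi>) q v v)"
    "\<And>q v. q \<in> U \<Longrightarrow> \<phi> q \<in> cball (\<phi> p) r \<Longrightarrow> sqrt (metric M (U, \<phi>) q v v) \<le> K * norm v"
proof -
  obtain r where r: "r > 0" "cball (\<phi> p) r \<subseteq> \<phi> ` (U \<inter> W)"
    using chart_image_open[OF assms(1,3)] assms(2,4) open_contains_cball by (metis IntI imageI)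
  define f where "f z = sqrt (metric M (U, \<phi>) (inv_into U \<phi> (fst z)) (snd z) (snd z))" for z
  let ?C = "cball (\<phi> p) r \<times> sphere (0 :: real^2) 1"
  have comp: "compact ?C" by (intro compact_Times) auto
  have "sphere (0 :: real^2) 1 \<noteq> {}" by (simp add: sphere_eq_empty)
  then have ne: "?C \<noteq> {}" using r(1) by auto
  have sub: "cball (\<phi> p) r \<subseteq> \<phi> ` U" using r(2) by auto
  have cont: "continuous_on ?C f"
    unfolding f_def
    by (intro continuous_intros continuous_on_subset[OF metric_continuous[OF assms(1)]])
      (use sub in auto)
  obtain z0 where z0: "z0 \<in> ?C" "\<And>z. z \<in> ?C \<Longrightarrow> f z0 \<le> f z"
    using continuous_attains_inf[OF comp ne cont] by blast
  obtain z1 where z1: "z1 \<in> ?C" "\<And>z. z \<in> ?C \<Longrightarrow> f z \<le> f z1"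
    using continuous_attains_sup[OF comp ne cont] by blast
  have "fst z0 \<in> \<phi> ` U" "snd z0 \<noteq> 0" using z0(1) sub by auto
  then have m: "f z0 > 0"
    unfolding f_def using metric_pos[OF assms(1) inv_into_into] by simp
  have K: "f z1 > 0" using z1(2)[OF z0(1)] m by simp
  have sc: "sqrt (metric M (U, \<phi>) q v v) = norm v * f (\<phi> q, v /\<^sub>R norm v)" (is ?A)
    "(\<phi> q, v /\<^sub>R norm v) \<in> ?C" (is ?B)
    if "q \<in> U" "\<phi> q \<in> cball (\<phi> p) r" "v \<noteq> 0" for q v
  proof -
    have "metric M (U, \<phi>) q v v =
        metric M (U, \<phi>) q (norm v *\<^sub>R (v /\<^sub>R norm v)) (norm v *\<^sub>R (v /\<^sub>R norm v))"
      using that by simp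
    also have "\<dots> = (norm v)\<^sup>2 * metric M (U, \<phi>) q (v /\<^sub>R norm v) (v /\<^sub>R norm v)"
      by (rule metric_scale[OF assms(1) that(1)])
    finally show ?A
      using that chart_inj[OF assms(1)] by (simp add: f_def real_sqrt_mult)
    show ?B using that by simp
  qed
  have zero: "sqrt (metric M (U, \<phi>) q 0 0) = 0" if "q \<in> U" for q
    using metric_scale[OF assms(1) that, of 0 0] by simp
  show ?thesis
  proof (rule that[OF r(1) m K r(2)])
    fix q and v :: "real^2" assume q: "q \<in> U" "\<phi> q \<in> cball (\<phi> p) r"
    show "f z0 * norm v \<le> sqrt (metric M (U, \<phi>) q v v)"
      using sc[OF q, of v] z0(2)[of "(\<phi> q, v /\<^sub>R norm v)"] zero[OF q(1)]
      by (cases "v = 0") (auto simp: mult.commute intro: mult_left_mono)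
    show "sqrt (metric M (U, \<phi>) q v v) \<le> f z1 * norm v"
      using sc[OF q, of v] z1(2)[of "(\<phi> q, v /\<^sub>R norm v)"] zero[OF q(1)]
      by (cases "v = 0") (auto simp: mult.commute intro: mult_left_mono)
  qed
qed

text \<open>Straight coordinate segments from p serve as competitors: their length is at most K
  times their Euclidean length.\<close>

lemma inf_len_small:
  assumes "openin X S" "p \<in> S" "\<epsilon> > 0"
  obtains N where "openin X N" "p \<in> N" "N \<subseteq> S" "\<And>y. y \<in> N \<Longrightarrow> inf_len M S p y < ennreal \<epsilon>"
proof -
  obtain U \<phi> where U: "(U, \<phi>) \<in> charts M" "p \<in> U"
    using chart_at assms openin_subset by blast
  obtain r m K where r: "r > 0" "K > 0" "cball (\<phi> p) r \<subseteq> \<phi> ` (U \<inter> S)"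
    and K: "\<And>q v. q \<in> U \<Longrightarrow> \<phi> q \<in> cball (\<phi> p) r \<Longrightarrow> sqrt (metric M (U, \<phi>) q v v) \<le> K * norm v"
    by (rule chart_ball[OF U assms(1,2)]) blast
  \<comment> \<open>The radius keeps segments within the ball of \<open>chart_ball\<close> and their
    length below \<epsilon>/2. The other half of \<epsilon> pays for the way back in the case y =
    p.\<close>
  define r' where "r' = min r (\<epsilon> / (2 * K))"
  have r': "r' > 0" "r' \<le> r" "K * r' \<le> \<epsilon> / 2"
    using r assms(3) by (auto simp: r'_def min_def field_simps)
  let ?N = "U \<inter> \<phi> -` ball (\<phi> p) r'"
  have N: "openin X ?N" by (rule chart_inv_openin[OF U(1)]) simp
  have main: "inf_len M S p y < ennreal (\<epsilon> / 2)" if y: "y \<in> ?N" "y \<noteq> p" for y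
  proof -
    define w where "w = \<phi> y - \<phi> p"
    define c where "c t = \<phi> p + t *\<^sub>R w" for t
    define \<gamma> where "\<gamma> t = inv_into U \<phi> (c t)" for t
    have nw: "norm w < r'" using y by (simp add: w_def dist_norm norm_minus_commute)
    have cin: "c t \<in> cball (\<phi> p) r" if "t \<in> {0..1}" for t
    proof -
      have "norm (t *\<^sub>R w) \<le> 1 * norm w"
        unfolding norm_scaleR by (intro mult_right_mono) (use that in auto)
      then show ?thesis using nw r'(2) by (simp add: c_def dist_norm)
    qed
    have gin: "\<gamma> t \<in> U" "\<phi> (\<gamma> t) = c t" "\<gamma> t \<in> S" if t: "t \<in> {0..1}" for t
    proof -
      obtain q where "q \<in> U" "q \<in> S" "c t = \<phi> q" using cin[OF t] r(3) by blast
      then show "\<gamma> t \<in> U" "\<phi> (\<gamma> t) = c t" "\<gamma> t \<in> S"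
        using chart_inj[OF U(1)] by (auto simp: \<gamma>_def)
    qed
    have g01: "\<gamma> 0 = p" "\<gamma> 1 = y"
      using chart_inj[OF U(1)] U(2) y by (auto simp: \<gamma>_def c_def w_def)
    have smc: "smooth_on T c" if "open T" for T
      unfolding c_def
      by (intro smooth_on_add smooth_on_const smooth_on_linear bounded_linear_scaleR_left that)
    have sa: "smooth_at \<gamma> t" if "t \<in> {0..1}" for t
      by (rule smooth_atI[of U \<phi> \<gamma> t 1 c]) (use U(1) gin that smc in auto)
    have g: "smooth_path M \<gamma>"
      unfolding smooth_path_iff using sa g01 y(2) by (metis atLeastAtMost_iff order_refl zero_le_one)
    have "speed M \<gamma> t \<le> K * norm w" if "t \<in> {0..1}" for t
    proof -
      have "(c has_vector_derivative w) (at t)"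
        unfolding c_def by (auto intro!: derivative_eq_intros)
      then have "speed M \<gamma> t = sqrt (metric M (U, \<phi>) (\<gamma> t) w w)"
        by (rule speed_eq_extension[OF U(1) that sa[OF that] zero_less_one, rotated])
          (use gin in auto)
      also have "\<dots> \<le> K * norm w"
        by (rule K) (use gin[OF that] cin[OF that] in auto)
      finally show ?thesis .
    qed
    then have "integral {0..1} (speed M \<gamma>) \<le> integral {0..1::real} (\<lambda>t. K * norm w)"
      by (intro integral_le speed_integrable[OF g]) auto
    also have "\<dots> < \<epsilon> / 2"
      using mult_strict_left_mono[OF nw r(2)] r'(3) by simp
    finally have "path_len M \<gamma> < ennreal (\<epsilon> / 2)"
      unfolding path_len_def using path_len_nonneg[OF g] by (simp add: ennreal_less_iff)
    moreover have "\<gamma> ` {0..1} \<subseteq> S" using gin(3) by blast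
    then have "inf_len M S p y \<le> path_len M \<gamma>"
      using inf_len_le[OF g, of S] g01 by simp
    ultimately show ?thesis by simp
  qed
  \<comment> \<open>Paths are non-constant, so the constant path is no competitor for y = p; a
    segment to a nearby point y and back replaces it.\<close>
  have "inf_len M S p p < ennreal \<epsilon>"
  proof -
    obtain e :: "real^2" where e: "norm e = r' / 2" using vector_choose_size[of "r'/2"] r'(1) by auto
    have "\<phi> p + e \<in> cball (\<phi> p) r" using e r' by (simp add: dist_norm)
    then obtain y where y: "y \<in> U" "\<phi> y = \<phi> p + e" using r(3) by fastforce
    then have "y \<in> ?N" "y \<noteq> p" using e r' by (auto simp: dist_norm)
    then have "inf_len M S p y < ennreal (\<epsilon> / 2)" by (rule main)
    moreover from this have "inf_len M S y p < ennreal (\<epsilon> / 2)" by (subst inf_len_sym)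
    ultimately have "inf_len M S p y + inf_len M S y p < ennreal (\<epsilon> / 2) + ennreal (\<epsilon> / 2)"
      by (rule add_strict_mono)
    then have "inf_len M S p p < ennreal (\<epsilon> / 2) + ennreal (\<epsilon> / 2)"
      by (rule le_less_trans[OF inf_len_triangle])
    then show ?thesis using assms(3) by (simp flip: ennreal_plus)
  qed
  moreover have "ennreal (\<epsilon> / 2) \<le> ennreal \<epsilon>" using assms(3) by (intro ennreal_leI) auto
  ultimately have "inf_len M S p y < ennreal \<epsilon>" if "y \<in> ?N" for y
    using main that by (cases "y = p") (auto intro: less_le_trans)
  moreover have "?N \<subseteq> S"
  proof
    fix q assume q: "q \<in> ?N"
    then have "\<phi> q \<in> \<phi> ` (U \<inter> S)" using r(3) r'(2) by fastforce
    then show "q \<in> S" using q chart_inj[OF U(1)] by (auto dest: inj_onD)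
  qed
  moreover have "p \<in> ?N" using U r' by simp
  ultimately show ?thesis using that[OF N] by blast
qed

text \<open>Although constant paths are excluded, arbitrarily short loops at p exist by
  \<open>inf_len_small\<close>; they require S to be open.\<close>

lemma inf_len_self:
  assumes "openin X S" "p \<in> S"
  shows "inf_len M S p p = 0"
proof -
  have "inf_len M S p p \<le> 0 + ennreal e" if e: "e > 0" for e
  proof -
    obtain N where "p \<in> N" "\<And>y. y \<in> N \<Longrightarrow> inf_len M S p y < ennreal e"
      by (rule inf_len_small[OF assms e]) blast
    then show ?thesis by (simp add: less_imp_le)
  qed
  then have "inf_len M S p p \<le> 0" by (rule ennreal_le_epsilon)
  then show ?thesis by simp
qed

text \<open>The restriction of \<sigma> to [u,v] may be constant and then is not a path. The case of
  equal end points is therefore settled by \<open>inf_len_self\<close>, and otherwise the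
  restriction is admissible.\<close>

lemma inf_len_le_integral:
  assumes "openin X S" "smooth_path M \<sigma>" "\<sigma> ` {0..1} \<subseteq> S" "0 \<le> u" "u \<le> v" "v \<le> 1"
  shows "inf_len M S (\<sigma> u) (\<sigma> v) \<le> ennreal (integral {u..v} (speed M \<sigma>))"
proof (cases "\<sigma> u = \<sigma> v")
  case True
  have "\<sigma> u \<in> S" using assms by auto
  then show ?thesis using inf_len_self[OF assms(1)] True by simp
next
  case False
  then have uv: "u < v" using assms(5) by (cases "u = v") auto
  let ?\<gamma> = "\<lambda>s. \<sigma> (u + (v - u) * s)"
  have r: "smooth_path M ?\<gamma>" "path_len M ?\<gamma> = ennreal (integral {u..v} (speed M \<sigma>))"
    using smooth_path_restrict[OF assms(2,4) uv assms(6) _ _ False] uv by auto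
  have "u + (v - u) * s \<in> {0..1}" if "s \<in> {0..1}" for s
  proof -
    have "0 \<le> (v - u) * s" "(v - u) * s \<le> (v - u) * 1"
      using that uv by (auto intro: mult_left_mono)
    then show ?thesis using assms by auto
  qed
  then have "?\<gamma> ` {0..1} \<subseteq> S" using assms(3) by blast
  from inf_len_le[OF r(1) this] r(2) show ?thesis by simp
qed

text \<open>Two cuts, because in \<open>boundary_detour\<close> a path is cut at its crossings with
  both halves of \<gamma>; taking u = v gives a single cut.\<close>

lemma inf_len_subdivide:
  assumes "openin X S" "smooth_path M \<sigma>" "\<sigma> ` {0..1} \<subseteq> S" "0 \<le> u" "u \<le> v" "v \<le> 1"
  shows "inf_len M S (\<sigma> 0) (\<sigma> u) + inf_len M S (\<sigma> u) (\<sigma> v) + inf_len M S (\<sigma> v) (\<sigma> 1) \<le> path_len M \<sigma>"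
proof -
  let ?s = "speed M \<sigma>"
  have nn: "0 \<le> integral {a..b} ?s" if "{a..b} \<subseteq> {0..1}" for a b
    using that by (intro integral_nonneg speed_integrable[OF assms(2)] speed_nonneg[OF assms(2)]) auto
  have "integral {0..u} ?s + integral {u..1} ?s = integral {0..1} ?s"
    "integral {u..v} ?s + integral {v..1} ?s = integral {u..1} ?s"
    using assms by (auto intro!: Henstock_Kurzweil_Integration.integral_combine speed_integrable)
  then have "path_len M \<sigma> = ennreal (integral {0..u} ?s) + ennreal (integral {u..v} ?s) + ennreal (integral {v..1} ?s)"
    unfolding path_len_def using nn[of 0 u] nn[of u v] nn[of v 1] assms
    by (simp flip: ennreal_plus)
  then show ?thesis
    using inf_len_le_integral[OF assms(1-3)] assms(4-6) by (auto intro!: add_mono)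
qed

text \<open>Leaving the chart ball requires Euclidean displacement r/2 at least, and by
  \<open>chart_ball\<close> each unit of displacement costs length m at least. With
  \<open>inf_len_small\<close> this identifies the topology of X with that of
  \<open>rhoX\<close>.\<close>

lemma inf_len_escape:
  assumes "openin X N" "p \<in> N"
  obtains \<epsilon> where "\<epsilon> > 0" "\<And>y. inf_len M S p y < ennreal \<epsilon> \<Longrightarrow> y \<in> N"
proof -
  obtain U \<phi> where U: "(U, \<phi>) \<in> charts M" "p \<in> U"
    using chart_at assms openin_subset by blast
  obtain r m where r: "r > 0" "m > 0" "cball (\<phi> p) r \<subseteq> \<phi> ` (U \<inter> N)"
    and m: "\<And>q v. q \<in> U \<Longrightarrow> \<phi> q \<in> cball (\<phi> p) r \<Longrightarrow> m * norm v \<le> sqrt (metric M (U, \<phi>) q v v)"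
    by (rule chart_ball[OF U assms]) blast
  let ?W = "U \<inter> \<phi> -` ball (\<phi> p) r" and ?B = "U \<inter> \<phi> -` cball (\<phi> p) (r / 2)"
  have W: "openin X ?W" by (rule chart_inv_openin[OF U(1)]) simp
  have "cball (\<phi> p) (r / 2) \<subseteq> cball (\<phi> p) r" using r(1) by (intro subset_cball) simp
  with r(3) have "cball (\<phi> p) (r / 2) \<subseteq> \<phi> ` U" by blast
  then have B: "closedin X ?B"
    by (rule chart_closed_preimage[OF U(1) compact_cball])
  have WN: "?W \<subseteq> N"
  proof
    fix q assume q: "q \<in> ?W"
    then have "\<phi> q \<in> \<phi> ` (U \<inter> N)" using r(3) by fastforce
    then show "q \<in> N" using q chart_inj[OF U(1)] by (auto dest: inj_onD)
  qed
  show ?thesis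
  proof (rule that)
    show "m * (r / 2) > 0" using r by simp
    fix y assume "inf_len M S p y < ennreal (m * (r / 2))"
    then obtain \<gamma> where g: "smooth_path M \<gamma>" "\<gamma> 0 = p" "\<gamma> 1 = y" "path_len M \<gamma> < ennreal (m * (r / 2))"
      by (rule inf_len_lessE)
    have len: "integral {0..1} (speed M \<gamma>) < m * (r / 2)"
      using g(4) path_len_nonneg[OF g(1)] unfolding path_len_def by (simp add: ennreal_less_iff)
    have cg: "continuous_map (top_of_set {0..1}) X \<gamma>"
      using g(1) unfolding smooth_path_def pathin_def by blast
    let ?E = "{t \<in> {0..1}. \<gamma> t \<notin> ?W}"
    have "?E = {}"
    proof (rule ccontr)
      assume ne: "?E \<noteq> {}"
      have "openin (top_of_set {0..1}) {t \<in> {0..1}. \<gamma> t \<in> ?W}"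
        using openin_continuous_map_preimage[OF cg W] by simp
      then have "closedin (top_of_set {0..1}) ({0..1} - {t \<in> {0..1}. \<gamma> t \<in> ?W})"
        by (intro closedin_diff) auto
      moreover have "{0..1} - {t \<in> {0..1}. \<gamma> t \<in> ?W} = ?E" by auto
      ultimately have "closedin (top_of_set {0..1}) ?E" by (simp only:)
      then have comp: "compact ?E" by (rule closedin_compact[OF compact_Icc])
      \<comment> \<open>The first time outside W; up to T the coordinates of the path can be
        differentiated and its displacement integrated.\<close>
      obtain T where T: "T \<in> ?E" "\<And>t. t \<in> ?E \<Longrightarrow> T \<le> t"
        using compact_attains_inf[OF comp ne] by blast
      have T0: "0 < T"
        using T(1) g(2) U r by (cases "T = 0") auto
      have before: "\<gamma> t \<in> ?B" if t: "t \<in> {0..<T}" for t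
      proof -
        have inW: "\<gamma> s \<in> ?W" if "s \<in> {0..t}" for s
        proof (rule ccontr)
          assume "\<gamma> s \<notin> ?W"
          moreover have "s \<in> {0..1}" using that t T(1) by auto
          ultimately have "s \<in> ?E" by blast
          from T(2)[OF this] that t show False by simp
        qed
        have D: "\<exists>v. ((\<lambda>s. \<phi> (\<gamma> s)) has_vector_derivative v) (at s within {0..1})" if s: "s \<in> {0..t}" for s
        proof -
          have s01: "s \<in> {0..1}" using s t T(1) by auto
          have sg: "smooth_at \<gamma> s" by (rule smooth_path_smooth_at[OF g(1) s01])
          have sU: "\<gamma> s \<in> U" using inW[OF s] by blast
          obtain \<delta> c where c: "\<delta> > 0" "smooth_on {s - \<delta><..<s + \<delta>} c"
            "\<And>r. r \<in> {0..1} \<Longrightarrow> r \<in> {s - \<delta><..<s + \<delta>} \<Longrightarrow> \<gamma> r \<in> U \<and> c r = \<phi> (\<gamma> r)"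
            by (rule smooth_atE[OF sg s01 U(1) sU chart_openin[OF U(1)] sU]) blast
          have "s \<in> {s - \<delta><..<s + \<delta>}" using c(1) by simp
          note has_vector_derivative_at_within[OF smooth_on_vector_derivative(2)[OF c(2) this]]
          then have "((\<lambda>s. \<phi> (\<gamma> s)) has_vector_derivative vector_derivative c (at s)) (at s within {0..1})"
            by (rule has_vector_derivative_transform_within[OF _ c(1) s01])
              (use c(3) in \<open>auto simp: dist_real_def abs_less_iff\<close>)
          then show ?thesis by blast
        qed
        then obtain v where v: "\<And>s. s \<in> {0..t} \<Longrightarrow>
            ((\<lambda>s. \<phi> (\<gamma> s)) has_vector_derivative v s) (at s within {0..1})"
          by metis
        have t1: "0 \<le> t" "t \<le> 1" using t T(1) by auto
        have vi: "(v has_integral (\<phi> (\<gamma> t) - \<phi> (\<gamma> 0))) {0..t}"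
          by (rule fundamental_theorem_of_calculus[OF t1(1)
                has_vector_derivative_within_subset[OF v]]) (use t1 in auto)
        have vb: "norm (v s) \<le> speed M \<gamma> s / m" if s: "s \<in> {0..t}" for s
        proof -
          have s01: "s \<in> {0..1}" using s t1 by auto
          have sU: "\<gamma> s \<in> U" using inW[OF s] by blast
          have "speed M \<gamma> s = sqrt (metric M (U, \<phi>) (\<gamma> s) (v s) (v s))"
            by (rule speed_eq[OF U(1) sU s01 smooth_path_smooth_at[OF g(1) s01] v[OF s]])
          moreover have "m * norm (v s) \<le> sqrt (metric M (U, \<phi>) (\<gamma> s) (v s) (v s))"
            by (rule m[OF sU]) (use inW[OF s] in auto)
          ultimately show ?thesis using r(2) by (simp add: field_simps)
        qed
        have si: "(\<lambda>s. speed M \<gamma> s / m) integrable_on {0..t}"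
          using integrable_cmul[OF speed_integrable[OF g(1), of 0 t], of "1 / m"] t1 by simp
        have "norm (\<phi> (\<gamma> t) - \<phi> (\<gamma> 0)) \<le> integral {0..t} (\<lambda>s. speed M \<gamma> s / m)"
          using integral_norm_bound_integral[OF has_integral_integrable[OF vi] si vb]
          unfolding integral_unique[OF vi] .
        also have "\<dots> = integral {0..t} (speed M \<gamma>) / m" by simp
        also have "\<dots> \<le> integral {0..1} (speed M \<gamma>) / m"
          using t1 r(2) by (intro divide_right_mono integral_subset_le speed_integrable[OF g(1)] ballI
              speed_nonneg[OF g(1)]) auto
        also have "\<dots> \<le> r / 2" using len r(2) by (simp add: field_simps)
        finally show ?thesis
          using inW[of t] t g(2) by (auto simp: dist_norm norm_minus_commute)
      qed
      \<comment> \<open>The bound by r/2 survives the limit at T because the preimage of the closed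
        ball is closed in X. So the path is still in W at time T, contrary to the choice of
        T.\<close>
      have "closedin (top_of_set {0..1}) {t \<in> {0..1}. \<gamma> t \<in> ?B}"
        using closedin_continuous_map_preimage[OF cg B] by simp
      then have "closed {t \<in> {0..1}. \<gamma> t \<in> ?B}"
        using closedin_closed_eq closed_atLeastAtMost by blast
      moreover have "{0..<T} \<subseteq> {t \<in> {0..1}. \<gamma> t \<in> ?B}"
        using before T(1) by auto
      ultimately have "closure {0..<T} \<subseteq> {t \<in> {0..1}. \<gamma> t \<in> ?B}"
        by (rule closure_minimal[rotated])
      moreover have "T \<in> closure {0..<T}" using T0 by simp
      ultimately have "\<gamma> T \<in> ?B" by blast
      then show False using T(1) r(1) by auto
    qed
    then have "y \<in> ?W" using g(3) by auto
    then show "y \<in> N" using WN by blast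
  qed
qed

section \<open>The metrics \<open>\<rho>\<^sub>X\<close> and \<open>\<rho>\<^sub>Y\<close>\<close>

lemma eventually_nhds_Int:
  assumes "x \<in> topspace X"
  shows "eventually P (nhds_Int M Y x) \<longleftrightarrow>
    (\<exists>N. openin X N \<and> x \<in> N \<and> (\<forall>z\<in>N \<inter> Int_of M Y. P z))"
  using assms unfolding nhds_Int_def by (auto simp: eventually_inf_principal eventually_nhdsin)

lemma less_rho_subE:
  assumes "x \<in> topspace X" "y \<in> topspace X" "r < rho_sub M Y x y"
  obtains N N' where "openin X N" "openin X N'" "x \<in> N" "y \<in> N'"
    "\<And>x' y'. x' \<in> N \<inter> Int_of M Y \<Longrightarrow> y' \<in> N' \<inter> Int_of M Y \<Longrightarrow> r < inf_len M (Int_of M Y) x' y'"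
proof -
  have "eventually (\<lambda>z. case z of (x', y') \<Rightarrow> r < inf_len M (Int_of M Y) x' y')
      (nhds_Int M Y x \<times>\<^sub>F nhds_Int M Y y)"
    using less_LiminfD[OF assms(3)[unfolded rho_sub_def]] by (simp add: case_prod_beta)
  then obtain P Q where "eventually P (nhds_Int M Y x)" "eventually Q (nhds_Int M Y y)"
    and PQ: "\<And>x' y'. P x' \<Longrightarrow> Q y' \<Longrightarrow> r < inf_len M (Int_of M Y) x' y'"
    unfolding eventually_prod_filter by auto
  then obtain N N' where "openin X N" "x \<in> N" "\<forall>z\<in>N \<inter> Int_of M Y. P z"
    "openin X N'" "y \<in> N'" "\<forall>z\<in>N' \<inter> Int_of M Y. Q z"
    unfolding eventually_nhds_Int[OF assms(1)] eventually_nhds_Int[OF assms(2)] by blast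
  then show ?thesis using that[of N N'] PQ by blast
qed

text \<open>The interior points near x and y are part of what is gained: over a trivial filter the
  Liminf would be infinite, so the strict inequality already forces them to exist.\<close>

lemma rho_sub_lessE:
  assumes "rho_sub M Y x y < r" "openin X N" "x \<in> N" "openin X N'" "y \<in> N'"
  obtains x' y' where "x' \<in> N \<inter> Int_of M Y" "y' \<in> N' \<inter> Int_of M Y"
    "inf_len M (Int_of M Y) x' y' < r"
proof -
  have "\<exists>x'\<in>N \<inter> Int_of M Y. \<exists>y'\<in>N' \<inter> Int_of M Y. inf_len M (Int_of M Y) x' y' < r"
  proof (rule ccontr)
    assume "\<not> ?thesis"
    then have *: "r \<le> inf_len M (Int_of M Y) x' y'"
      if "x' \<in> N \<inter> Int_of M Y" "y' \<in> N' \<inter> Int_of M Y" for x' y'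
      using that not_less by blast
    have xy: "x \<in> topspace X" "y \<in> topspace X"
      using assms openin_subset by blast+
    have "eventually (\<lambda>z. r \<le> (case z of (x', y') \<Rightarrow> inf_len M (Int_of M Y) x' y'))
        (nhds_Int M Y x \<times>\<^sub>F nhds_Int M Y y)"
      unfolding eventually_prod_filter eventually_nhds_Int[OF xy(1)] eventually_nhds_Int[OF xy(2)]
      using assms(2-5) * by (intro exI[of _ "\<lambda>z. z \<in> N \<inter> Int_of M Y"] exI[of _ "\<lambda>z. z \<in> N' \<inter> Int_of M Y"]) auto
    then have "r \<le> rho_sub M Y x y" unfolding rho_sub_def by (rule Liminf_bounded)
    then show False using assms(1) by simp
  qed
  then show ?thesis using that by blast
qed

text \<open>For interior points the pair (x, y) itself lies in every product of neighbourhoods that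
  enters the liminf.\<close>

lemma rho_sub_le_inf_len:
  assumes "x \<in> Int_of M Y" "y \<in> Int_of M Y" "Y \<subseteq> topspace X"
  shows "rho_sub M Y x y \<le> inf_len M (Int_of M Y) x y"
proof (rule ccontr)
  assume "\<not> ?thesis"
  then have lt: "inf_len M (Int_of M Y) x y < rho_sub M Y x y" by simp
  have xt: "x \<in> topspace X" and yt: "y \<in> topspace X"
    using assms by (auto simp: manifold_interior_def)
  obtain N N' where "x \<in> N" "y \<in> N'"
    "\<And>x' y'. x' \<in> N \<inter> Int_of M Y \<Longrightarrow> y' \<in> N' \<inter> Int_of M Y \<Longrightarrow>
       inf_len M (Int_of M Y) x y < inf_len M (Int_of M Y) x' y'"
    by (rule less_rho_subE[OF xt yt lt]) blast
  then show False using assms(1,2) by blast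
qed

lemma rho_sub_sym:
  assumes "x \<in> topspace X" "y \<in> topspace X"
  shows "rho_sub M Y x y = rho_sub M Y y x"
proof -
  have le: "rho_sub M Y x y \<le> rho_sub M Y y x" if xy: "x \<in> topspace X" "y \<in> topspace X" for x y
  proof (rule ccontr)
    assume "\<not> ?thesis"
    then have "rho_sub M Y y x < rho_sub M Y x y" by simp
    then obtain r where r: "rho_sub M Y y x < r" "r < rho_sub M Y x y" using dense by blast
    obtain N N' where N: "openin X N" "openin X N'" "x \<in> N" "y \<in> N'"
      "\<And>x' y'. x' \<in> N \<inter> Int_of M Y \<Longrightarrow> y' \<in> N' \<inter> Int_of M Y \<Longrightarrow> r < inf_len M (Int_of M Y) x' y'"
      using less_rho_subE[OF xy r(2)] by blast
    obtain y' x' where "y' \<in> N' \<inter> Int_of M Y" "x' \<in> N \<inter> Int_of M Y" "inf_len M (Int_of M Y) y' x' < r"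
      by (rule rho_sub_lessE[OF r(1) N(2,4,1,3)])
    then show False using N(5)[of x' y'] inf_len_sym by (metis less_asym)
  qed
  then show ?thesis using assms by (intro antisym) auto
qed

abbreviation rhoX :: "'a \<Rightarrow> 'a \<Rightarrow> ennreal" where "rhoX \<equiv> rho_space M"

lemma rhoX_triangle: "rhoX x z \<le> rhoX x y + rhoX y z"
  unfolding rho_space_def by (rule inf_len_triangle)

lemma rhoX_sym: "rhoX x y = rhoX y x"
  unfolding rho_space_def by (rule inf_len_sym)

lemma rhoX_le_inf_len: "S \<subseteq> topspace X \<Longrightarrow> rhoX x y \<le> inf_len M S x y"
  unfolding rho_space_def by (rule inf_len_mono)

lemma rhoX_small:
  assumes "p \<in> topspace X" "\<epsilon> > 0"
  obtains N where "openin X N" "p \<in> N" "\<And>y. y \<in> N \<Longrightarrow> rhoX p y < ennreal \<epsilon>"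
proof -
  obtain N where "openin X N" "p \<in> N" "\<And>y. y \<in> N \<Longrightarrow> inf_len M (topspace X) p y < ennreal \<epsilon>"
    by (rule inf_len_small[OF openin_topspace assms]) blast
  then show ?thesis using that unfolding rho_space_def by blast
qed

lemma rhoX_escape:
  assumes "openin X N" "p \<in> N"
  obtains \<epsilon> where "\<epsilon> > 0" "\<And>y. rhoX p y < ennreal \<epsilon> \<Longrightarrow> y \<in> N"
proof -
  obtain \<epsilon> where "\<epsilon> > 0" "\<And>y. inf_len M (topspace X) p y < ennreal \<epsilon> \<Longrightarrow> y \<in> N"
    by (rule inf_len_escape[OF assms]) blast
  then show ?thesis using that unfolding rho_space_def by blast
qed

lemma rhoX_self: "p \<in> topspace X \<Longrightarrow> rhoX p p = 0"
  unfolding rho_space_def by (rule inf_len_self) auto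

lemma Int_subset: "Y \<subseteq> topspace X \<Longrightarrow> Int_of M Y \<subseteq> Y"
  by (auto simp: manifold_interior_def)

text \<open>Paths in the interior compete for \<open>rhoX\<close> as well, and moving their end
  points back to x and y costs arbitrarily little in \<open>rhoX\<close>. One third of e goes to
  each end and one to the approximation of the liminf.\<close>

lemma rhoX_le_rho_sub:
  assumes "Y \<subseteq> topspace X" "x \<in> Y" "y \<in> Y"
  shows "rhoX x y \<le> rho_sub M Y x y"
proof (rule ennreal_le_epsilon)
  have AC: "E + ((R + E) + E) = R + (E + E + E)" for R E :: ennreal
    by (simp only: ac_simps)
  fix e :: real assume fin: "rho_sub M Y x y < top" and e: "0 < e"
  have xy: "x \<in> topspace X" "y \<in> topspace X" using assms by auto
  have e3: "e / 3 > 0" using e by simp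
  obtain N where N: "openin X N" "x \<in> N" "\<And>z. z \<in> N \<Longrightarrow> rhoX x z < ennreal (e / 3)"
    using rhoX_small[OF xy(1) e3] by blast
  obtain N' where N': "openin X N'" "y \<in> N'" "\<And>z. z \<in> N' \<Longrightarrow> rhoX y z < ennreal (e / 3)"
    using rhoX_small[OF xy(2) e3] by blast
  obtain x' y' where x': "x' \<in> N \<inter> Int_of M Y" "y' \<in> N' \<inter> Int_of M Y"
    "inf_len M (Int_of M Y) x' y' < rho_sub M Y x y + ennreal (e / 3)"
    by (rule rho_sub_lessE[OF ennreal_less_add[OF fin e3] N(1,2) N'(1,2)])
  have "rhoX x y \<le> rhoX x x' + (rhoX x' y' + rhoX y' y)"
    using rhoX_triangle[of x y x'] add_left_mono[OF rhoX_triangle[of x' y y'], of "rhoX x x'"]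
    by (rule order_trans)
  also have "\<dots> \<le> ennreal (e / 3) + ((rho_sub M Y x y + ennreal (e / 3)) + ennreal (e / 3))"
  proof (intro add_mono)
    show "rhoX x x' \<le> ennreal (e / 3)" using N(3)[of x'] x'(1) by auto
    show "rhoX y' y \<le> ennreal (e / 3)" using N'(3)[of y'] x'(2) rhoX_sym[of y y'] by auto
    show "rhoX x' y' \<le> rho_sub M Y x y + ennreal (e / 3)"
      by (rule order_trans[OF rhoX_le_inf_len less_imp_le[OF x'(3)]])
        (use Int_subset[OF assms(1)] assms(1) in blast)
  qed
  also have "\<dots> = rho_sub M Y x y + (ennreal (e / 3) + ennreal (e / 3) + ennreal (e / 3))"
    by (rule AC)
  also have "ennreal (e / 3) + ennreal (e / 3) + ennreal (e / 3) = ennreal e"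
    using e by (simp flip: ennreal_plus)
  finally show "rhoX x y \<le> rho_sub M Y x y + ennreal e" .
qed

section \<open>Invariance of domain on the surface: manifold interior and boundary charts\<close>

lemma openin_continuous_injective_image:
  fixes f :: "'a \<Rightarrow> real^2"
  assumes "openin X G" "continuous_map (subtopology X G) euclidean f" "inj_on f G" "q \<in> G"
  obtains T where "open T" "f q \<in> T" "T \<subseteq> f ` G"
proof -
  obtain U \<phi> where U: "(U, \<phi>) \<in> charts M" "q \<in> U"
    using chart_at assms openin_subset by blast
  let ?D = "\<phi> ` (U \<inter> G)"
  let ?i = "inv_into U \<phi>"
  have D: "open ?D" by (rule chart_image_open[OF U(1) assms(1)])
  obtain g where g: "homeomorphic_maps (subtopology X U) (top_of_set (\<phi> ` U)) \<phi> g"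
    using chart_homeo[OF U(1)] homeomorphic_map_maps by blast
  have gi: "g u = ?i u" if "u \<in> \<phi> ` U" for u
    using that g chart_inj[OF U(1)] chart_subset[OF U(1)]
    by (auto simp: homeomorphic_maps_def)
  have "continuous_map (top_of_set (\<phi> ` U)) (subtopology X U) g"
    using g by (simp add: homeomorphic_maps_def)
  then have "continuous_map (top_of_set (\<phi> ` U)) (subtopology X U) ?i"
    by (rule continuous_map_eq) (simp add: gi)
  then have "continuous_map (top_of_set ?D) X ?i"
    by (metis continuous_map_from_subtopology_mono continuous_map_into_fulltopology image_mono inf_le1)
  moreover have "?i ` ?D \<subseteq> G" using chart_inj[OF U(1)] by auto
  ultimately have "continuous_map (top_of_set ?D) (subtopology X G) ?i"
    by (auto simp: continuous_map_in_subtopology)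
  then have "continuous_map (top_of_set ?D) euclidean (f \<circ> ?i)"
    using assms(2) by (rule continuous_map_compose)
  then have cont: "continuous_on ?D (f \<circ> ?i)" by simp
  have im: "(f \<circ> ?i) ` ?D = f ` (U \<inter> G)"
    using chart_inj[OF U(1)] by (force simp: image_iff)
  have "inj_on (f \<circ> ?i) ?D"
    using chart_inj[OF U(1)] assms(3) by (auto simp: inj_on_def)
  then have "open ((f \<circ> ?i) ` ?D)"
    by (rule invariance_of_domain[OF cont D])
  then show ?thesis using that[of "f ` (U \<inter> G)"] im U assms by auto
qed

text \<open>Read in a chart of X, the inverse homeomorphism becomes an injective continuous map from
  an open planar set to the plane, whose image is open by invariance of domain.\<close>

lemma openin_if_homeomorphic_open:
  assumes "S \<subseteq> topspace X" "subtopology X S homeomorphic_space top_of_set V" "open (V :: (real^2) set)"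
  shows "openin X S"
proof (subst openin_subopen, intro ballI)
  fix p assume p: "p \<in> S"
  obtain f g where fg: "homeomorphic_maps (subtopology X S) (top_of_set V) f g"
    using assms(2) unfolding homeomorphic_space_def by blast
  obtain U \<phi> where U: "(U, \<phi>) \<in> charts M" "p \<in> U"
    using chart_at assms p by blast
  have hf: "homeomorphic_map (subtopology X S) (top_of_set V) f"
    and gf: "\<And>x. x \<in> S \<Longrightarrow> g (f x) = x" and cg: "continuous_map (top_of_set V) (subtopology X S) g"
    using fg assms(1) by (auto simp: homeomorphic_maps_map homeomorphic_imp_continuous_map)
  let ?D = "f ` (S \<inter> U)"
  have "openin (subtopology X S) (S \<inter> U)"
    using chart_openin[OF U(1)] by (auto simp: openin_subtopology)
  then have "openin (top_of_set V) ?D"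
    using homeomorphic_map_openness_eq[OF hf] by blast
  then have D: "open ?D" using assms(3) openin_open_trans by blast
  have "?D \<subseteq> V" using homeomorphic_imp_surjective_map[OF hf] assms(1) by auto
  then have "continuous_map (top_of_set ?D) X g"
    using cg by (metis continuous_map_from_subtopology_mono continuous_map_into_fulltopology)
  moreover have "g ` ?D \<subseteq> U" using gf by auto
  ultimately have "continuous_map (top_of_set ?D) (subtopology X U) g"
    by (auto simp: continuous_map_in_subtopology)
  moreover have "continuous_map (subtopology X U) euclidean \<phi>"
    using homeomorphic_imp_continuous_map[OF chart_homeo[OF U(1)]] continuous_map_into_fulltopology by blast
  ultimately have "continuous_map (top_of_set ?D) euclidean (\<phi> \<circ> g)" by (rule continuous_map_compose)
  then have cont: "continuous_on ?D (\<phi> \<circ> g)" by simp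
  have im: "(\<phi> \<circ> g) ` ?D = \<phi> ` (S \<inter> U)"
    using gf by (force simp: image_iff)
  have "inj_on (\<phi> \<circ> g) ?D"
    using chart_inj[OF U(1)] gf by (auto simp: inj_on_def)
  then have "open (\<phi> ` (S \<inter> U))"
    using invariance_of_domain[OF cont D] im by simp
  then have "openin X (U \<inter> \<phi> -` (\<phi> ` (S \<inter> U)))" by (rule chart_inv_openin[OF U(1)])
  moreover have "U \<inter> \<phi> -` (\<phi> ` (S \<inter> U)) \<subseteq> S"
    using chart_inj[OF U(1)] by (auto dest: inj_onD)
  ultimately show "\<exists>T. openin X T \<and> p \<in> T \<and> T \<subseteq> S" using U p by blast
qed

text \<open>Y and X have equal dimension, so a planar neighbourhood within Y is automatically open
  in X. This makes the local estimates for \<open>inf_len\<close>, which concern open sets,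
  applicable to the interior of Y.\<close>

lemma Int_openin:
  assumes "Y \<subseteq> topspace X"
  shows "openin X (Int_of M Y)"
proof (subst openin_subopen, intro ballI)
  fix p assume p: "p \<in> Int_of M Y"
  then obtain U V where U: "openin (subtopology X Y) U" "p \<in> U" "open (V :: (real^2) set)"
     "subtopology (subtopology X Y) U homeomorphic_space top_of_set V"
    unfolding manifold_interior_def by blast
  have UY: "U \<subseteq> Y" "U \<subseteq> topspace X" using openin_subset[OF U(1)] by auto
  have "openin X U"
    by (rule openin_if_homeomorphic_open[OF UY(2) _ U(3)])
      (use U(4) UY in \<open>simp add: subtopology_subtopology Int_absorb1\<close>)
  moreover have "U \<subseteq> Int_of M Y"
    using openin_subset[OF U(1)] U unfolding manifold_interior_def by blast
  ultimately show "\<exists>T. openin X T \<and> p \<in> T \<and> T \<subseteq> Int_of M Y" using U by blast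
qed

lemma Bd_eq: "Y \<subseteq> topspace X \<Longrightarrow> Bd_of M Y = Y - Int_of M Y"
  by (simp add: manifold_boundary_def Int_absorb1)

text \<open>\<open>manifold_interior\<close> lets each interior point choose its own planar
  neighbourhood; that one half-plane chart decides about all its points is invariance of the
  boundary. An interior point on the edge would have a neighbourhood whose chart image is open in
  the plane, hence sticks out of the half plane.\<close>

lemma boundary_chart:
  assumes "Y \<subseteq> topspace X" "surface_with_boundary (subtopology X Y)" "p \<in> Y"
  obtains Q V \<psi> g where "openin (subtopology X Y) Q" "p \<in> Q" "openin (top_of_set half_plane) V"
    "homeomorphic_maps (subtopology X Q) (top_of_set V) \<psi> g"
    "\<And>q. q \<in> Q \<Longrightarrow> q \<in> Int_of M Y \<longleftrightarrow> 0 < \<psi> q $ 2"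
proof -
  have "p \<in> topspace (subtopology X Y)" using assms by auto
  then obtain Q V where Q: "openin (subtopology X Y) Q" "p \<in> Q" "openin (top_of_set half_plane) V"
    "subtopology (subtopology X Y) Q homeomorphic_space top_of_set V"
    using assms(2) unfolding surface_with_boundary_def by blast
  have QY: "Q \<subseteq> Y" "Q \<subseteq> topspace X" using openin_subset[OF Q(1)] by auto
  have "subtopology X Q homeomorphic_space top_of_set V"
    using Q(4) QY by (simp add: subtopology_subtopology Int_absorb1)
  then obtain \<psi> g where psi: "homeomorphic_maps (subtopology X Q) (top_of_set V) \<psi> g"
    unfolding homeomorphic_space_def by blast
  then have hm: "homeomorphic_map (subtopology X Q) (top_of_set V) \<psi>"
    by (simp add: homeomorphic_maps_map)
  have im: "\<psi> ` Q = V" using homeomorphic_imp_surjective_map[OF hm] QY by (simp add: Int_absorb1)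
  have inj: "inj_on \<psi> Q" using homeomorphic_imp_injective_map[OF hm] QY by (simp add: Int_absorb1)
  have cont: "continuous_map (subtopology X Q) euclidean \<psi>"
    using homeomorphic_imp_continuous_map[OF hm] continuous_map_into_fulltopology by blast
  have VH: "V \<subseteq> half_plane" using Q(3) openin_imp_subset by blast
  have "q \<in> Int_of M Y \<longleftrightarrow> 0 < \<psi> q $ 2" if q: "q \<in> Q" for q
  proof
    assume pos: "0 < \<psi> q $ 2"
    let ?P = "{x :: real^2. 0 < x $ 2}"
    have oP: "open ?P" by (rule open_halfspace_component_gt_cart)
    obtain V' where V': "open V'" "V = half_plane \<inter> V'" using Q(3) by (auto simp: openin_open)
    have "V \<inter> ?P = V' \<inter> ?P" using V' by (auto simp: half_plane_def)
    then have oV: "open (V \<inter> ?P)" using V' oP by auto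
    let ?Q = "Q \<inter> \<psi> -` ?P"
    have "openin (subtopology X Q) {x \<in> topspace (subtopology X Q). \<psi> x \<in> ?P}"
      using openin_continuous_map_preimage[OF cont] oP open_openin by blast
    moreover have "{x \<in> topspace (subtopology X Q). \<psi> x \<in> ?P} = ?Q" using QY by auto
    moreover have "subtopology X Q = subtopology (subtopology X Y) Q"
      using QY by (simp add: subtopology_subtopology Int_absorb1)
    ultimately have oQ: "openin (subtopology X Y) ?Q" using Q(1) openin_trans_full by metis
    have h1: "homeomorphic_map (subtopology (subtopology X Q) ?Q) (subtopology (top_of_set V) ?P) \<psi>"
      by (rule homeomorphic_map_subtopologies[OF hm]) (use im QY in auto)
    have e1: "subtopology (subtopology X Q) ?Q = subtopology (subtopology X Y) ?Q"
      using QY by (simp add: subtopology_subtopology Int_absorb1 le_infI1)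
    have e2: "subtopology (top_of_set V) ?P = top_of_set (V \<inter> ?P)"
      by (simp add: subtopology_subtopology)
    have h2: "subtopology (subtopology X Y) ?Q homeomorphic_space top_of_set (V \<inter> ?P)"
      using homeomorphic_map_imp_homeomorphic_space[OF h1] unfolding e1 e2 .
    have qQ: "q \<in> ?Q" using q pos by simp
    have "q \<in> topspace (subtopology X Y)" using q QY by auto
    then show "q \<in> Int_of M Y"
      using oQ oV qQ h2 unfolding manifold_interior_def by blast
  next
    assume qI: "q \<in> Int_of M Y"
    obtain Q' where Q': "openin X Q'" "Q = Q' \<inter> Y" using Q(1) by (auto simp: openin_subtopology)
    have oI: "openin X (Q \<inter> Int_of M Y)"
    proof -
      have "Q \<inter> Int_of M Y = Q' \<inter> Int_of M Y" using Q' Int_subset[OF assms(1)] by auto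
      then show ?thesis using Q' Int_openin[OF assms(1)] by auto
    qed
    obtain T where T: "open T" "\<psi> q \<in> T" "T \<subseteq> \<psi> ` (Q \<inter> Int_of M Y)"
    proof (rule openin_continuous_injective_image[OF oI, of \<psi> q])
      show "continuous_map (subtopology X (Q \<inter> Int_of M Y)) euclidean \<psi>"
        using cont by (rule continuous_map_from_subtopology_mono) auto
      show "inj_on \<psi> (Q \<inter> Int_of M Y)" using inj by (rule inj_on_subset) auto
    qed (use q qI in auto)
    show "0 < \<psi> q $ 2"
    proof (rule ccontr)
      assume "\<not> 0 < \<psi> q $ 2"
      obtain e where e: "e > 0" "ball (\<psi> q) e \<subseteq> T" using T open_contains_ball by blast
      \<comment> \<open>A point straight below the chart image of q, within the ball but outside the
        half plane.\<close>
      let ?z = "\<psi> q - (e / 2) *\<^sub>R axis 2 1"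
      have "?z \<in> ball (\<psi> q) e" using e by (simp add: dist_norm)
      then have "?z \<in> half_plane" using e T im VH by blast
      then have "0 \<le> \<psi> q $ 2 - e / 2" by (simp add: half_plane_def axis_def)
      then show False using e \<open>\<not> 0 < \<psi> q $ 2\<close> by simp
    qed
  qed
  then show ?thesis using that[OF Q(1-3) psi] by blast
qed

end

section \<open>Geodesics in compact intrinsic domains\<close>

text \<open>The situation of \<open>Y1\<close>, once the hypothesis on X has been applied to it. The
  equality of the metrics is assumed only within Y, so shortest paths are built from compactness of
  Y alone, without completeness of X.\<close>

locale intrinsic_domain = riemannian_surface +
  fixes Y :: "'a set"
  assumes Y_subset: "Y \<subseteq> topspace X"
    and Y_compact: "compactin X Y"
    and rho_fin: "\<And>x y. x \<in> Y \<Longrightarrow> y \<in> Y \<Longrightarrow> rho_sub M Y x y < \<infinity>"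
    and rho_eq: "\<And>x y. x \<in> Y \<Longrightarrow> y \<in> Y \<Longrightarrow> rhoX x y = rho_sub M Y x y"
begin

definition d :: "'a \<Rightarrow> 'a \<Rightarrow> real" where "d x y = enn2real (rhoX x y)"

lemma d_nonneg: "0 \<le> d x y"
  by (simp add: d_def)

lemma rhoX_d: "x \<in> Y \<Longrightarrow> y \<in> Y \<Longrightarrow> rhoX x y = ennreal (d x y)"
  using rho_fin rho_eq by (simp add: d_def less_top)

lemma d_sym: "d x y = d y x"
  by (simp add: d_def rhoX_sym)

lemma d_triangle: "x \<in> Y \<Longrightarrow> y \<in> Y \<Longrightarrow> z \<in> Y \<Longrightarrow> d x z \<le> d x y + d y z"
  using rhoX_triangle[of x z y] d_nonneg by (simp add: rhoX_d flip: ennreal_plus)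

lemma d_diff: "x \<in> Y \<Longrightarrow> y \<in> Y \<Longrightarrow> z \<in> Y \<Longrightarrow> \<bar>d x y - d x z\<bar> \<le> d y z"
  using d_triangle[of x y z] d_triangle[of x z y] d_sym[of y z] by auto

lemma d_self: "x \<in> Y \<Longrightarrow> d x x = 0"
  using rhoX_self Y_subset by (auto simp: d_def)

lemma d_less_iff: "x \<in> Y \<Longrightarrow> y \<in> Y \<Longrightarrow> rhoX x y < ennreal e \<longleftrightarrow> d x y < e"
  using d_nonneg[of x y] by (simp add: rhoX_d ennreal_less_iff)

lemma d_eq_0:
  assumes "x \<in> Y" "y \<in> Y" "d x y = 0"
  shows "x = y"
proof (rule ccontr)
  assume "x \<noteq> y"
  then obtain U V where UV: "openin X U" "x \<in> U" "y \<in> V" "disjnt U V"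
    using Hausdorff_X assms Y_subset unfolding Hausdorff_space_def by (metis subsetD)
  obtain e where e: "e > 0" "\<And>y. rhoX x y < ennreal e \<Longrightarrow> y \<in> U"
    using rhoX_escape[OF UV(1,2)] by blast
  have "y \<in> U" by (rule e(2)) (use e(1) assms d_less_iff in auto)
  then show False using UV by (auto simp: disjnt_iff)
qed

lemma openin_Y_iff:
  assumes "S \<subseteq> Y"
  shows "openin (subtopology X Y) S \<longleftrightarrow> (\<forall>x\<in>S. \<exists>r>0. \<forall>y\<in>Y. d x y < r \<longrightarrow> y \<in> S)"
proof
  assume "openin (subtopology X Y) S"
  then obtain N where N: "openin X N" "S = N \<inter> Y" by (auto simp: openin_subtopology)
  show "\<forall>x\<in>S. \<exists>r>0. \<forall>y\<in>Y. d x y < r \<longrightarrow> y \<in> S"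
  proof
    fix x assume x: "x \<in> S"
    then have "x \<in> N" using N by auto
    then obtain e where "e > 0" "\<And>y. rhoX x y < ennreal e \<Longrightarrow> y \<in> N"
      using rhoX_escape[OF N(1)] by blast
    then show "\<exists>r>0. \<forall>y\<in>Y. d x y < r \<longrightarrow> y \<in> S"
      using N x d_less_iff by (intro exI[of _ e]) auto
  qed
next
  assume R: "\<forall>x\<in>S. \<exists>r>0. \<forall>y\<in>Y. d x y < r \<longrightarrow> y \<in> S"
  show "openin (subtopology X Y) S"
  proof (subst openin_subopen, intro ballI)
    fix x assume x: "x \<in> S"
    then obtain r where r: "r > 0" "\<forall>y\<in>Y. d x y < r \<longrightarrow> y \<in> S" using R by blast
    have xX: "x \<in> topspace X" "x \<in> Y" using x assms Y_subset by auto
    obtain N where N: "openin X N" "x \<in> N" "\<And>y. y \<in> N \<Longrightarrow> rhoX x y < ennreal r"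
      using rhoX_small[OF xX(1) r(1)] by blast
    have "openin (subtopology X Y) (N \<inter> Y)" using N(1) by (auto simp: openin_subtopology)
    moreover have "N \<inter> Y \<subseteq> S" using N(3) r(2) d_less_iff[OF xX(2)] by blast
    ultimately show "\<exists>T. openin (subtopology X Y) T \<and> x \<in> T \<and> T \<subseteq> S"
      using N(2) xX(2) by blast
  qed
qed

lemma compact_Y_sub: "compact_space (subtopology X Y)"
  using Y_compact by (simp add: compact_space_subtopology)

lemma topspace_Y: "topspace (subtopology X Y) = Y"
  using Y_subset by auto

lemma continuous_d:
  assumes "x \<in> Y"
  shows "continuous_map (subtopology X Y) euclideanreal (d x)"
  unfolding continuous_map_def topspace_Y
proof (intro conjI allI impI)
  fix W :: "real set" assume "openin euclideanreal W"
  then have W: "open W" by simp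
  show "openin (subtopology X Y) {y \<in> Y. d x y \<in> W}"
  proof (subst openin_Y_iff, blast, intro ballI)
    fix y assume "y \<in> {y \<in> Y. d x y \<in> W}"
    then have y: "y \<in> Y" "d x y \<in> W" by auto
    then obtain e where e: "e > 0" "\<And>s. dist s (d x y) < e \<Longrightarrow> s \<in> W"
      using W unfolding open_dist by blast
    have "d x z \<in> W" if "z \<in> Y" "d y z < e" for z
      by (rule e(2)) (use d_diff[OF assms y(1) that(1)] that(2) in \<open>auto simp: dist_real_def\<close>)
    then show "\<exists>r>0. \<forall>z\<in>Y. d y z < r \<longrightarrow> z \<in> {y \<in> Y. d x y \<in> W}" using e(1) by blast
  qed
qed simp

lemma compact_image_d:
  assumes "x \<in> Y" "closedin (subtopology X Y) C"
  shows "compact (d x ` C)"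
proof -
  have "compactin (subtopology X Y) C"
    using closedin_compact_space[OF compact_Y_sub assms(2)] .
  then have "compactin euclideanreal (d x ` C)"
    using image_compactin continuous_d[OF assms(1)] by blast
  then show ?thesis by simp
qed

text \<open>By definition of \<open>rho_sub\<close> there is an interior path, from near x to near
  y, that is at most \<eta> too long; it stays in Y and passes a point at distance exactly half from
  x. The error is \<eta> for the length and \<eta> for each displaced end. The upper bound on \<eta>
  keeps the ends of the path on the two sides of the half-way value.\<close>

lemma approximate_midpoint:
  assumes "x \<in> Y" "y \<in> Y" "0 < \<eta>" "\<eta> < d x y / 2"
  obtains m where "m \<in> Y" "d x m = d x y / 2" "d m y \<le> d x y / 2 + 3 * \<eta>"
proof -
  let ?I = "Int_of M Y"
  have xX: "x \<in> topspace X" "y \<in> topspace X" using assms Y_subset by auto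
  obtain N where N: "openin X N" "x \<in> N" "\<And>z. z \<in> N \<Longrightarrow> rhoX x z < ennreal \<eta>"
    using rhoX_small[OF xX(1) assms(3)] by blast
  obtain N' where N': "openin X N'" "y \<in> N'" "\<And>z. z \<in> N' \<Longrightarrow> rhoX y z < ennreal \<eta>"
    using rhoX_small[OF xX(2) assms(3)] by blast
  have "rho_sub M Y x y = ennreal (d x y)"
    using rhoX_d[OF assms(1,2)] rho_eq[OF assms(1,2)] by simp
  moreover have "ennreal (d x y) < ennreal (d x y + \<eta>)"
    using assms(3) d_nonneg[of x y] by (simp add: ennreal_less_iff)
  ultimately have lt: "rho_sub M Y x y < ennreal (d x y + \<eta>)" by simp
  obtain x' y' where x': "x' \<in> N \<inter> ?I" "y' \<in> N' \<inter> ?I" "inf_len M ?I x' y' < ennreal (d x y + \<eta>)"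
    by (rule rho_sub_lessE[OF lt N(1,2) N'(1,2)])
  obtain \<sigma> where s: "smooth_path M \<sigma>" "\<sigma> ` {0..1} \<subseteq> ?I" "\<sigma> 0 = x'" "\<sigma> 1 = y'"
    "path_len M \<sigma> < ennreal (d x y + \<eta>)"
    by (rule inf_len_lessE[OF x'(3)])
  have IY: "?I \<subseteq> Y" by (rule Int_subset[OF Y_subset])
  have sY: "\<sigma> t \<in> Y" if "t \<in> {0..1}" for t using s(2) IY that by blast
  have xy'Y: "x' \<in> Y" "y' \<in> Y" using x' IY by auto
  have "d x x' < \<eta>" "d y y' < \<eta>"
    using d_less_iff[OF assms(1) xy'Y(1)] d_less_iff[OF assms(2) xy'Y(2)] N(3)[of x'] N'(3)[of y'] x'(1,2)
    by blast+
  note xy' = xy'Y this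
  have "continuous_map (top_of_set {0..1}) X \<sigma>"
    using s(1) unfolding smooth_path_def pathin_def by blast
  then have "continuous_map (top_of_set {0..1}) (subtopology X Y) \<sigma>"
    using sY by (auto simp: continuous_map_in_subtopology)
  then have "continuous_map (top_of_set {0..1}) euclideanreal (d x \<circ> \<sigma>)"
    using continuous_d[OF assms(1)] by (rule continuous_map_compose)
  then have cont: "continuous_on {0..1} (d x \<circ> \<sigma>)" by simp
  have ends: "(d x \<circ> \<sigma>) 0 \<le> d x y / 2" "d x y / 2 \<le> (d x \<circ> \<sigma>) 1"
    using d_triangle[OF assms(1) xy'(2) assms(2)] xy' assms(4) s d_sym[of y y'] by auto
  obtain t where t: "0 \<le> t" "t \<le> 1" "(d x \<circ> \<sigma>) t = d x y / 2"
    using IVT'[OF ends zero_le_one cont] by blast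
  have m: "\<sigma> t \<in> Y" using sY t by auto
  have "rhoX x' (\<sigma> t) + rhoX (\<sigma> t) y' \<le> inf_len M ?I x' (\<sigma> t) + inf_len M ?I (\<sigma> t) y'"
    by (intro add_mono rhoX_le_inf_len) (use IY Y_subset in auto)
  also have "\<dots> \<le> inf_len M ?I (\<sigma> 0) (\<sigma> t) + inf_len M ?I (\<sigma> t) (\<sigma> t) + inf_len M ?I (\<sigma> t) (\<sigma> 1)"
    unfolding s(3,4) by (intro add_right_mono) simp
  also have "\<dots> \<le> path_len M \<sigma>"
    by (rule inf_len_subdivide[OF Int_openin[OF Y_subset] s(1,2) t(1) order_refl t(2)])
  also have "\<dots> < ennreal (d x y + \<eta>)" by (rule s(5))
  finally have "d x' (\<sigma> t) + d (\<sigma> t) y' < d x y + \<eta>"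
    using d_nonneg by (simp add: rhoX_d m xy' ennreal_less_iff flip: ennreal_plus)
  moreover have "d x (\<sigma> t) \<le> d x x' + d x' (\<sigma> t)" "d (\<sigma> t) y \<le> d (\<sigma> t) y' + d y' y"
    using d_triangle assms m xy' by auto
  ultimately have "d (\<sigma> t) y \<le> d x y / 2 + 3 * \<eta>" using t(3) xy' d_sym[of y y'] by simp
  then show ?thesis using that m t(3) by auto
qed

text \<open>On the compact set of points at half distance from x, the distance to y attains its
  minimum, and approximate midpoints force that minimum down to one half.\<close>

lemma midpoint:
  assumes "x \<in> Y" "y \<in> Y"
  obtains m where "m \<in> Y" "d x m = d x y / 2" "d m y = d x y / 2"
proof (cases "d x y = 0")
  case True
  then show ?thesis using that[of x] assms d_self by simp
next
  case False
  then have L: "d x y > 0" using d_nonneg[of x y] by simp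
  let ?K = "{m \<in> Y. d x m \<in> {d x y / 2}}"
  have "closedin (subtopology X Y) {m \<in> topspace (subtopology X Y). d x m \<in> {d x y / 2}}"
    by (rule closedin_continuous_map_preimage[OF continuous_d[OF assms(1)]]) simp
  then have K: "closedin (subtopology X Y) ?K" unfolding topspace_Y .
  have "0 < d x y / 4" "d x y / 4 < d x y / 2" using L by auto
  from approximate_midpoint[OF assms this] have ne: "d y ` ?K \<noteq> {}" by blast
  obtain m where m: "m \<in> ?K" "\<And>k. k \<in> ?K \<Longrightarrow> d y m \<le> d y k"
    using compact_attains_inf[OF compact_image_d[OF assms(2) K] ne] by blast
  have "d y m \<le> d x y / 2 + e" if e: "e > 0" for e
  proof -
    \<comment> \<open>The first bound makes the error of \<open>approximate_midpoint\<close> at most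
      e, the second meets its requirement on \<eta>.\<close>
    define \<eta> where "\<eta> = min (e / 3) (d x y / 4)"
    have \<eta>: "0 < \<eta>" "\<eta> < d x y / 2" "3 * \<eta> \<le> e" using e L by (auto simp: \<eta>_def)
    obtain k where "k \<in> Y" "d x k = d x y / 2" "d k y \<le> d x y / 2 + 3 * \<eta>"
      by (rule approximate_midpoint[OF assms \<eta>(1,2)])
    then show ?thesis using m(2)[of k] \<eta>(3) d_sym[of k y] by auto
  qed
  then have "d y m \<le> d x y / 2" by (rule field_le_epsilon)
  moreover have "d x y \<le> d x m + d m y" using d_triangle assms m by auto
  ultimately show ?thesis using that[of m] m(1) d_sym[of m y] by auto
qed

text \<open>A maximal subset on which \<open>d a\<close> is an isometry into the reals has no gaps, because a gap
  could be filled by a midpoint; it is thus a geodesic.\<close>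

lemma geodesic_through:
  assumes "a \<in> Y" "b \<in> Y" "c \<in> Y" "d a b = d a c + d c b" "d a b > 0"
  obtains \<gamma> where "\<And>t. t \<in> {0..1} \<Longrightarrow> \<gamma> t \<in> Y"
    "\<And>s t. s \<in> {0..1} \<Longrightarrow> t \<in> {0..1} \<Longrightarrow> d (\<gamma> s) (\<gamma> t) = d a b * \<bar>s - t\<bar>"
    "\<gamma> 0 = a" "\<gamma> 1 = b" "\<gamma> (d a c / d a b) = c"
proof -
  let ?e = "d a" and ?L = "d a b"
  define A where "A = {C. C \<subseteq> Y \<and> {a, b, c} \<subseteq> C \<and> (\<forall>x\<in>C. \<forall>y\<in>C. d x y = \<bar>?e x - ?e y\<bar>)}"
  have "{a, b, c} \<in> A"
    using assms d_self d_sym[of b a] d_sym[of c a] d_sym[of b c] d_nonneg[of a c] d_nonneg[of c b]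
    by (auto simp: A_def)
  then have ne: "A \<noteq> {}" by blast
  have "\<Union>\<C> \<in> A" if C: "\<C> \<noteq> {}" "subset.chain A \<C>" for \<C>
  proof -
    have CA: "\<C> \<subseteq> A" using C(2) by (simp add: subset.chain_def)
    have "d x y = \<bar>?e x - ?e y\<bar>" if xy: "x \<in> \<Union>\<C>" "y \<in> \<Union>\<C>" for x y
    proof -
      obtain C1 C2 where 12: "C1 \<in> \<C>" "x \<in> C1" "C2 \<in> \<C>" "y \<in> C2" using xy by blast
      then consider "C1 \<subseteq> C2" | "C2 \<subseteq> C1" using C(2) by (auto simp: subset.chain_def)
      then show ?thesis using 12 CA unfolding A_def by cases blast+
    qed
    moreover have "\<Union>\<C> \<subseteq> Y" "{a, b, c} \<subseteq> \<Union>\<C>" using CA C(1) unfolding A_def by blast+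
    ultimately show ?thesis unfolding A_def by blast
  qed
  from subset_Zorn_nonempty[OF ne this] obtain C where C: "C \<in> A" "\<And>D. D \<in> A \<Longrightarrow> C \<subseteq> D \<Longrightarrow> D = C"
    by blast
  have CY: "C \<subseteq> Y" and abc: "a \<in> C" "b \<in> C" "c \<in> C"
    and iso: "\<And>x y. x \<in> C \<Longrightarrow> y \<in> C \<Longrightarrow> d x y = \<bar>?e x - ?e y\<bar>"
    using C(1) unfolding A_def by blast+
  have max: "x \<in> C" if x: "x \<in> Y" "\<And>y. y \<in> C \<Longrightarrow> d x y = \<bar>?e x - ?e y\<bar>" for x
  proof -
    have "d y x = \<bar>?e y - ?e x\<bar>" if "y \<in> C" for y
      using x(2)[OF that] d_sym[of x y] abs_minus_commute[of "?e x" "?e y"] by argo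
    then have "d u v = \<bar>?e u - ?e v\<bar>" if "u \<in> insert x C" "v \<in> insert x C" for u v
      using that iso[of u v] x(2)[of v] d_self[OF x(1)] by (cases "u = x"; cases "v = x") simp_all
    then have "insert x C \<in> A"
      using CY abc x(1) unfolding A_def by blast
    then show ?thesis using C(2)[of "insert x C"] by auto
  qed
  \<comment> \<open>A limit of points of C satisfies the same distance equations, so maximality puts
    it into C. Consequently the values of \<open>d a\<close> on C form a compact set, and a gap in
    them has two end points that are attained.\<close>
  have closed: "closedin (subtopology X Y) C"
    unfolding closedin_def topspace_Y
  proof (intro conjI CY, subst openin_Y_iff, blast, intro ballI, rule ccontr)
    fix x assume x: "x \<in> Y - C" and "\<not> (\<exists>r>0. \<forall>y\<in>Y. d x y < r \<longrightarrow> y \<in> Y - C)"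
    then have app: "\<exists>z\<in>C. d x z < r" if "r > 0" for r using that by blast
    have "d x y = \<bar>?e x - ?e y\<bar>" if y: "y \<in> C" for y
    proof -
      have "\<bar>d x y - \<bar>?e x - ?e y\<bar>\<bar> \<le> 0 + r" if r: "r > 0" for r
      proof -
        obtain z where z: "z \<in> C" "d x z < r / 2" using app[of "r / 2"] r by auto
        have "\<bar>d y x - d y z\<bar> \<le> d x z" "\<bar>?e x - ?e z\<bar> \<le> d x z"
          using d_diff x y z CY assms(1) by auto
        moreover have "d y z = \<bar>?e y - ?e z\<bar>" using iso y z by blast
        ultimately show ?thesis using z(2) d_sym[of x y] by linarith
      qed
      then have "\<bar>d x y - \<bar>?e x - ?e y\<bar>\<bar> \<le> 0" by (rule field_le_epsilon)
      then show ?thesis by simp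
    qed
    then show False using max x by blast
  qed
  have comp: "compact (?e ` C)" by (rule compact_image_d[OF assms(1) closed])
  have ea: "?e a = 0" using d_self assms by blast
  have surj: "\<exists>x\<in>C. ?e x = s" if s: "0 \<le> s" "s \<le> ?L" for s
  proof (rule ccontr)
    assume no: "\<not> (\<exists>x\<in>C. ?e x = s)"
    have c1: "compact (?e ` C \<inter> {..s})" and c2: "compact (?e ` C \<inter> {s..})"
      using comp by (auto intro: compact_Int_closed)
    have n1: "?e ` C \<inter> {..s} \<noteq> {}" using abc(1) ea s by force
    have n2: "?e ` C \<inter> {s..} \<noteq> {}" using abc(2) s by force
    obtain s1 where s1: "s1 \<in> ?e ` C \<inter> {..s}" "\<And>r. r \<in> ?e ` C \<inter> {..s} \<Longrightarrow> r \<le> s1"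
      using compact_attains_sup[OF c1 n1] by blast
    obtain s2 where s2: "s2 \<in> ?e ` C \<inter> {s..}" "\<And>r. r \<in> ?e ` C \<inter> {s..} \<Longrightarrow> s2 \<le> r"
      using compact_attains_inf[OF c2 n2] by blast
    obtain x1 x2 where x: "x1 \<in> C" "s1 = ?e x1" "x2 \<in> C" "s2 = ?e x2" using s1(1) s2(1) by auto
    have xY: "x1 \<in> Y" "x2 \<in> Y" using x CY by auto
    have lt: "s1 < s" "s < s2" using s1(1) s2(1) x no by (auto simp: less_le)
    have d12: "d x1 x2 = s2 - s1" using iso[OF x(1,3)] x lt by simp
    obtain m where m: "m \<in> Y" "d x1 m = (s2 - s1) / 2" "d m x2 = (s2 - s1) / 2"
      by (rule midpoint[OF xY]) (simp add: d12)
    have em: "?e m = (s1 + s2) / 2"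
      using d_triangle[OF assms(1) xY(1) m(1)] d_triangle[OF assms(1) m(1) xY(2)] m x by (simp add: field_simps)
    \<comment> \<open>z lies on one side of the gap, and the detour from m to z through the end of
      the gap on that side has exactly the length that \<open>d_diff\<close> gives as a lower
      bound.\<close>
    have "d m z = \<bar>?e m - ?e z\<bar>" if z: "z \<in> C" for z
    proof -
      have zY: "z \<in> Y" using z CY by blast
      have ge: "\<bar>?e m - ?e z\<bar> \<le> d m z" using d_diff assms(1) m(1) zY by blast
      have "?e z \<le> s1 \<or> s2 \<le> ?e z" using s1(2)[of "?e z"] s2(2)[of "?e z"] z by fastforce
      then show ?thesis
      proof
        assume "?e z \<le> s1"
        moreover have "d m z \<le> d m x1 + d x1 z" using d_triangle m(1) xY(1) zY by blast
        moreover have "d x1 z = \<bar>s1 - ?e z\<bar>" using iso x z by auto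
        ultimately show ?thesis using ge em m(2) d_sym[of m x1] lt by (simp add: field_simps abs_if split: if_splits)
      next
        assume "s2 \<le> ?e z"
        moreover have "d m z \<le> d m x2 + d x2 z" using d_triangle m(1) xY(2) zY by blast
        moreover have "d x2 z = \<bar>s2 - ?e z\<bar>" using iso x z by auto
        ultimately show ?thesis using ge em m(3) lt by (simp add: field_simps abs_if split: if_splits)
      qed
    qed
    then have "m \<in> C" using max m(1) by blast
    then have "?e m \<le> s1 \<or> s2 \<le> ?e m" using s1(2)[of "?e m"] s2(2)[of "?e m"] by fastforce
    then show False using em lt by (simp add: field_simps)
  qed
  have "\<exists>x\<in>C. ?e x = ?L * t" if "t \<in> {0..1}" for t
    by (rule surj) (use that assms(5) mult_left_mono[of t 1 ?L] in auto)
  then obtain \<gamma> where g: "\<And>t. t \<in> {0..1} \<Longrightarrow> \<gamma> t \<in> C" "\<And>t. t \<in> {0..1} \<Longrightarrow> ?e (\<gamma> t) = ?L * t"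
    by metis
  have gd: "d (\<gamma> s) (\<gamma> t) = ?L * \<bar>s - t\<bar>" if "s \<in> {0..1}" "t \<in> {0..1}" for s t
  proof -
    have "d (\<gamma> s) (\<gamma> t) = \<bar>?L * (s - t)\<bar>" using iso[OF g(1)[OF that(1)] g(1)[OF that(2)]] g(2) that by (simp add: right_diff_distrib)
    then show ?thesis using assms(5) by (simp add: abs_mult)
  qed
  have at: "\<gamma> t = x" if "x \<in> C" "t \<in> {0..1}" "?e x = ?L * t" for x t
  proof -
    have "d (\<gamma> t) x = 0" using iso[OF g(1)[OF that(2)] that(1)] g(2)[OF that(2)] that(3) by simp
    then show ?thesis using d_eq_0 g(1)[OF that(2)] that(1) CY by blast
  qed
  show ?thesis
  proof (rule that[of \<gamma>])
    show "\<gamma> t \<in> Y" if "t \<in> {0..1}" for t using g(1)[OF that] CY by blast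
    show "\<gamma> 0 = a" "\<gamma> 1 = b" using at abc ea by auto
    show "\<gamma> (d a c / d a b) = c"
      by (rule at) (use abc assms d_nonneg[of a c] d_nonneg[of c b] in \<open>auto simp: field_simps\<close>)
  qed (fact gd)
qed

text \<open>The geodesic has constant speed, so \<phi> is multiplication by \<open>d a b\<close>.
  The point c sits at the time d a c / d a b, which is strictly between 0 and 1 because c differs
  from both ends.\<close>

lemma shortest_path_through:
  assumes "a \<in> Y" "b \<in> Y" "c \<in> Y" "a \<noteq> c" "c \<noteq> b" "rhoX a b = rhoX a c + rhoX c b"
  obtains \<gamma> where "shortest_path M Y a b \<gamma>" "c \<in> \<gamma> ` {0<..<1}"
proof -
  have L: "d a b = d a c + d c b"
    using assms d_nonneg by (simp add: rhoX_d flip: ennreal_plus)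
  have pos: "d a c > 0" "d c b > 0"
    using d_eq_0 assms d_nonneg by (metis less_eq_real_def)+
  obtain \<gamma> where g: "\<And>t. t \<in> {0..1} \<Longrightarrow> \<gamma> t \<in> Y"
    "\<And>s t. s \<in> {0..1} \<Longrightarrow> t \<in> {0..1} \<Longrightarrow> d (\<gamma> s) (\<gamma> t) = d a b * \<bar>s - t\<bar>"
    "\<gamma> 0 = a" "\<gamma> 1 = b" "\<gamma> (d a c / d a b) = c"
    using geodesic_through[OF assms(1-3) L] L pos by auto
  have "continuous_map (top_of_set {0..1}) (subtopology X Y) \<gamma>"
    unfolding continuous_map_def topspace_Y
  proof (intro conjI allI impI)
    show "\<gamma> \<in> topspace (top_of_set {0..1}) \<rightarrow> Y" using g(1) by auto
    fix W assume W: "openin (subtopology X Y) W"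
    have WY: "W \<subseteq> Y" using openin_subset[OF W] by auto
    have "\<exists>e>0. \<forall>s\<in>{0..1}. dist s t < e \<longrightarrow> \<gamma> s \<in> W" if t: "t \<in> {0..1}" "\<gamma> t \<in> W" for t
    proof -
      obtain r where r: "r > 0" "\<And>y. y \<in> Y \<Longrightarrow> d (\<gamma> t) y < r \<Longrightarrow> y \<in> W"
        using W t(2) unfolding openin_Y_iff[OF WY] by blast
      have "\<gamma> s \<in> W" if s: "s \<in> {0..1}" "dist s t < r / d a b" for s
        by (rule r(2)[OF g(1)[OF s(1)]])
          (use g(2)[OF t(1) s(1)] s(2) L pos in \<open>simp add: dist_real_def abs_minus_commute field_simps\<close>)
      then show ?thesis using r(1) L pos by (intro exI[of _ "r / d a b"]) auto
    qed
    then show "openin (top_of_set {0..1}) {x \<in> topspace (top_of_set {0..1}). \<gamma> x \<in> W}"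
      by (auto simp: openin_euclidean_subtopology_iff)
  qed
  then have "pathin (subtopology X Y) \<gamma>" by (simp add: pathin_def)
  moreover have "a \<noteq> b" using L pos d_self assms by fastforce
  moreover have "\<exists>\<phi> :: real \<Rightarrow> real. \<phi> \<in> {0..1} \<rightarrow> {0..} \<and> strict_mono_on {0..1} \<phi> \<and>
        continuous_on {0..1} \<phi> \<and> \<phi> 0 = 0 \<and>
        (\<forall>s t. 0 \<le> s \<and> s \<le> t \<and> t \<le> 1 \<longrightarrow>
           rho_sub M Y (\<gamma> s) (\<gamma> t) = ennreal (\<phi> t - \<phi> s))"
  proof (intro exI[of _ "\<lambda>t. d a b * t"] conjI allI impI)
    show "(*) (d a b) \<in> {0..1} \<rightarrow> {0..}" using d_nonneg by auto
    show "strict_mono_on {0..1} ((*) (d a b))" using L pos by (auto simp: strict_mono_on_def)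
    show "continuous_on {0..1} ((*) (d a b))" by (intro continuous_intros)
    fix s t :: real assume st: "0 \<le> s \<and> s \<le> t \<and> t \<le> 1"
    then have "d (\<gamma> s) (\<gamma> t) = d a b * t - d a b * s" using g(2)[of s t] by (simp add: right_diff_distrib abs_if)
    then show "rho_sub M Y (\<gamma> s) (\<gamma> t) = ennreal (d a b * t - d a b * s)"
      using st g(1) rho_eq[of "\<gamma> s" "\<gamma> t"] rhoX_d[of "\<gamma> s" "\<gamma> t"] by simp
  qed simp
  ultimately have "shortest_path M Y a b \<gamma>"
    unfolding shortest_path_def using g(3,4) by blast
  moreover have "c \<in> \<gamma> ` {0<..<1}"
    using g(5) L pos by (intro image_eqI[of _ _ "d a c / d a b"]) auto
  ultimately show ?thesis using that by blast
qed

end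

section \<open>Paths crossing in the half plane\<close>

text \<open>f connects two points of the edge on either side of P inside a half disc that h leaves.
  Extending h outside the disc to a point of the edge to the right of f makes the four end points
  alternate along the bottom of a box, so the extended path meets f; the extension itself
  cannot.\<close>

lemma half_plane_crossing:
  fixes P :: "real^2"
  assumes "P $ 2 = 0" "0 < a" "a < r"
    and h: "path h" "pathstart h = P" "\<And>x. x \<in> path_image h \<Longrightarrow> 0 \<le> x $ 2"
    and out: "r < norm (pathfinish h - P)"
    and f: "path f" "path_image f \<subseteq> ball P r" "\<And>x. x \<in> path_image f \<Longrightarrow> 0 \<le> x $ 2"
      "pathstart f $ 1 = P $ 1 - a" "pathstart f $ 2 = 0"
      "pathfinish f $ 1 = P $ 1 + a" "pathfinish f $ 2 = 0"
  obtains z where "z \<in> path_image f" "z \<in> path_image h"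
proof -
  define w where "w = pathfinish h"
  \<comment> \<open>The extension goes from w straight up to A, across to B and down to E. The first
    piece only increases the distance from P, the second is at height at least r, and the third is
    at horizontal distance r from P.\<close>
  define H where "H = w $ 2 + r"
  define A :: "real^2" where "A = vector [w $ 1, H]"
  define B :: "real^2" where "B = vector [P $ 1 + r, H]"
  define E :: "real^2" where "E = vector [P $ 1 + r, 0]"
  have w2: "0 \<le> w $ 2" unfolding w_def by (rule h(3)) (rule pathfinish_in_path_image)
  have r: "r > 0" using assms by simp
  have nr: "r \<le> norm x" if "r \<le> \<bar>x $ i\<bar>" for x :: "real^2" and i
    using component_le_norm_cart[of x i] that by linarith
  let ?g = "h +++ linepath w A +++ linepath A B +++ linepath B E"
  have s1: "0 \<le> x $ 2 \<and> r \<le> norm (x - P)" if x: "x \<in> closed_segment w A" for x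
  proof -
    obtain u where u: "0 \<le> u" "u \<le> 1" "x = (1 - u) *\<^sub>R w + u *\<^sub>R A"
      using x by (auto simp: in_segment)
    have 1: "x $ 1 = w $ 1" unfolding u(3) by (simp add: A_def algebra_simps)
    have 2: "x $ 2 = w $ 2 + u * r" unfolding u(3) by (simp add: A_def H_def algebra_simps)
    have "w $ 2 \<le> x $ 2" using 2 u r by simp
    then have "(w $ 2)\<^sup>2 \<le> (x $ 2)\<^sup>2" using w2 by (intro power_mono)
    then have "norm (w - P) \<le> norm (x - P)"
      unfolding norm_eq_sqrt_inner inner_vec_def sum_2
      using 1 assms(1) by (simp add: power2_eq_square)
    then show ?thesis using out \<open>w $ 2 \<le> x $ 2\<close> w2 by (simp add: w_def)
  qed
  have s2: "0 \<le> x $ 2 \<and> r \<le> norm (x - P)" if x: "x \<in> closed_segment A B" for x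
  proof -
    obtain u where u: "0 \<le> u" "u \<le> 1" "x = (1 - u) *\<^sub>R A + u *\<^sub>R B"
      using x by (auto simp: in_segment)
    have "x $ 2 = w $ 2 + r" unfolding u(3) by (simp add: A_def B_def H_def algebra_simps)
    then show ?thesis using nr[of "x - P" 2] assms(1) w2 r by simp
  qed
  have s3: "0 \<le> x $ 2 \<and> r \<le> norm (x - P)" if x: "x \<in> closed_segment B E" for x
  proof -
    obtain u where u: "0 \<le> u" "u \<le> 1" "x = (1 - u) *\<^sub>R B + u *\<^sub>R E"
      using x by (auto simp: in_segment)
    have 1: "x $ 1 = P $ 1 + r" unfolding u(3) by (simp add: E_def B_def algebra_simps)
    have "x $ 2 = (1 - u) * H" unfolding u(3) by (simp add: E_def B_def algebra_simps)
    then have "0 \<le> x $ 2" using u w2 r by (simp add: H_def)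
    then show ?thesis using nr[of "x - P" 1] 1 r by simp
  qed
  have g: "path ?g" using h(1) by (auto simp: w_def)
  have gim: "path_image ?g = path_image h \<union> (closed_segment w A \<union> (closed_segment A B \<union> closed_segment B E))"
    by (simp add: path_image_join w_def)
  have "bounded (path_image f \<union> path_image ?g)"
    using f(1) g by (intro bounded_Un[THEN iffD2] conjI bounded_path_image)
  then obtain c where c: "path_image f \<union> path_image ?g \<subseteq> cbox (- c) c"
    using bounded_subset_cbox_symmetric by blast
  define lo :: "real^2" where "lo = vector [- c $ 1, 0]"
  have box: "x \<in> cbox lo c" if "x \<in> path_image f \<union> path_image ?g" for x
  proof -
    have "x \<in> cbox (- c) c" using c that by blast
    moreover have "0 \<le> x $ 2" using that f(3) h(3) s1 s2 s3 unfolding gim by blast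
    ultimately show ?thesis by (auto simp: mem_box_cart forall_2 lo_def)
  qed
  obtain z where z: "z \<in> path_image f" "z \<in> path_image ?g"
  proof (rule fashoda_interlace[OF f(1) g, of lo c])
    show "path_image f \<subseteq> cbox lo c" "path_image ?g \<subseteq> cbox lo c" using box by blast+
  qed (use f h assms in \<open>auto simp: lo_def E_def\<close>)
  have "norm (z - P) < r" using z(1) f(2) by (auto simp: dist_norm norm_minus_commute)
  then have "z \<in> path_image h" using z(2) s1 s2 s3 unfolding gim by fastforce
  then show ?thesis using that z(1) by blast
qed

section \<open>Gluing estimates for \<open>rho_sub\<close> at interior points\<close>

context riemannian_surface
begin

text \<open>The liminf bounded from below, in additive form. A value of at most \<eta> is treated
  separately, since the bound R - \<eta> has to be nonnegative for its conversion to
  \<open>ennreal\<close>.\<close>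

lemma rho_sub_le_near:
  assumes "x \<in> topspace X" "y \<in> topspace X" "rho_sub M Y x y < \<infinity>" "\<eta> > 0"
  obtains N N' where "openin X N" "openin X N'" "x \<in> N" "y \<in> N'"
    "\<And>x' y'. x' \<in> N \<inter> Int_of M Y \<Longrightarrow> y' \<in> N' \<inter> Int_of M Y \<Longrightarrow>
       rho_sub M Y x y \<le> inf_len M (Int_of M Y) x' y' + ennreal \<eta>"
proof (cases "rho_sub M Y x y \<le> ennreal \<eta>")
  case True
  then show ?thesis
    using that[of "topspace X" "topspace X"] assms
    by (metis add_increasing openin_topspace zero_le)
next
  case False
  define R where "R = enn2real (rho_sub M Y x y)"
  have R: "rho_sub M Y x y = ennreal R" "R \<ge> 0"
    using assms(3) by (auto simp: R_def less_top)
  have \<eta>R: "\<eta> < R" using False assms(4) by (auto simp: R not_le ennreal_less_iff)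
  have lt: "ennreal (R - \<eta>) < rho_sub M Y x y"
    using \<eta>R assms(4) by (simp add: R ennreal_less_iff)
  have sum: "rho_sub M Y x y = ennreal (R - \<eta>) + ennreal \<eta>"
    using \<eta>R assms(4) by (simp add: R flip: ennreal_plus)
  obtain N N' where N: "openin X N" "openin X N'" "x \<in> N" "y \<in> N'"
    "\<And>x' y'. x' \<in> N \<inter> Int_of M Y \<Longrightarrow> y' \<in> N' \<inter> Int_of M Y \<Longrightarrow>
       ennreal (R - \<eta>) < inf_len M (Int_of M Y) x' y'"
    by (rule less_rho_subE[OF assms(1,2) lt]) blast
  show ?thesis
    by (rule that[OF N(1-4)]) (unfold sum, intro add_right_mono less_imp_le N(5))
qed

text \<open>A path that realises \<open>rho_sub M Y w p\<close> starts only near w. As w is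
  interior, \<open>inf_len_small\<close> supplies a short interior link to its start, and this is
  why w is not allowed on the boundary. One \<eta> pays for the link, one for the near-optimal path,
  and one is the slack in the assumption on R.\<close>

lemma rho_sub_interior_triangle:
  assumes "Y \<subseteq> topspace X" "w \<in> Int_of M Y" "openin X N" "p \<in> N" "\<eta> > 0"
    "rho_sub M Y w p < \<infinity>"
    and R: "\<And>z. z \<in> N \<inter> Int_of M Y \<Longrightarrow> R \<le> inf_len M (Int_of M Y) x z + ennreal \<eta>"
  shows "R \<le> inf_len M (Int_of M Y) x w + rho_sub M Y w p + (ennreal \<eta> + ennreal \<eta> + ennreal \<eta>)"
proof -
  let ?I = "Int_of M Y"
  have AC: "a + (e + (b + e)) + e = a + b + (e + e + e)" for a b e :: ennreal
    by (simp only: ac_simps)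
  obtain W where W: "openin X W" "w \<in> W" "\<And>y. y \<in> W \<Longrightarrow> inf_len M ?I w y < ennreal \<eta>"
    by (rule inf_len_small[OF Int_openin[OF assms(1)] assms(2,5)]) blast
  have lt: "rho_sub M Y w p < rho_sub M Y w p + ennreal \<eta>"
    using assms(5,6) by (intro ennreal_less_add) auto
  obtain y z where yz: "y \<in> W \<inter> ?I" "z \<in> N \<inter> ?I" "inf_len M ?I y z < rho_sub M Y w p + ennreal \<eta>"
    by (rule rho_sub_lessE[OF lt W(1,2) assms(3,4)])
  have "R \<le> inf_len M ?I x z + ennreal \<eta>" by (rule R[OF yz(2)])
  also have "inf_len M ?I x z \<le> inf_len M ?I x w + (inf_len M ?I w y + inf_len M ?I y z)"
    using inf_len_triangle[of ?I x z w] add_left_mono[OF inf_len_triangle[of ?I w z y], of "inf_len M ?I x w"]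
    by (rule order_trans)
  also have "\<dots> \<le> inf_len M ?I x w + (ennreal \<eta> + (rho_sub M Y w p + ennreal \<eta>))"
    using W(3)[of y] yz by (intro add_left_mono add_mono less_imp_le) auto
  finally show ?thesis unfolding AC by (simp add: add_right_mono)
qed

section \<open>Shortest paths touching the boundary\<close>

text \<open>A path in the interior that joins points near \<open>q\<close> and \<open>q'\<close>, on either side of \<open>p\<close>, must cross
  both halves of \<open>\<gamma>\<close>. The part of it between the two crossings is at least as long as the
  corresponding part of \<open>\<gamma>\<close>, which passes through \<open>p\<close>; the order of the two crossings is irrelevant.\<close>

lemma boundary_detour:
  fixes t0 t1 t2 :: real and \<gamma> :: "real \<Rightarrow> 'a"
  assumes Y: "Y \<subseteq> topspace X" "surface_with_boundary (subtopology X Y)"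
    and fin: "\<And>x y. x \<in> Y \<Longrightarrow> y \<in> Y \<Longrightarrow> rho_sub M Y x y < \<infinity>"
    and \<gamma>: "continuous_map (top_of_set {0..1}) (subtopology X Y) \<gamma>"
    and t: "0 \<le> t1" "t1 < t0" "t0 < t2" "t2 \<le> 1"
    and p: "\<gamma> t0 = p" "p \<in> Bd_of M Y"
    and int: "\<And>s. s \<in> {t1..t2} \<Longrightarrow> s \<noteq> t0 \<Longrightarrow> \<gamma> s \<in> Int_of M Y"
    and split: "\<And>s t. s \<in> {t1..t0} \<Longrightarrow> t \<in> {t0..t2} \<Longrightarrow>
      rho_sub M Y (\<gamma> s) (\<gamma> t) = rho_sub M Y (\<gamma> s) p + rho_sub M Y p (\<gamma> t)"
    and cont: "\<And>\<epsilon>. \<epsilon> > 0 \<Longrightarrow> \<exists>N. openin X N \<and> p \<in> N \<and>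
      (\<forall>q\<in>N \<inter> Bd_of M Y. \<forall>q'\<in>N \<inter> Bd_of M Y. rho_sub M Y q q' < ennreal \<epsilon>)"
  obtains q q' where "q \<in> Bd_of M Y" "q' \<in> Bd_of M Y" "q \<noteq> p" "q' \<noteq> p"
    "rho_sub M Y q p + rho_sub M Y p q' \<le> rho_sub M Y q q'"
proof -
  let ?I = "Int_of M Y" and ?rho = "rho_sub M Y"
  have IY: "?I \<subseteq> Y" and oI: "openin X ?I" using Int_subset Int_openin Y(1) by blast+
  have pY: "p \<in> Y" "p \<notin> ?I" using p(2) Bd_eq[OF Y(1)] by auto
  then have pX: "p \<in> topspace X" using Y(1) by auto
  obtain Q V \<psi> g where Q: "openin (subtopology X Y) Q" "p \<in> Q" "openin (top_of_set half_plane) V"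
    and hom: "homeomorphic_maps (subtopology X Q) (top_of_set V) \<psi> g"
    and pos: "\<And>q. q \<in> Q \<Longrightarrow> q \<in> ?I \<longleftrightarrow> 0 < \<psi> q $ 2"
    by (rule boundary_chart[OF Y pY(1)]) blast
  have QY: "Q \<subseteq> Y" "Q \<subseteq> topspace X" using openin_subset[OF Q(1)] by auto
  have VH: "V \<subseteq> half_plane" using openin_imp_subset[OF Q(3)] .
  have c\<psi>: "continuous_map (subtopology X Q) (top_of_set V) \<psi>"
    and cg: "continuous_map (top_of_set V) (subtopology X Q) g"
    and g\<psi>: "\<And>q. q \<in> Q \<Longrightarrow> g (\<psi> q) = q" and \<psi>g: "\<And>x. x \<in> V \<Longrightarrow> \<psi> (g x) = x"
    and \<psi>V: "\<And>q. q \<in> Q \<Longrightarrow> \<psi> q \<in> V" and gQ: "\<And>x. x \<in> V \<Longrightarrow> g x \<in> Q"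
    using hom QY by (auto simp: homeomorphic_maps_def continuous_map_def)
  have nn: "0 \<le> \<psi> q $ 2" if "q \<in> Q" for q
    using \<psi>V[OF that] VH by (auto simp: half_plane_def)
  define P where "P = \<psi> p"
  have P2: "P $ 2 = 0" using nn[OF Q(2)] pos[OF Q(2)] pY(2) by (auto simp: P_def)
  have chart_open: "\<exists>N. openin X N \<and> N \<inter> Y = {q \<in> Q. \<psi> q \<in> B}" if B: "open B" for B
  proof -
    have "openin (subtopology X Q) {q \<in> topspace (subtopology X Q). \<psi> q \<in> B}"
      by (rule openin_continuous_map_preimage[OF continuous_map_into_fulltopology[OF c\<psi>]])
        (simp add: B)
    moreover have "{q \<in> topspace (subtopology X Q). \<psi> q \<in> B} = {q \<in> Q. \<psi> q \<in> B}" using QY by auto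
    moreover have "subtopology X Q = subtopology (subtopology X Y) Q"
      using QY by (simp add: subtopology_subtopology Int_absorb1)
    ultimately have "openin (subtopology X Y) {q \<in> Q. \<psi> q \<in> B}"
      using openin_trans_full[OF _ Q(1)] by simp
    then show ?thesis by (auto simp: openin_subtopology)
  qed
  have "openin (top_of_set {0..1}) {s \<in> topspace (top_of_set {0..1}). \<gamma> s \<in> Q}"
    by (rule openin_continuous_map_preimage[OF \<gamma> Q(1)])
  then have "openin (top_of_set {0..1}) {s \<in> {0..1}. \<gamma> s \<in> Q}" by simp
  moreover have "0 \<le> t0" "t0 \<le> 1" using t by linarith+
  then have "t0 \<in> {s \<in> {0..1}. \<gamma> s \<in> Q}" using p Q(2) by auto
  ultimately obtain e where e: "e > 0" "\<And>s. s \<in> {0..1} \<Longrightarrow> dist s t0 < e \<Longrightarrow> \<gamma> s \<in> Q"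
    unfolding openin_euclidean_subtopology_iff by blast
  define s1 where "s1 = max t1 (t0 - e / 2)"
  define s2 where "s2 = min t2 (t0 + e / 2)"
  have s12: "t1 \<le> s1" "s1 < t0" "t0 < s2" "s2 \<le> t2" using t e(1) by (auto simp: s1_def s2_def)
  have \<gamma>Q: "\<gamma> s \<in> Q" if "s \<in> {s1..s2}" for s
    by (rule e(2)) (use that t e(1) in \<open>auto simp: s1_def s2_def dist_real_def abs_less_iff\<close>)
  have \<gamma>I: "\<gamma> s \<in> ?I" if "s \<in> {s1..s2}" "s \<noteq> t0" for s
    using int[of s] that s12 by auto
  define k where "k = \<psi> \<circ> \<gamma>"
  have contk: "continuous_on {s1..s2} k"
  proof -
    have sub: "{s1..s2} \<subseteq> {0..1}" using s12 t by auto
    have "continuous_map (top_of_set {s1..s2}) X \<gamma>"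
      using \<gamma> sub by (metis continuous_map_from_subtopology_mono continuous_map_into_fulltopology)
    then have "continuous_map (top_of_set {s1..s2}) (subtopology X Q) \<gamma>"
      using \<gamma>Q by (auto simp: continuous_map_in_subtopology)
    then have "continuous_map (top_of_set {s1..s2}) (top_of_set V) k"
      unfolding k_def using c\<psi> by (rule continuous_map_compose)
    then show ?thesis using continuous_map_into_fulltopology by fastforce
  qed
  have kP: "k t0 = P" by (simp add: k_def p P_def)
  have kpos: "0 < k s $ 2" if "s \<in> {s1..s2}" "s \<noteq> t0" for s
    using \<gamma>I[OF that] pos[OF \<gamma>Q[OF that(1)]] by (simp add: k_def)
  have knn: "0 \<le> k s $ 2" if "s \<in> {s1..s2}" for s
    using nn[OF \<gamma>Q[OF that]] by (simp add: k_def)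
  have "k s1 \<noteq> P" "k s2 \<noteq> P" using kpos[of s1] kpos[of s2] s12 P2 by auto
  then have kn: "norm (k s1 - P) > 0" "norm (k s2 - P) > 0" by auto
  obtain R where R: "R > 0" "half_plane \<inter> ball P R \<subseteq> V"
  proof -
    have "\<exists>R>0. ball P R \<inter> half_plane \<subseteq> V"
      using Q(3) \<psi>V[OF Q(2)] unfolding openin_contains_ball P_def by blast
    then show ?thesis using that by (auto simp: Int_commute)
  qed
  \<comment> \<open>The half disc of radius r lies in the chart image V, and both halves of the
    image curve k end outside it, as \<open>half_plane_crossing\<close> requires of h.\<close>
  define r where "r = min R (min (norm (k s1 - P)) (norm (k s2 - P))) / 2"
  have r: "r > 0" "r < R" "r < norm (k s1 - P)" "r < norm (k s2 - P)"
    using R(1) kn unfolding r_def by linarith+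
  obtain N where N: "openin X N" "N \<inter> Y = {q \<in> Q. \<psi> q \<in> ball P r}"
    using chart_open[of "ball P r"] by auto
  have "p \<in> {q \<in> Q. \<psi> q \<in> ball P r}" using Q(2) r(1) by (simp add: P_def)
  then have pN: "p \<in> N" using N(2) by blast
  \<comment> \<open>N corresponds to that half disc. A path of length below \<epsilon>/2 that starts
    within \<epsilon>/2 of p stays in N by the triangle inequality for \<open>rhoX\<close>.\<close>
  obtain \<epsilon> where \<epsilon>: "\<epsilon> > 0" "\<And>y. rhoX p y < ennreal \<epsilon> \<Longrightarrow> y \<in> N"
    by (rule rhoX_escape[OF N(1) pN]) blast
  then have \<epsilon>2: "\<epsilon> / 2 > 0" by simp
  obtain N1 where N1: "openin X N1" "p \<in> N1"
    "\<And>q q'. q \<in> N1 \<Longrightarrow> q \<in> Bd_of M Y \<Longrightarrow> q' \<in> N1 \<Longrightarrow> q' \<in> Bd_of M Y \<Longrightarrow> ?rho q q' < ennreal (\<epsilon> / 2)"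
    using cont[OF \<epsilon>2] by blast
  obtain N2 where N2: "openin X N2" "p \<in> N2" "\<And>y. y \<in> N2 \<Longrightarrow> rhoX p y < ennreal (\<epsilon> / 2)"
    by (rule rhoX_small[OF pX \<epsilon>2]) blast
  have "openin (top_of_set V) {x \<in> topspace (top_of_set V). g x \<in> N1 \<inter> N2}"
    by (rule openin_continuous_map_preimage[OF continuous_map_into_fulltopology[OF cg]])
      (rule openin_Int[OF N1(1) N2(1)])
  then have "openin (top_of_set V) {x \<in> V. g x \<in> N1 \<inter> N2}" by simp
  moreover have "P \<in> {x \<in> V. g x \<in> N1 \<inter> N2}"
    using N1(2) N2(2) \<psi>V[OF Q(2)] g\<psi>[OF Q(2)] by (simp add: P_def)
  ultimately obtain b where b: "b > 0" "\<And>x. x \<in> V \<Longrightarrow> dist x P < b \<Longrightarrow> g x \<in> N1 \<inter> N2"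
    unfolding openin_euclidean_subtopology_iff by blast
  \<comment> \<open>Below r, so that the boundary points at distance a lie in the half disc, and
    below b, so that they lie in N1 and N2; positive, so that they differ from p.\<close>
  define a where "a = min r b / 2"
  have a: "0 < a" "a < r" "a < b" using r b by (auto simp: a_def)
  have side: "g x \<in> Q \<and> \<psi> (g x) = x \<and> g x \<in> N1 \<and> g x \<in> N2 \<and> g x \<in> Bd_of M Y \<and> g x \<noteq> p \<and> x \<notin> k ` {s1..s2}"
    if x: "x $ 2 = 0" "norm (x - P) = a" for x
  proof -
    have "x \<in> half_plane \<inter> ball P R"
      using x a r by (auto simp: half_plane_def dist_norm norm_minus_commute)
    then have xV: "x \<in> V" using R(2) by blast
    then have gx: "g x \<in> Q" "\<psi> (g x) = x" using gQ \<psi>g by auto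
    moreover have "g x \<in> N1 \<inter> N2" using b(2)[OF xV] x a by (simp add: dist_norm)
    moreover have "g x \<in> Bd_of M Y"
      unfolding Bd_eq[OF Y(1)] using gx pos[OF gx(1)] x QY by auto
    moreover have "x \<noteq> P" using x a by auto
    then have "g x \<noteq> p" using gx by (auto simp: P_def)
    moreover have "x \<noteq> k s" if "s \<in> {s1..s2}" for s
      using kpos[OF that] kP x(1) \<open>x \<noteq> P\<close> by (cases "s = t0") auto
    ultimately show ?thesis by blast
  qed
  define xL where "xL = P - a *\<^sub>R axis 1 1"
  define xR where "xR = P + a *\<^sub>R axis 1 1"
  have xL: "xL $ 1 = P $ 1 - a" "xL $ 2 = 0" "norm (xL - P) = a"
    and xR: "xR $ 1 = P $ 1 + a" "xR $ 2 = 0" "norm (xR - P) = a"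
    using P2 a by (simp_all add: xL_def xR_def norm_axis_1) (simp_all add: axis_def)
  define q where "q = g xL"
  define q' where "q' = g xR"
  note L = side[OF xL(2,3), folded q_def] and R' = side[OF xR(2,3), folded q'_def]
  have comp: "compact (k ` {s1..s2})" using contk by (intro compact_continuous_image) auto
  \<comment> \<open>A path that approximates \<open>rho_sub M Y q q'\<close> begins and ends only
    near q and q'. In the chart its ends are joined to xL and xR by segments inside small balls that
    avoid k, so that no crossing happens on the added segments.\<close>
  have "\<exists>\<delta>>0. ball x \<delta> \<inter> k ` {s1..s2} = {} \<and> ball x \<delta> \<subseteq> ball P r"
    if x: "x \<notin> k ` {s1..s2}" "norm (x - P) = a" for x
  proof -
    have "open (ball P r - k ` {s1..s2})"
      by (rule open_Diff[OF open_ball compact_imp_closed[OF comp]])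
    moreover have "x \<in> ball P r - k ` {s1..s2}" using x a by (simp add: dist_norm norm_minus_commute)
    ultimately obtain \<delta> where "\<delta> > 0" "ball x \<delta> \<subseteq> ball P r - k ` {s1..s2}"
      using open_contains_ball by blast
    then show ?thesis by (intro exI[of _ \<delta>]) blast
  qed
  note away = this
  obtain \<delta>L where \<delta>L: "\<delta>L > 0" "ball xL \<delta>L \<inter> k ` {s1..s2} = {}" "ball xL \<delta>L \<subseteq> ball P r"
    using away[of xL] L xL(3) by blast
  obtain \<delta>R where \<delta>R: "\<delta>R > 0" "ball xR \<delta>R \<inter> k ` {s1..s2} = {}" "ball xR \<delta>R \<subseteq> ball P r"
    using away[of xR] R' xR(3) by blast
  obtain NL where NL: "openin X NL" "NL \<inter> Y = {q \<in> Q. \<psi> q \<in> ball xL \<delta>L}"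
    using chart_open[of "ball xL \<delta>L"] by auto
  obtain NR where NR: "openin X NR" "NR \<inter> Y = {q \<in> Q. \<psi> q \<in> ball xR \<delta>R}"
    using chart_open[of "ball xR \<delta>R"] by auto
  have qY: "q \<in> Y" "q' \<in> Y" "q \<in> topspace X" "q' \<in> topspace X" using L R' QY by auto
  have qN: "q \<in> NL" "q' \<in> NR" using L R' NL(2) NR(2) \<delta>L \<delta>R QY by auto
  \<comment> \<open>\<tau> selects the half of \<gamma> before or after t0. The crossing is not at
    t0, because \<sigma> stays in the interior while p is on the boundary.\<close>
  have cross: "\<exists>s\<in>{s1..s2}. \<exists>u\<in>{0..1}. s \<in> closed_segment t0 \<tau> \<and> s \<noteq> t0 \<and> \<sigma> u = \<gamma> s"
    if \<tau>: "\<tau> = s1 \<or> \<tau> = s2"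
      and \<sigma>: "continuous_map (top_of_set {0..1}) X \<sigma>" "\<And>u. u \<in> {0..1} \<Longrightarrow> \<sigma> u \<in> ?I"
        "\<And>u. u \<in> {0..1} \<Longrightarrow> \<sigma> u \<in> N" "\<sigma> 0 \<in> NL" "\<sigma> 1 \<in> NR"
    for \<tau> and \<sigma> :: "real \<Rightarrow> 'a"
  proof -
    have \<sigma>Q: "\<sigma> u \<in> Q" "\<psi> (\<sigma> u) \<in> ball P r" "0 < \<psi> (\<sigma> u) $ 2" if "u \<in> {0..1}" for u
      using \<sigma>(2,3)[OF that] IY N(2) pos by blast+
    have s0: "\<psi> (\<sigma> 0) \<in> ball xL \<delta>L" and s1': "\<psi> (\<sigma> 1) \<in> ball xR \<delta>R"
      using \<sigma>(2)[of 0] \<sigma>(2)[of 1] \<sigma>(4,5) NL(2) NR(2) IY by auto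
    have "continuous_map (top_of_set {0..1}) (subtopology X Q) \<sigma>"
      using \<sigma>(1) \<sigma>Q(1) by (auto simp: continuous_map_in_subtopology)
    then have "continuous_map (top_of_set {0..1}) (top_of_set V) (\<psi> \<circ> \<sigma>)"
      using c\<psi> by (rule continuous_map_compose)
    then have p\<sigma>: "path (\<psi> \<circ> \<sigma>)"
      unfolding path_def using continuous_map_into_fulltopology by fastforce
    let ?f = "linepath xL (\<psi> (\<sigma> 0)) +++ (\<psi> \<circ> \<sigma>) +++ linepath (\<psi> (\<sigma> 1)) xR"
    let ?h = "k \<circ> linepath t0 \<tau>"
    have \<tau>sub: "closed_segment t0 \<tau> \<subseteq> {s1..s2}"
      using \<tau> s12 by (auto simp: closed_segment_eq_real_ivl split: if_splits)
    have e01: "pathstart (\<psi> \<circ> \<sigma>) = \<psi> (\<sigma> 0)" "pathfinish (\<psi> \<circ> \<sigma>) = \<psi> (\<sigma> 1)"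
      by (simp_all add: pathstart_def pathfinish_def)
    have fim: "path_image ?f = closed_segment xL (\<psi> (\<sigma> 0)) \<union> ((\<psi> \<circ> \<sigma>) ` {0..1} \<union> closed_segment (\<psi> (\<sigma> 1)) xR)"
      using e01 by (simp add: path_image_join path_image_def[of "\<psi> \<circ> \<sigma>"])
    have him: "path_image ?h = k ` closed_segment t0 \<tau>"
      by (simp add: path_image_compose)
    have segL: "closed_segment xL (\<psi> (\<sigma> 0)) \<subseteq> ball xL \<delta>L"
      by (rule closed_segment_subset) (use s0 \<delta>L in auto)
    have segR: "closed_segment (\<psi> (\<sigma> 1)) xR \<subseteq> ball xR \<delta>R"
      by (rule closed_segment_subset) (use s1' \<delta>R in auto)
    have conv: "convex {x :: real^2. 0 \<le> x $ 2}"
      using convex_halfspace_ge[of 0 "axis 2 1 :: real^2"] by (simp add: inner_axis')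
    have nnLR: "closed_segment xL (\<psi> (\<sigma> 0)) \<subseteq> {x. 0 \<le> x $ 2}" "closed_segment (\<psi> (\<sigma> 1)) xR \<subseteq> {x. 0 \<le> x $ 2}"
      by (intro closed_segment_subset conv; use xL xR \<sigma>Q(3)[of 0] \<sigma>Q(3)[of 1] in simp)+
    have mid: "(\<psi> \<circ> \<sigma>) ` {0..1} \<subseteq> {x. 0 \<le> x $ 2}" "(\<psi> \<circ> \<sigma>) ` {0..1} \<subseteq> ball P r"
      by (intro image_subsetI; simp only: o_apply mem_Collect_eq less_imp_le[OF \<sigma>Q(3)] \<sigma>Q(2))+
    have fnn: "0 \<le> x $ 2" if "x \<in> path_image ?f" for x
      using that nnLR mid(1) unfolding fim by blast
    have fr: "path_image ?f \<subseteq> ball P r"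
      unfolding fim using segL segR \<delta>L(3) \<delta>R(3) mid(2) by blast
    have ph: "path ?h"
      by (rule path_continuous_image[OF path_linepath])
        (simp add: continuous_on_subset[OF contk \<tau>sub])
    have hnn: "0 \<le> x $ 2" if "x \<in> path_image ?h" for x
      using that \<tau>sub knn unfolding him by blast
    have h0: "pathstart ?h = P" using kP by (simp add: pathstart_compose)
    have out: "r < norm (pathfinish ?h - P)"
      using \<tau> r(3,4) by (auto simp: pathfinish_compose)
    have pf: "path ?f" using p\<sigma> e01 by (simp add: path_join_imp)
    have "pathstart ?f = xL" "pathfinish ?f = xR" by simp_all
    then have ends: "pathstart ?f $ 1 = P $ 1 - a" "pathstart ?f $ 2 = 0"
      "pathfinish ?f $ 1 = P $ 1 + a" "pathfinish ?f $ 2 = 0"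
      by (simp_all only: xL(1,2) xR(1,2))
    obtain z where z: "z \<in> path_image ?f" "z \<in> path_image ?h"
      by (rule half_plane_crossing[OF P2 a(1,2) ph h0 hnn out pf fr fnn ends])
    obtain s where s: "s \<in> closed_segment t0 \<tau>" "z = k s" using z(2) unfolding him by blast
    have s': "s \<in> {s1..s2}" using s(1) \<tau>sub by blast
    have "z \<notin> ball xL \<delta>L" "z \<notin> ball xR \<delta>R" using \<delta>L(2) \<delta>R(2) s(2) s' by auto
    then have "z \<in> (\<psi> \<circ> \<sigma>) ` {0..1}" using z(1) segL segR unfolding fim by blast
    then obtain u where u: "u \<in> {0..1}" "\<psi> (\<sigma> u) = k s" using s(2) by auto
    have "\<sigma> u = g (\<psi> (\<sigma> u))" by (rule g\<psi>[OF \<sigma>Q(1)[OF u(1)], symmetric])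
    also have "\<dots> = g (\<psi> (\<gamma> s))" unfolding u(2) by (simp only: k_def o_apply)
    also have "\<dots> = \<gamma> s" by (rule g\<psi>[OF \<gamma>Q[OF s']])
    finally have eq: "\<sigma> u = \<gamma> s" .
    have "0 < k s $ 2" using \<sigma>Q(3)[OF u(1)] unfolding u(2) .
    then have "s \<noteq> t0" using kP P2 by auto
    then show ?thesis by (intro bexI[OF _ s'] bexI[OF _ u(1)] conjI s(1) eq)
  qed
  have "?rho q p + ?rho p q' \<le> ?rho q q'"
  proof (rule ennreal_le_epsilon)
    fix \<zeta> :: real assume "0 < \<zeta>"
    \<comment> \<open>Seven errors: three from \<open>rho_sub_interior_triangle\<close> at each of
      the two crossings, and one for the choice of \<sigma>.\<close>
    define \<eta> where "\<eta> = \<zeta> / 7"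
    have \<eta>: "\<eta> > 0" using \<open>0 < \<zeta>\<close> by (simp add: \<eta>_def)
    obtain A1 A2 where A: "openin X A1" "openin X A2" "q \<in> A1" "p \<in> A2"
      "\<And>x' y'. x' \<in> A1 \<inter> ?I \<Longrightarrow> y' \<in> A2 \<inter> ?I \<Longrightarrow> ?rho q p \<le> inf_len M ?I x' y' + ennreal \<eta>"
      by (rule rho_sub_le_near[OF qY(3) pX fin[OF qY(1) pY(1)] \<eta>]) blast
    obtain B1 B2 where B: "openin X B1" "openin X B2" "q' \<in> B1" "p \<in> B2"
      "\<And>x' y'. x' \<in> B1 \<inter> ?I \<Longrightarrow> y' \<in> B2 \<inter> ?I \<Longrightarrow> ?rho q' p \<le> inf_len M ?I x' y' + ennreal \<eta>"
      by (rule rho_sub_le_near[OF qY(4) pX fin[OF qY(2) pY(1)] \<eta>]) blast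
    \<comment> \<open>One path has to be both near-optimal between q and q' and short enough to
      remain in N. The bound by \<epsilon>/2 is where continuity of \<open>rho_sub\<close> on the
      boundary enters.\<close>
    have lt: "?rho q q' < min (?rho q q' + ennreal \<eta>) (ennreal (\<epsilon> / 2))"
      using ennreal_less_add[OF _ \<eta>] fin[OF qY(1,2)] N1(3)[of q q'] L R' by simp
    have near: "openin X (NL \<inter> A1 \<inter> N2)" "q \<in> NL \<inter> A1 \<inter> N2"
      "openin X (NR \<inter> B1)" "q' \<in> NR \<inter> B1"
      using qN A(3) B(3) L by (simp_all add: openin_Int NL(1) NR(1) A(1) B(1) N2(1))
    obtain x' y' where x': "x' \<in> (NL \<inter> A1 \<inter> N2) \<inter> ?I" "y' \<in> (NR \<inter> B1) \<inter> ?I"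
      "inf_len M ?I x' y' < min (?rho q q' + ennreal \<eta>) (ennreal (\<epsilon> / 2))"
      by (rule rho_sub_lessE[OF lt near])
    have x'A: "x' \<in> A1 \<inter> ?I" "y' \<in> B1 \<inter> ?I" using x'(1,2) by blast+
    obtain \<sigma> where \<sigma>: "smooth_path M \<sigma>" "\<sigma> ` {0..1} \<subseteq> ?I" "\<sigma> 0 = x'" "\<sigma> 1 = y'"
      "path_len M \<sigma> < min (?rho q q' + ennreal \<eta>) (ennreal (\<epsilon> / 2))"
      by (rule inf_len_lessE[OF x'(3)])
    have \<sigma>I: "\<sigma> u \<in> ?I" if "u \<in> {0..1}" for u using \<sigma>(2) that by blast
    have \<sigma>c: "continuous_map (top_of_set {0..1}) X \<sigma>"
      using \<sigma>(1) unfolding smooth_path_def pathin_def by blast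
    have \<sigma>N: "\<sigma> u \<in> N" if u: "u \<in> {0..1}" for u
    proof (rule \<epsilon>(2))
      have "rhoX x' (\<sigma> u) \<le> inf_len M ?I (\<sigma> 0) (\<sigma> u)"
        unfolding \<sigma>(3) by (rule rhoX_le_inf_len) (use IY Y in blast)
      also have "\<dots> \<le> inf_len M ?I (\<sigma> 0) (\<sigma> u) + inf_len M ?I (\<sigma> u) (\<sigma> u) + inf_len M ?I (\<sigma> u) (\<sigma> 1)"
        by (simp add: add.assoc)
      also have "\<dots> \<le> path_len M \<sigma>"
        by (rule inf_len_subdivide[OF oI \<sigma>(1,2)]) (use u in auto)
      also have "\<dots> < ennreal (\<epsilon> / 2)" using \<sigma>(5) by simp
      finally have 1: "rhoX x' (\<sigma> u) < ennreal (\<epsilon> / 2)" .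
      have 2: "rhoX p x' < ennreal (\<epsilon> / 2)" by (rule N2(3)) (use x'(1) in blast)
      have "rhoX p (\<sigma> u) \<le> rhoX p x' + rhoX x' (\<sigma> u)" by (rule rhoX_triangle)
      also have "\<dots> < ennreal (\<epsilon> / 2) + ennreal (\<epsilon> / 2)" using 2 1 by (rule add_strict_mono)
      also have "\<dots> = ennreal \<epsilon>" using \<epsilon>(1) by (simp flip: ennreal_plus)
      finally show "rhoX p (\<sigma> u) < ennreal \<epsilon>" .
    qed
    have \<sigma>ends: "\<sigma> 0 \<in> NL" "\<sigma> 1 \<in> NR" using x' \<sigma>(3,4) by auto
    obtain s u where s: "s \<in> {s1..s2}" "u \<in> {0..1}" "s \<in> closed_segment t0 s1" "s \<noteq> t0" "\<sigma> u = \<gamma> s"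
      using cross[of s1 \<sigma>, OF _ \<sigma>c \<sigma>I \<sigma>N \<sigma>ends] by blast
    obtain t v where t': "t \<in> {s1..s2}" "v \<in> {0..1}" "t \<in> closed_segment t0 s2" "t \<noteq> t0" "\<sigma> v = \<gamma> t"
      using cross[of s2 \<sigma>, OF _ \<sigma>c \<sigma>I \<sigma>N \<sigma>ends] by blast
    have sub: "s \<in> {t1..t0}" "t \<in> {t0..t2}"
      using s(3) t'(3) s12 by (auto simp: closed_segment_eq_real_ivl split: if_splits)
    have \<gamma>Y: "\<gamma> s \<in> Y" "\<gamma> t \<in> Y" using \<gamma>Q[OF s(1)] \<gamma>Q[OF t'(1)] QY by auto
    then have \<gamma>X: "\<gamma> s \<in> topspace X" "\<gamma> t \<in> topspace X" using Y(1) by auto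
    have st: "?rho (\<gamma> s) (\<gamma> t) = ?rho (\<gamma> s) p + ?rho (\<gamma> t) p"
      using split[OF sub] rho_sub_sym[OF pX \<gamma>X(2)] by simp
    \<comment> \<open>The outer pieces of \<sigma> link q and q' to the crossings. The middle piece
      is at least as long as the distance of the crossings, which splits at p; regrouping yields the
      distances from q and q' to p.\<close>
    have key: "?rho q p + ?rho q' p \<le> path_len M \<sigma> + ennreal (6 * \<eta>)"
      if uv: "0 \<le> u" "u \<le> v" "v \<le> 1" and add: "?rho (\<sigma> u) (\<sigma> v) = ?rho (\<sigma> u) p + ?rho (\<sigma> v) p" for u v
    proof -
      let ?e = "ennreal \<eta> + ennreal \<eta> + ennreal \<eta>"
      have I: "\<sigma> u \<in> ?I" "\<sigma> v \<in> ?I" using \<sigma>I uv by auto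
      then have uvY: "\<sigma> u \<in> Y" "\<sigma> v \<in> Y" using IY by blast+
      have AC: "(a + b + e) + (c + d + e) = a + (b + d) + c + (e + e)" for a b c d e :: ennreal
        by (simp only: ac_simps)
      have "?rho q p \<le> inf_len M ?I x' (\<sigma> u) + ?rho (\<sigma> u) p + ?e"
        by (rule rho_sub_interior_triangle[OF Y(1) I(1) A(2,4) \<eta> fin[OF uvY(1) pY(1)] A(5)[OF x'A(1)]])
      moreover have "?rho q' p \<le> inf_len M ?I y' (\<sigma> v) + ?rho (\<sigma> v) p + ?e"
        by (rule rho_sub_interior_triangle[OF Y(1) I(2) B(2,4) \<eta> fin[OF uvY(2) pY(1)] B(5)[OF x'A(2)]])
      ultimately have "?rho q p + ?rho q' p \<le>
          (inf_len M ?I x' (\<sigma> u) + ?rho (\<sigma> u) p + ?e) + (inf_len M ?I y' (\<sigma> v) + ?rho (\<sigma> v) p + ?e)"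
        by (rule add_mono)
      also have "\<dots> = inf_len M ?I x' (\<sigma> u) + ?rho (\<sigma> u) (\<sigma> v) + inf_len M ?I y' (\<sigma> v) + (?e + ?e)"
        unfolding AC add ..
      also have "\<dots> \<le> path_len M \<sigma> + (?e + ?e)"
      proof (rule add_right_mono)
        have "inf_len M ?I x' (\<sigma> u) + ?rho (\<sigma> u) (\<sigma> v) + inf_len M ?I y' (\<sigma> v) \<le>
            inf_len M ?I (\<sigma> 0) (\<sigma> u) + inf_len M ?I (\<sigma> u) (\<sigma> v) + inf_len M ?I (\<sigma> v) (\<sigma> 1)"
          unfolding \<sigma>(3,4) inf_len_sym[of ?I y']
          by (intro add_mono order_refl rho_sub_le_inf_len I Y(1))
        also have "\<dots> \<le> path_len M \<sigma>" by (rule inf_len_subdivide[OF oI \<sigma>(1,2) uv])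
        finally show "inf_len M ?I x' (\<sigma> u) + ?rho (\<sigma> u) (\<sigma> v) + inf_len M ?I y' (\<sigma> v) \<le> path_len M \<sigma>" .
      qed
      also have "?e + ?e = ennreal (6 * \<eta>)" using \<eta> by (simp flip: ennreal_plus)
      finally show ?thesis .
    qed
    have "?rho q p + ?rho p q' = ?rho q p + ?rho q' p" by (simp add: rho_sub_sym[OF pX qY(4)])
    also have "\<dots> \<le> path_len M \<sigma> + ennreal (6 * \<eta>)"
    proof (cases "u \<le> v")
      case True
      show ?thesis by (rule key[OF _ True]) (use s t' st in auto)
    next
      case False
      have "?rho (\<gamma> t) (\<gamma> s) = ?rho (\<gamma> t) p + ?rho (\<gamma> s) p"
        using st rho_sub_sym[OF \<gamma>X] by (simp add: add.commute)
      then show ?thesis using False s t' by (intro key[of v u]) auto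
    qed
    also have "\<dots> \<le> (?rho q q' + ennreal \<eta>) + ennreal (6 * \<eta>)"
      using \<sigma>(5) by (intro add_right_mono less_imp_le) simp
    also have "\<dots> = ?rho q q' + (ennreal \<eta> + ennreal (6 * \<eta>))" by (rule add.assoc)
    also have "ennreal \<eta> + ennreal (6 * \<eta>) = ennreal \<zeta>"
      using \<eta> by (simp add: \<eta>_def flip: ennreal_plus)
    finally show "?rho q p + ?rho p q' \<le> ?rho q q' + ennreal \<zeta>" .
  qed
  then show ?thesis using that[of q q'] L R' by blast
qed

end

section \<open>Isometric boundaries\<close>

context intrinsic_domain
begin

lemma compactin_Bd: "compactin X (Bd_of M Y)"
proof -
  have "closedin X (topspace X - Int_of M Y)" using Int_openin[OF Y_subset] by blast
  moreover have "(topspace X - Int_of M Y) \<inter> Y = Bd_of M Y"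
    unfolding Bd_eq[OF Y_subset] using Y_subset by blast
  ultimately show ?thesis using closed_Int_compactin Y_compact by metis
qed

text \<open>The isometry is continuous for the topology of \<open>X\<close>, as \<open>rhoX\<close> is at most \<open>rho_sub M Z\<close>;
  so by compactness it is a homeomorphism, and \<open>rho_sub M Z\<close> is continuous on the boundary of \<open>Z\<close>.\<close>

lemma isometric_boundary_continuous:
  assumes Z: "Z \<subseteq> topspace X" and f: "bij_betw f (Bd_of M Y) (Bd_of M Z)"
    and iso: "\<And>x y. x \<in> Bd_of M Y \<Longrightarrow> y \<in> Bd_of M Y \<Longrightarrow> rho_sub M Z (f x) (f y) = rho_sub M Y x y"
    and p: "p \<in> Bd_of M Z" and \<epsilon>: "\<epsilon> > 0"
  shows "\<exists>N. openin X N \<and> p \<in> N \<and>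
      (\<forall>q\<in>N \<inter> Bd_of M Z. \<forall>q'\<in>N \<inter> Bd_of M Z. rho_sub M Z q q' < ennreal \<epsilon>)"
proof -
  let ?B = "Bd_of M Y" and ?C = "Bd_of M Z"
  have BY: "?B \<subseteq> Y" and CZ: "?C \<subseteq> Z" using Bd_eq Y_subset Z by auto
  have BX: "?B \<subseteq> topspace X" and CX: "?C \<subseteq> topspace X" using BY CZ Y_subset Z by auto
  have fC: "f ` ?B = ?C" and inj: "inj_on f ?B" using f by (auto simp: bij_betw_def)
  have rho: "rho_sub M Z (f x) (f y) = rhoX x y" if xy: "x \<in> ?B" "y \<in> ?B" for x y
  proof -
    have "x \<in> Y" "y \<in> Y" using xy BY by blast+
    then show ?thesis using iso[OF xy] rho_eq by simp
  qed
  have "continuous_map (subtopology X ?B) (subtopology X ?C) f"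
    unfolding continuous_map_def
  proof (intro conjI allI impI)
    show "f \<in> topspace (subtopology X ?B) \<rightarrow> topspace (subtopology X ?C)" using fC CX by auto
    fix W assume "openin (subtopology X ?C) W"
    then obtain N where N: "openin X N" "W = N \<inter> ?C" by (auto simp: openin_subtopology)
    show "openin (subtopology X ?B) {x \<in> topspace (subtopology X ?B). f x \<in> W}"
    proof (subst openin_subopen, intro ballI)
      fix x assume "x \<in> {x \<in> topspace (subtopology X ?B). f x \<in> W}"
      then have x: "x \<in> ?B" "x \<in> topspace X" "f x \<in> N" using N(2) by auto
      obtain e where e: "e > 0" "\<And>y. rhoX (f x) y < ennreal e \<Longrightarrow> y \<in> N"
        by (rule rhoX_escape[OF N(1) x(3)]) blast
      obtain N' where N': "openin X N'" "x \<in> N'" "\<And>y. y \<in> N' \<Longrightarrow> rhoX x y < ennreal e"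
        by (rule rhoX_small[OF x(2) e(1)]) blast
      have "f y \<in> W" if y: "y \<in> N'" "y \<in> ?B" for y
      proof -
        have "rhoX (f x) (f y) \<le> rho_sub M Z (f x) (f y)"
          by (rule rhoX_le_rho_sub[OF Z]) (use fC x(1) y(2) CZ in blast)+
        also have "\<dots> < ennreal e" unfolding rho[OF x(1) y(2)] by (rule N'(3)[OF y(1)])
        finally have "f y \<in> N" by (rule e(2))
        then show ?thesis using N(2) fC y(2) by blast
      qed
      then have "N' \<inter> ?B \<subseteq> {x \<in> topspace (subtopology X ?B). f x \<in> W}" using BX by auto
      moreover have "openin (subtopology X ?B) (N' \<inter> ?B)" using N'(1) by (auto simp: openin_subtopology)
      ultimately show "\<exists>T. openin (subtopology X ?B) T \<and> x \<in> T \<and>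
          T \<subseteq> {x \<in> topspace (subtopology X ?B). f x \<in> W}"
        using N'(2) x(1) by (intro exI[of _ "N' \<inter> ?B"]) blast
    qed
  qed
  moreover have "compact_space (subtopology X ?B)"
    using compactin_Bd by (simp add: compact_space_subtopology)
  moreover have "Hausdorff_space (subtopology X ?C)" by (rule Hausdorff_space_subtopology[OF Hausdorff_X])
  moreover have "f ` topspace (subtopology X ?B) = topspace (subtopology X ?C)" "inj_on f (topspace (subtopology X ?B))"
    using fC inj BX CX by (simp_all add: Int_absorb1)
  ultimately have hm: "homeomorphic_map (subtopology X ?B) (subtopology X ?C) f"
    using continuous_imp_homeomorphic_map by blast
  obtain a where a: "a \<in> ?B" "f a = p" using p unfolding fC[symmetric] by blast
  have e2: "\<epsilon> / 2 > 0" and aX: "a \<in> topspace X" using \<epsilon> a(1) BX by auto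
  obtain N' where N': "openin X N'" "a \<in> N'" "\<And>y. y \<in> N' \<Longrightarrow> rhoX a y < ennreal (\<epsilon> / 2)"
    by (rule rhoX_small[OF aX e2]) blast
  have "openin (subtopology X ?B) (N' \<inter> ?B)" using N'(1) by (auto simp: openin_subtopology)
  then have "openin (subtopology X ?C) (f ` (N' \<inter> ?B))"
    using homeomorphic_map_openness_eq[OF hm] by blast
  then obtain N where N: "openin X N" "f ` (N' \<inter> ?B) = N \<inter> ?C" by (auto simp: openin_subtopology)
  have "rho_sub M Z q q' < ennreal \<epsilon>" if q: "q \<in> N \<inter> ?C" "q' \<in> N \<inter> ?C" for q q'
  proof -
    obtain y y' where y: "y \<in> N' \<inter> ?B" "q = f y" "y' \<in> N' \<inter> ?B" "q' = f y'"
      using q unfolding N(2)[symmetric] by blast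
    have yB: "y \<in> ?B" "y' \<in> ?B" using y by auto
    have "rhoX y y' \<le> rhoX y a + rhoX a y'" by (rule rhoX_triangle)
    also have "\<dots> < ennreal (\<epsilon> / 2) + ennreal (\<epsilon> / 2)"
      using N'(3)[of y] N'(3)[of y'] y rhoX_sym[of y a] by (intro add_strict_mono) auto
    also have "\<dots> = ennreal \<epsilon>" using \<epsilon> by (simp flip: ennreal_plus)
    finally show ?thesis unfolding y(2,4) rho[OF yB] .
  qed
  moreover have "p \<in> N" using N(2) a N'(2) by blast
  ultimately show ?thesis using N(1) by blast
qed

lemma strictly_convex_if_isometric_boundary:
  assumes sc: "strictly_convex M Y"
    and Z: "Z \<subseteq> topspace X" "surface_with_boundary (subtopology X Z)"
    and fin: "\<And>x y. x \<in> Z \<Longrightarrow> y \<in> Z \<Longrightarrow> rho_sub M Z x y < \<infinity>"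
    and f: "bij_betw f (Bd_of M Y) (Bd_of M Z)"
    and iso: "\<And>x y. x \<in> Bd_of M Y \<Longrightarrow> y \<in> Bd_of M Y \<Longrightarrow> rho_sub M Z (f x) (f y) = rho_sub M Y x y"
  shows "strictly_convex M Z"
  unfolding strictly_convex_def
proof (intro ballI allI impI)
  fix \<alpha> \<beta> \<gamma> assume sp: "shortest_path M Z \<alpha> \<beta> \<gamma>"
  let ?B = "Bd_of M Y" and ?C = "Bd_of M Z" and ?rho = "rho_sub M Z"
  have BY: "?B \<subseteq> Y" using Bd_eq Y_subset by auto
  have fB: "f ` ?B = ?C" using f by (rule bij_betw_imp_surj_on)
  \<comment> \<open>An inequality suffices for q, r, q': after transport to \<open>Y1\<close>, the
    opposite one is the triangle inequality for \<open>rhoX\<close>.\<close>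
  have no_between: False
    if q: "q \<in> ?C" "r \<in> ?C" "q' \<in> ?C" "q \<noteq> r" "r \<noteq> q'" "?rho q r + ?rho r q' \<le> ?rho q q'" for q r q'
  proof -
    obtain a b c where abc: "a \<in> ?B" "f a = q" "b \<in> ?B" "f b = q'" "c \<in> ?B" "f c = r"
      using q(1-3) unfolding fB[symmetric] by blast
    have Y3: "a \<in> Y" "b \<in> Y" "c \<in> Y" using abc BY by auto
    have "rhoX a c = ?rho q r" "rhoX c b = ?rho r q'" "rhoX a b = ?rho q q'"
      using iso[OF abc(1,5)] iso[OF abc(5,3)] iso[OF abc(1,3)] abc(2,4,6)
        rho_eq[OF Y3(1,3)] rho_eq[OF Y3(3,2)] rho_eq[OF Y3(1,2)] by simp_all
    then have "rhoX a b = rhoX a c + rhoX c b"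
      using q(6) rhoX_triangle[of a b c] by (intro antisym) auto
    moreover have "a \<noteq> c" "c \<noteq> b" using abc q(4,5) by auto
    ultimately obtain \<delta> where "shortest_path M Y a b \<delta>" "c \<in> \<delta> ` {0<..<1}"
      using shortest_path_through[OF Y3] by metis
    then have "c \<in> Int_of M Y" using sc Y3 unfolding strictly_convex_def by blast
    then show False using abc(5) Bd_eq[OF Y_subset] by auto
  qed
  have \<gamma>: "continuous_map (top_of_set {0..1}) (subtopology X Z) \<gamma>"
    using sp unfolding shortest_path_def pathin_def by blast
  have \<gamma>Z: "\<gamma> s \<in> Z" if "s \<in> {0..1}" for s
    using sp that unfolding shortest_path_def pathin_subtopology by blast
  obtain \<phi> :: "real \<Rightarrow> real" where \<phi>: "strict_mono_on {0..1} \<phi>"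
    and len: "\<And>s t. 0 \<le> s \<Longrightarrow> s \<le> t \<Longrightarrow> t \<le> 1 \<Longrightarrow> ?rho (\<gamma> s) (\<gamma> t) = ennreal (\<phi> t - \<phi> s)"
    using sp unfolding shortest_path_def by blast
  have \<phi>mono: "\<phi> s \<le> \<phi> t" if "0 \<le> s" "s \<le> t" "t \<le> 1" for s t
    using strict_mono_on_leD[OF \<phi>, of s t] that by auto
  have add: "?rho (\<gamma> s) (\<gamma> u) = ?rho (\<gamma> s) (\<gamma> t) + ?rho (\<gamma> t) (\<gamma> u)"
    if "0 \<le> s" "s \<le> t" "t \<le> u" "u \<le> 1" for s t u
    using that \<phi>mono[of s t] \<phi>mono[of t u] len[of s t] len[of t u] len[of s u] by (simp flip: ennreal_plus)
  \<comment> \<open>The self-distance of a boundary point of Z is 0 by transport from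
    \<open>rhoX\<close>; this contradicts strict growth of \<phi> if \<gamma> returns to it.\<close>
  have neq: "\<gamma> s \<noteq> \<gamma> t" if st: "0 \<le> s" "s < t" "t \<le> 1" and "\<gamma> s \<in> ?C" for s t
  proof
    assume eq: "\<gamma> s = \<gamma> t"
    obtain a where a: "a \<in> ?B" "f a = \<gamma> s"
      using \<open>\<gamma> s \<in> ?C\<close> unfolding fB[symmetric] by auto
    then have aY: "a \<in> Y" using BY by auto
    have "?rho (\<gamma> s) (\<gamma> s) = rhoX a a" using iso[OF a(1) a(1)] rho_eq[OF aY aY] a(2) by simp
    also have "\<dots> = 0" using rhoX_self aY Y_subset by blast
    finally have "ennreal (\<phi> t - \<phi> s) = 0" using len[of s t] st eq by simp
    moreover have "\<phi> s < \<phi> t" using \<phi> st by (auto simp: strict_mono_on_def)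
    ultimately show False by (simp add: ennreal_eq_0_iff)
  qed
  have no_three: False
    if "0 \<le> s" "s < t" "t < u" "u \<le> 1" "\<gamma> s \<in> ?C" "\<gamma> t \<in> ?C" "\<gamma> u \<in> ?C" for s t u
    by (rule no_between[of "\<gamma> s" "\<gamma> t" "\<gamma> u"])
      (use that neq[of s t] neq[of t u] add[of s t u] in auto)
  show "\<gamma> ` {0<..<1} \<subseteq> Int_of M Z"
  proof (rule ccontr)
    assume "\<not> ?thesis"
    then obtain t0 where "t0 \<in> {0<..<1}" and tI: "\<gamma> t0 \<notin> Int_of M Z" by blast
    then have t0: "0 < t0" "t0 < 1" by simp_all
    then have pC: "\<gamma> t0 \<in> ?C" using \<gamma>Z[of t0] tI unfolding Bd_eq[OF Z(1)] by simp
    \<comment> \<open>Two contacts on the same side of t0 would, together with t0, be three. So each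
      side has at most one, and t0 is isolated among the contacts.\<close>
    define T1 where "T1 = {s. 0 \<le> s \<and> s < t0 \<and> \<gamma> s \<in> ?C}"
    define T2 where "T2 = {s. t0 < s \<and> s \<le> 1 \<and> \<gamma> s \<in> ?C}"
    have "finite T1"
    proof (cases "T1 = {}")
      case False
      then obtain s1 where s1: "s1 \<in> T1" by blast
      have "s = s1" if "s \<in> T1" for s
        using no_three[of s s1 t0] no_three[of s1 s t0] that s1 pC t0 unfolding T1_def
        by (cases s s1 rule: linorder_cases) auto
      then have "T1 \<subseteq> {s1}" by blast
      then show ?thesis by (rule finite_subset) simp
    qed simp
    moreover have "finite T2"
    proof (cases "T2 = {}")
      case False
      then obtain s1 where s1: "s1 \<in> T2" by blast
      have "s = s1" if "s \<in> T2" for s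
        using no_three[of t0 s s1] no_three[of t0 s1 s] that s1 pC t0 unfolding T2_def
        by (cases s s1 rule: linorder_cases) auto
      then have "T2 \<subseteq> {s1}" by blast
      then show ?thesis by (rule finite_subset) simp
    qed simp
    ultimately have "finite (T1 \<union> T2)" by simp
    from finite_set_avoid[OF this, of t0] obtain e where e: "e > 0"
      "\<And>s. s \<in> T1 \<union> T2 \<Longrightarrow> s \<noteq> t0 \<Longrightarrow> e \<le> dist t0 s" by blast
    define t1 where "t1 = max 0 (t0 - e / 2)"
    define t2 where "t2 = min 1 (t0 + e / 2)"
    have t12: "0 \<le> t1" "t1 < t0" "t0 < t2" "t2 \<le> 1" "t0 - e < t1" "t2 < t0 + e"
      using t0 e(1) by (auto simp: t1_def t2_def)
    have int: "\<gamma> s \<in> Int_of M Z" if s: "s \<in> {t1..t2}" "s \<noteq> t0" for s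
    proof (rule ccontr)
      assume "\<gamma> s \<notin> Int_of M Z"
      moreover have s01: "s \<in> {0..1}" using s(1) t12 by auto
      ultimately have "\<gamma> s \<in> ?C" using \<gamma>Z[OF s01] Bd_eq[OF Z(1)] by auto
      then have "s \<in> T1 \<union> T2" using s s01 by (auto simp: T1_def T2_def)
      from e(2)[OF this s(2)] show False
        using s(1) t12 by (auto simp: dist_real_def abs_if split: if_splits)
    qed
    have sp: "?rho (\<gamma> s) (\<gamma> t) = ?rho (\<gamma> s) (\<gamma> t0) + ?rho (\<gamma> t0) (\<gamma> t)"
      if "s \<in> {t1..t0}" "t \<in> {t0..t2}" for s t
      by (rule add) (use that t12 in auto)
    obtain q q' where "q \<in> ?C" "q' \<in> ?C" "q \<noteq> \<gamma> t0" "q' \<noteq> \<gamma> t0"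
      "?rho q (\<gamma> t0) + ?rho (\<gamma> t0) q' \<le> ?rho q q'"
      by (rule boundary_detour[OF Z fin \<gamma> t12(1-4) refl pC int sp
            isometric_boundary_continuous[OF Z(1) f iso pC]])
    then show False using no_between[of q "\<gamma> t0" q'] pC by blast
  qed
qed

end

theorem corollary3p1:
  fixes M :: "'a surface" and Y1 Y2 :: "'a set"
  assumes "connected_riemannian_surface M"
    and "compact_connected_C0_submanifold M Y1" and "Bd_of M Y1 \<noteq> {}"
    and "\<forall>x\<in>Y1. \<forall>y\<in>Y1. rho_sub M Y1 x y < \<infinity>"
    and "strictly_convex M Y1"
    and "compact_connected_C0_submanifold M Y2" and "Bd_of M Y2 \<noteq> {}"
    and "\<forall>x\<in>Y2. \<forall>y\<in>Y2. rho_sub M Y2 x y < \<infinity>"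
    and "\<exists>f. bij_betw f (Bd_of M Y1) (Bd_of M Y2) \<and>
          (\<forall>x\<in>Bd_of M Y1. \<forall>y\<in>Bd_of M Y1. rho_sub M Y2 (f x) (f y) = rho_sub M Y1 x y)"
    and "\<forall>Y. compact_connected_C0_submanifold M Y \<and> Bd_of M Y \<noteq> {} \<and>
          (\<forall>x\<in>Y. \<forall>y\<in>Y. rho_sub M Y x y < \<infinity>) \<and> strictly_convex M Y \<longrightarrow>
          (\<forall>x\<in>Y. \<forall>y\<in>Y. rho_space M x y = rho_sub M Y x y)"
  shows "\<exists>F. bij_betw F (Bd_of M Y1) (Bd_of M Y2) \<and>
          (\<forall>x\<in>Bd_of M Y1. \<forall>y\<in>Bd_of M Y1. rho_space M (F x) (F y) = rho_space M x y)"
proof -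
  have eq1: "\<forall>x\<in>Y1. \<forall>y\<in>Y1. rho_space M x y = rho_sub M Y1 x y"
    using spec[OF assms(10), of Y1] assms(2-5) by blast
  have Y1: "Y1 \<subseteq> topspace (space_of M)" "compactin (space_of M) Y1"
    using assms(2) by (auto simp: compact_connected_C0_submanifold_def)
  \<comment> \<open>\<open>Y1\<close> is strictly convex by assumption, so the hypothesis on X
    applies to it now; for \<open>Y2\<close> it becomes applicable only after strict convexity has
    been transferred.\<close>
  interpret intrinsic_domain M Y1
    by unfold_locales (use assms(1,4) Y1 eq1 in blast)+
  obtain f where f: "bij_betw f (Bd_of M Y1) (Bd_of M Y2)"
    and iso: "\<And>x y. x \<in> Bd_of M Y1 \<Longrightarrow> y \<in> Bd_of M Y1 \<Longrightarrow> rho_sub M Y2 (f x) (f y) = rho_sub M Y1 x y"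
    using assms(9) by blast
  have Y2: "Y2 \<subseteq> topspace X" "surface_with_boundary (subtopology X Y2)"
    using assms(6) by (auto simp: compact_connected_C0_submanifold_def)
  have fin2: "\<And>x y. x \<in> Y2 \<Longrightarrow> y \<in> Y2 \<Longrightarrow> rho_sub M Y2 x y < \<infinity>" using assms(8) by blast
  have "strictly_convex M Y2"
    by (rule strictly_convex_if_isometric_boundary[OF assms(5) Y2 fin2 f iso])
  then have eq2: "\<forall>x\<in>Y2. \<forall>y\<in>Y2. rho_space M x y = rho_sub M Y2 x y"
    using spec[OF assms(10), of Y2] assms(6-8) by blast
  have sub: "Bd_of M Y1 \<subseteq> Y1" "Bd_of M Y2 \<subseteq> Y2" using Bd_eq Y_subset Y2(1) by auto
  have "rho_space M (f x) (f y) = rho_space M x y" if xy: "x \<in> Bd_of M Y1" "y \<in> Bd_of M Y1" for x y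
  proof -
    have "f x \<in> Bd_of M Y2" "f y \<in> Bd_of M Y2" using f xy by (auto simp: bij_betw_def)
    then have "rho_space M (f x) (f y) = rho_sub M Y2 (f x) (f y)" using eq2 sub(2) by blast
    also have "\<dots> = rho_sub M Y1 x y" by (rule iso[OF xy])
    also have "\<dots> = rho_space M x y" using eq1 sub(1) xy by (metis subsetD)
    finally show ?thesis .
  qed
  then show ?thesis using f by blast
qed

end
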